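(* Let $B:=B_+(V)$ and let $\eta:V\otimes V\to\mathbb{C}D$ be a morphism in the category of right $H$-comodules as described in the context. Then $$L_\pm=B\otimes\mathbb{C}D,\qquad b.(c\otimes D)=bc\otimes D,\qquad (c\otimes D).b=c\,\Psi^{\mp1}(D\otimes b)$$ are $B$-bimodules for which the image of $\eta$ is braided-commutative in the required way (that is, $\eta(x).b=\Psi^{\mp1}(\eta(x)\otimes b)$ in $L_\pm$ for all $x\in V\otimes V$, $b\in B$), and $\eta$ gives bimodule maps $$\psi_+:\Omega^{1,0}\otimes_B\Omega^{1,0}\to L_+,\qquad \psi_-:\Omega^{0,1}\otimes_B\Omega^{0,1}\to L_-.$$
   Context: Setting: the category of right comodules of a coquasitriangular Hopf algebra $H=G\otimes\mathbb{C}[t,t^{-1}]$, where $G$ is a coquasitriangular Hopf algebra, $t$ is grouplike, and the coquasitriangular structure is extended by $\mathcal R(t^m,t^n)=q^{\alpha mn}$. The braiding is $\Psi(v\otimes w)=w_0\otimes v_0\,\mathcal R(v_1,w_1)$. $G$ right coacts on $V$, and $H$ right coacts on $V$ by this coaction with an extra $\otimes t$. Let $\eta:V\otimes V\to\mathbb{C}$ be invariant under $G$, let $\mathbb{C}D$ be the 1-dimensional $H$-comodule with $\Delta_RD=D\otimes1\otimes t^2$, and regard $\eta$ (tensored by $D$) as a map $\eta:V\otimes V\to\mathbb{C}D$, which is then a morphism of $H$-comodules. Here $\Psi^{\pm 1}(D\otimes b)\in B\otimes\mathbb{C}D$; explicitly the right actions are $(b\otimes D).c=q^{\mp2\alpha|c|}bc\otimes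 D$ with $|c|$ the degree of $c\in B_+(V)$. $B_+(V)=TV/\oplus_n\ker[n,\Psi]!$ where $[n,\Psi]!=\sum_{\sigma\in S_n}\Psi_\sigma$ on $V^{\otimes n}$ (via reduced expressions). $\Omega^{1,0}=V\otimes B$ has right action by multiplication and left action $b.(v\otimes c)=\Psi_{B,V}(b\otimes v)c$; $\Omega^{0,1}=B\otimes V$ has left action by multiplication and right action $(c\otimes v).b=c\,\Psi_{V,B}(v\otimes b)$. For $L=L_\pm$ set $\phi_-(a\otimes v\otimes w\otimes b)=a.\eta(v\otimes w).b\in L$ on $B\otimes V\otimes V\otimes B$ (with $\mathbb{C}D\subset L$ as $1\otimes D$). Then $\psi_+=\phi_-\circ(\Psi_{B,V}^{-1}\otimes\mathrm{id})$ on $\Omega^{1,0}\otimes\Omega^{1,0}$ with $L=L_+$, and $\psi_-=\phi_-\circ(\mathrm{id}\otimes\Psi_{V,B}^{-1})$ on $\Omega^{0,1}\otimes\Omega^{0,1}$ with $L=L_-$; the claim is that these are bimodule maps descending to $\otimes_B$. *)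

theory Defs
  imports
    "HOL-Analysis.Complex_Transcendental"
    "HOL-Library.Poly_Mapping"
    "HOL-Combinatorics.Permutations"
begin

section \<open>Complex vector spaces and algebras\<close>

class complex_vec = ab_group_add +
  fixes cscale :: "complex \<Rightarrow> 'a \<Rightarrow> 'a"  (infixr "*\<^sub>C" 75)
  assumes cscale_add_right: "c *\<^sub>C (x + y) = c *\<^sub>C x + c *\<^sub>C y"
    and cscale_add_left: "(c + d) *\<^sub>C x = c *\<^sub>C x + d *\<^sub>C x"
    and cscale_cscale: "c *\<^sub>C (d *\<^sub>C x) = (c * d) *\<^sub>C x"
    and cscale_one: "1 *\<^sub>C x = x"

global_interpretation cvec: vector_space "cscale :: complex \<Rightarrow> 'a \<Rightarrow> 'a::complex_vec"
  by unfold_locales (simp_all add: cscale_add_right cscale_add_left cscale_cscale cscale_one)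

abbreviation clinear :: "('a::complex_vec \<Rightarrow> 'b::complex_vec) \<Rightarrow> bool"
  where "clinear \<equiv> Vector_Spaces.linear cscale cscale"

definition cbilinear :: "('a::complex_vec \<Rightarrow> 'b::complex_vec \<Rightarrow> 'c::complex_vec) \<Rightarrow> bool"
  where "cbilinear f \<longleftrightarrow> (\<forall>x. clinear (f x)) \<and> (\<forall>y. clinear (\<lambda>x. f x y))"

class complex_alg = complex_vec + ring_1 +
  assumes cscale_mult_left: "(c *\<^sub>C x) * y = c *\<^sub>C (x * y)"
    and cscale_mult_right: "x * (c *\<^sub>C y) = c *\<^sub>C (x * y)"

instantiation complex :: complex_alg
begin
definition cscale_complex :: "complex \<Rightarrow> complex \<Rightarrow> complex"
  where "cscale_complex = (*)"
instance
  by standard (auto simp: cscale_complex_def algebra_simps)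
end

lemma clinear_iff:
  "clinear f \<longleftrightarrow> (\<forall>x y. f (x + y) = f x + f y) \<and> (\<forall>c x. f (c *\<^sub>C x) = c *\<^sub>C f x)"
  by (auto simp: Vector_Spaces.linear_iff cvec.vector_space_axioms)

lemma clinearI:
  assumes "\<And>x y. f (x + y) = f x + f y" "\<And>c x. f (c *\<^sub>C x) = c *\<^sub>C f x"
  shows "clinear f"
  using assms by (simp add: clinear_iff)

lemma clinear_add: "clinear f \<Longrightarrow> f (x + y) = f x + f y"
  and clinear_scale: "clinear f \<Longrightarrow> f (c *\<^sub>C x) = c *\<^sub>C f x"
  by (simp_all add: clinear_iff)

lemma clinear_zero: "clinear f \<Longrightarrow> f 0 = 0"
  using clinear_scale[of f 0 0] by simp

lemma clinear_diff: "clinear f \<Longrightarrow> f (x - y) = f x - f y"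
  using clinear_add[of f "x - y" y] by (simp add: algebra_simps)

lemma clinear_compose: "clinear f \<Longrightarrow> clinear g \<Longrightarrow> clinear (\<lambda>x. g (f x))"
  by (simp add: clinear_iff)

definition algebra_hom :: "('a::complex_alg \<Rightarrow> 'b::complex_alg) \<Rightarrow> bool"
  where "algebra_hom f \<longleftrightarrow> clinear f \<and> f 1 = 1 \<and> (\<forall>x y. f (x * y) = f x * f y)"

text \<open>
  Types cannot depend on terms, so a quotient by a subspace \<open>N\<close> is given by its projection: a
  surjective linear map with kernel exactly \<open>N\<close>. The map out of the quotient induced by a map \<open>f\<close>
  that is constant on the fibres of \<open>p\<close> is \<open>f\<close> evaluated on a representative.
\<close>

definition quotient_projection :: "('a::complex_vec \<Rightarrow> 'b::complex_vec) \<Rightarrow> 'a set \<Rightarrow> bool"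
  where "quotient_projection p N \<longleftrightarrow> clinear p \<and> surj p \<and> {x. p x = 0} = N"

definition descend :: "('a \<Rightarrow> 'b) \<Rightarrow> ('a \<Rightarrow> 'c) \<Rightarrow> 'b \<Rightarrow> 'c"
  where "descend p f b = f (SOME x. p x = b)"


section \<open>Free vector spaces\<close>

instantiation poly_mapping :: (type, complex_vec) complex_vec
begin
lift_definition cscale_poly_mapping :: "complex \<Rightarrow> ('a \<Rightarrow>\<^sub>0 'b) \<Rightarrow> ('a \<Rightarrow>\<^sub>0 'b)"
  is "\<lambda>c f k. c *\<^sub>C f k"
  by (erule finite_subset[rotated]) auto
instance
  by standard (transfer; auto simp: fun_eq_iff algebra_simps cvec.scale_left_distrib
      cvec.scale_right_distrib)+
end

lemma lookup_cscale:
  "poly_mapping.lookup (c *\<^sub>C p) k = c *\<^sub>C poly_mapping.lookup p k"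
  by transfer simp


lemma poly_mapping_sum_single:
  "(\<Sum>k\<in>Poly_Mapping.keys p. Poly_Mapping.single k (poly_mapping.lookup p k)) = p"
  by (rule poly_mapping_eqI)
    (auto simp: lookup_sum lookup_single when_def if_distrib sum.delta in_keys_iff cong: if_cong)

lemma poly_mapping_induct_single:
  fixes p :: "'a \<Rightarrow>\<^sub>0 'b::comm_monoid_add"
  assumes zero: "P 0" and single: "\<And>k a. P (Poly_Mapping.single k a)"
    and add: "\<And>x y. P x \<Longrightarrow> P y \<Longrightarrow> P (x + y)"
  shows "P p"
proof -
  have "P (\<Sum>k\<in>K. Poly_Mapping.single k (poly_mapping.lookup p k))" if "finite K" for K
    using that by (induction K) (auto intro: assms)
  from this[OF finite_keys[of p]] show ?thesis
    by (simp add: poly_mapping_sum_single)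
qed

lemma cscale_single: "c *\<^sub>C Poly_Mapping.single k a = Poly_Mapping.single k (c *\<^sub>C a)"
  by (rule poly_mapping_eqI) (simp add: lookup_cscale lookup_single when_def)

instance poly_mapping :: (monoid_add, complex_alg) complex_alg
proof
  fix c and x y :: "'a \<Rightarrow>\<^sub>0 'b"
  have L: "(c *\<^sub>C Poly_Mapping.single k a) * y = c *\<^sub>C (Poly_Mapping.single k a * y)" for k a
    by (induction y rule: poly_mapping_induct_single)
      (simp_all add: cscale_single mult_single cscale_mult_left distrib_left cscale_add_right)
  show "(c *\<^sub>C x) * y = c *\<^sub>C (x * y)"
    by (induction x rule: poly_mapping_induct_single)
      (simp_all add: L distrib_right cscale_add_right)
  have R: "Poly_Mapping.single k a * (c *\<^sub>C y) = c *\<^sub>C (Poly_Mapping.single k a * y)" for k a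
    by (induction y rule: poly_mapping_induct_single)
      (simp_all add: cscale_single mult_single cscale_mult_right distrib_left cscale_add_right)
  show "x * (c *\<^sub>C y) = c *\<^sub>C (x * y)"
    by (induction x rule: poly_mapping_induct_single)
      (simp_all add: R distrib_right cscale_add_right)
qed

definition free_extend :: "('i \<Rightarrow> 'a::complex_vec) \<Rightarrow> ('i \<Rightarrow>\<^sub>0 complex) \<Rightarrow> 'a"
  where "free_extend f p = (\<Sum>i\<in>Poly_Mapping.keys p. poly_mapping.lookup p i *\<^sub>C f i)"

lemma free_extend_superset:
  assumes "finite K" "Poly_Mapping.keys p \<subseteq> K"
  shows "free_extend f p = (\<Sum>i\<in>K. poly_mapping.lookup p i *\<^sub>C f i)"
  unfolding free_extend_def using assms
  by (intro sum.mono_neutral_left) (auto simp: in_keys_iff)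

lemma clinear_free_extend:
  fixes f :: "'i \<Rightarrow> 'a::complex_vec"
  shows "clinear (free_extend f)"
proof (rule clinearI)
  fix x y :: "'i \<Rightarrow>\<^sub>0 complex" and c
  let ?K = "Poly_Mapping.keys x \<union> Poly_Mapping.keys y"
  have "free_extend f (x + y) = (\<Sum>i\<in>?K. poly_mapping.lookup (x + y) i *\<^sub>C f i)"
    by (rule free_extend_superset) (auto dest: subsetD[OF Poly_Mapping.keys_add])
  also have "\<dots> = free_extend f x + free_extend f y"
    by (simp add: free_extend_superset[of ?K] lookup_add cscale_add_left sum.distrib)
  finally show "free_extend f (x + y) = free_extend f x + free_extend f y" .
  have "free_extend f (c *\<^sub>C x)
      = (\<Sum>i\<in>Poly_Mapping.keys x. poly_mapping.lookup (c *\<^sub>C x) i *\<^sub>C f i)"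
    by (rule free_extend_superset) (auto simp: in_keys_iff lookup_cscale)
  then show "free_extend f (c *\<^sub>C x) = c *\<^sub>C free_extend f x"
    by (simp add: free_extend_def lookup_cscale cvec.scale_sum_right cscale_complex_def)
qed

lemma free_extend_single: "free_extend f (Poly_Mapping.single i 1) = f i"
  by (simp add: free_extend_def cscale_one)

lemma free_induct:
  fixes p :: "'i \<Rightarrow>\<^sub>0 complex"
  assumes "\<And>i. P (Poly_Mapping.single i 1)" "\<And>x y. P x \<Longrightarrow> P y \<Longrightarrow> P (x + y)"
    and sc: "\<And>c x. P x \<Longrightarrow> P (c *\<^sub>C x)"
  shows "P p"
proof (induction p rule: poly_mapping_induct_single)
  case (2 k a)
  then show ?case
    using sc[OF assms(1), of a k] by (simp add: cscale_single cscale_complex_def)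
next
  case 1
  then show ?case
    using sc[OF assms(1), of 0] by simp
qed (use assms in auto)

lemma span_vanish:
  assumes "clinear f" "\<And>x. x \<in> S \<Longrightarrow> f x = 0" "x \<in> cvec.span S"
  shows "f x = 0"
  using assms(3)
  by (induction rule: cvec.span_induct_alt)
    (auto simp: clinear_zero[OF assms(1)] clinear_add[OF assms(1)] clinear_scale[OF assms(1)] assms(2))


section \<open>Tensor products\<close>

text \<open>The tensor product is the free vector space on pairs modulo the bilinearity relations.\<close>

definition tensor_relations :: "('a::complex_vec \<times> 'b::complex_vec \<Rightarrow>\<^sub>0 complex) set" where
  "tensor_relations =
     {Poly_Mapping.single (a + a', b) 1 - Poly_Mapping.single (a, b) 1
        - Poly_Mapping.single (a', b) 1 | a a' b. True}
   \<union> {Poly_Mapping.single (a, b + b') 1 - Poly_Mapping.single (a, b) 1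
        - Poly_Mapping.single (a, b') 1 | a b b'. True}
   \<union> {Poly_Mapping.single (c *\<^sub>C a, b) 1 - c *\<^sub>C Poly_Mapping.single (a, b) 1 | c a b. True}
   \<union> {Poly_Mapping.single (a, c *\<^sub>C b) 1 - c *\<^sub>C Poly_Mapping.single (a, b) 1 | c a b. True}"

lemma equivp_mod_span: "equivp (\<lambda>x y. x - y \<in> cvec.span S)"
proof (rule equivpI)
  show "reflp (\<lambda>x y. x - y \<in> cvec.span S)"
    by (simp add: reflp_def cvec.span_zero)
  show "symp (\<lambda>x y. x - y \<in> cvec.span S)"
    by (rule sympI) (drule cvec.span_neg, simp)
  show "transp (\<lambda>x y. x - y \<in> cvec.span S)"
    by (rule transpI) (drule (1) cvec.span_add, simp)
qed

quotient_type (overloaded) ('a, 'b) tensor =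
    "'a::complex_vec \<times> 'b::complex_vec \<Rightarrow>\<^sub>0 complex" /
    "\<lambda>x y. x - y \<in> cvec.span tensor_relations"
  by (rule equivp_mod_span)

type_notation tensor (infixr "\<otimes>" 80)

instantiation tensor :: (complex_vec, complex_vec) complex_vec
begin
lift_definition zero_tensor :: "'a \<otimes> 'b" is 0 .
lift_definition plus_tensor :: "'a \<otimes> 'b \<Rightarrow> 'a \<otimes> 'b \<Rightarrow> 'a \<otimes> 'b" is "(+)"
  by (drule (1) cvec.span_add) (simp add: algebra_simps)
lift_definition minus_tensor :: "'a \<otimes> 'b \<Rightarrow> 'a \<otimes> 'b \<Rightarrow> 'a \<otimes> 'b" is "(-)"
  by (drule (1) cvec.span_diff) (simp add: algebra_simps)
lift_definition uminus_tensor :: "'a \<otimes> 'b \<Rightarrow> 'a \<otimes> 'b" is uminus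
  by (drule cvec.span_neg) (simp add: algebra_simps)
lift_definition cscale_tensor :: "complex \<Rightarrow> 'a \<otimes> 'b \<Rightarrow> 'a \<otimes> 'b" is "cscale"
  by (simp add: cvec.span_scale flip: cvec.scale_right_diff_distrib)
instance
proof
  fix x y z :: "'a \<otimes> 'b" and c d :: complex
  show "x + y + z = x + (y + z)"
    by transfer (simp add: add.assoc cvec.span_zero)
  show "x + y = y + x"
    by transfer (simp add: add.commute cvec.span_zero)
  show "0 + x = x"
    by transfer (simp add: cvec.span_zero)
  show "- x + x = 0"
    by transfer (simp add: cvec.span_zero)
  show "x - y = x + - y"
    by transfer (simp add: cvec.span_zero)
  show "c *\<^sub>C (x + y) = c *\<^sub>C x + c *\<^sub>C y"
    by transfer (simp add: cscale_add_right cvec.span_zero)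
  show "(c + d) *\<^sub>C x = c *\<^sub>C x + d *\<^sub>C x"
    by transfer (simp add: cscale_add_left cvec.span_zero)
  show "c *\<^sub>C (d *\<^sub>C x) = (c * d) *\<^sub>C x"
    by transfer (simp add: cvec.span_zero)
  show "1 *\<^sub>C x = x"
    by transfer (simp add: cvec.span_zero)
qed
end

lift_definition pure_tensor :: "'a::complex_vec \<Rightarrow> 'b::complex_vec \<Rightarrow> 'a \<otimes> 'b" (infixr "\<otimes>" 80)
  is "\<lambda>a b. Poly_Mapping.single (a, b) 1" .

text \<open>
  For bilinear \<open>f\<close>, \<open>tensor_lift f\<close> is the unique linear map with \<open>a \<otimes> b \<mapsto> f a b\<close>. With a coproduct or
  coaction as last argument it plays the role of Sweedler notation: \<open>tensor_lift (\<lambda>v\<^sub>0 v\<^sub>1. F v\<^sub>0 v\<^sub>1) (\<delta> v)\<close>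
  is \<open>F v\<^sub>0 v\<^sub>1\<close>.
\<close>

definition tensor_lift ::
  "('a::complex_vec \<Rightarrow> 'b::complex_vec \<Rightarrow> 'c::complex_vec) \<Rightarrow> 'a \<otimes> 'b \<Rightarrow> 'c"
  where "tensor_lift f x = free_extend (\<lambda>(a, b). f a b) (rep_tensor x)"

definition tensor_map ::
  "('a::complex_vec \<Rightarrow> 'c::complex_vec) \<Rightarrow> ('b::complex_vec \<Rightarrow> 'd::complex_vec) \<Rightarrow> 'a \<otimes> 'b \<Rightarrow> 'c \<otimes> 'd"
  where "tensor_map f g = tensor_lift (\<lambda>a b. f a \<otimes> g b)"

definition tensor_assoc ::
  "('a::complex_vec \<otimes> 'b::complex_vec) \<otimes> 'c::complex_vec \<Rightarrow> 'a \<otimes> ('b \<otimes> 'c)"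
  where "tensor_assoc = tensor_lift (\<lambda>x c. tensor_lift (\<lambda>a b. a \<otimes> (b \<otimes> c)) x)"

lemma tensor_abs_cases:
  obtains p where "x = abs_tensor p"
  by (rule that[OF sym, OF Quotient3_abs_rep[OF Quotient3_tensor]])

lemma tensor_lift_abs:
  assumes "cbilinear f"
  shows "tensor_lift f (abs_tensor p) = free_extend (\<lambda>(a, b). f a b) p"
proof -
  let ?F = "free_extend (\<lambda>(a, b). f a b)"
  have f: "clinear (f x)" "clinear (\<lambda>x. f x y)" for x y
    using assms by (auto simp: cbilinear_def)
  note f_simps = clinear_add[OF f(1)] clinear_scale[OF f(1)]
    clinear_add[OF f(2)] clinear_scale[OF f(2)]
  have mem: "rep_tensor (abs_tensor p) - p \<in> cvec.span tensor_relations"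
    by (rule rep_abs_rsp_left[OF Quotient3_tensor]) (simp add: cvec.span_zero)
  have rel: "?F r = 0" if "r \<in> tensor_relations" for r
    using that unfolding tensor_relations_def
    by (elim UnE CollectE exE conjE)
      (simp_all only: clinear_diff[OF clinear_free_extend] clinear_scale[OF clinear_free_extend]
        free_extend_single prod.case f_simps cvec.scale_one add_diff_cancel_left' diff_self)
  have "?F (rep_tensor (abs_tensor p) - p) = 0"
    by (rule span_vanish[OF clinear_free_extend rel mem])
  then show ?thesis
    by (simp add: tensor_lift_def clinear_diff[OF clinear_free_extend])
qed

lemma tensor_lift_pure:
  assumes "cbilinear f"
  shows "tensor_lift f (a \<otimes> b) = f a b"
  by (simp add: pure_tensor.abs_eq tensor_lift_abs[OF assms] free_extend_single)

lemma clinear_tensor_lift: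
  assumes "cbilinear f"
  shows "clinear (tensor_lift f)"
proof (rule clinearI)
  fix x y :: "'a \<otimes> 'b" and c
  obtain p where p: "x = abs_tensor p"
    by (rule tensor_abs_cases)
  obtain r where r: "y = abs_tensor r"
    by (rule tensor_abs_cases)
  show "tensor_lift f (x + y) = tensor_lift f x + tensor_lift f y"
    unfolding p r plus_tensor.abs_eq tensor_lift_abs[OF assms]
    by (rule clinear_add[OF clinear_free_extend])
  show "tensor_lift f (c *\<^sub>C x) = c *\<^sub>C tensor_lift f x"
    unfolding p cscale_tensor.abs_eq tensor_lift_abs[OF assms]
    by (rule clinear_scale[OF clinear_free_extend])
qed

lemma pure_tensor_add_left: "(a + a') \<otimes> b = a \<otimes> b + a' \<otimes> b"
  by transfer (rule cvec.span_base, unfold tensor_relations_def diff_diff_add[symmetric], fast)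

lemma pure_tensor_add_right: "a \<otimes> (b + b') = a \<otimes> b + a \<otimes> b'"
  by transfer (rule cvec.span_base, unfold tensor_relations_def diff_diff_add[symmetric], fast)

lemma pure_tensor_scale_left: "(c *\<^sub>C a) \<otimes> b = c *\<^sub>C (a \<otimes> b)"
  by transfer (rule cvec.span_base, unfold tensor_relations_def, fast)

lemma pure_tensor_scale_right: "a \<otimes> (c *\<^sub>C b) = c *\<^sub>C (a \<otimes> b)"
  by transfer (rule cvec.span_base, unfold tensor_relations_def, fast)

lemmas pure_tensor_simps = pure_tensor_add_left pure_tensor_add_right
  pure_tensor_scale_left pure_tensor_scale_right

lemma cbilinear_pure: "cbilinear (\<otimes>)"
  unfolding cbilinear_def clinear_iff by (simp add: pure_tensor_simps)

lemma tensor_induct [case_names pure add]: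
  assumes pure: "\<And>a b. P (a \<otimes> b)" and add: "\<And>x y. P x \<Longrightarrow> P y \<Longrightarrow> P (x + y)"
  shows "P x"
proof -
  obtain p where x: "x = abs_tensor p"
    by (rule tensor_abs_cases)
  have "P (abs_tensor p)"
  proof (induction p rule: poly_mapping_induct_single)
    case 1
    have "abs_tensor 0 = (0 *\<^sub>C 0 :: 'a) \<otimes> (0 :: 'b)"
      unfolding pure_tensor_scale_left zero_tensor_def[symmetric] by simp
    with pure show ?case by metis
  next
    case (2 k a)
    have "abs_tensor (Poly_Mapping.single k a) = a *\<^sub>C (fst k \<otimes> snd k)"
      by (simp add: pure_tensor.abs_eq cscale_tensor.abs_eq cscale_single cscale_complex_def)
    then show ?case
      using pure[of "a *\<^sub>C fst k" "snd k"] by (simp add: pure_tensor_scale_left)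
  next
    case (3 x y)
    then show ?case
      using add[of "abs_tensor x" "abs_tensor y"] by (simp only: plus_tensor.abs_eq)
  qed
  then show ?thesis
    using x by simp
qed

lemma tensor_lift_eqI:
  assumes "clinear f" "clinear g" "\<And>a b. f (a \<otimes> b) = g (a \<otimes> b)"
  shows "f x = g x"
  by (induction x rule: tensor_induct)
    (simp_all add: assms clinear_add[OF assms(1)] clinear_add[OF assms(2)])

lemma exists_functional_nonzero:
  fixes a :: "'a::complex_vec"
  assumes "a \<noteq> 0"
  obtains f :: "'a \<Rightarrow> complex" where "clinear f" "f a = 1"
proof -
  interpret vector_space_pair "cscale :: complex \<Rightarrow> 'a \<Rightarrow> 'a" "cscale :: complex \<Rightarrow> complex \<Rightarrow> complex"
    by unfold_locales
  have "\<not> cvec.dependent {a}"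
    using assms by simp
  from linear_independent_extend[OF this, of "\<lambda>_. 1"] that show ?thesis
    by auto
qed

lemma pure_tensor_nonzero:
  assumes "a \<noteq> 0" "b \<noteq> 0"
  shows "a \<otimes> b \<noteq> 0"
proof
  assume *: "a \<otimes> b = 0"
  obtain f g where f: "clinear f" "f a = (1::complex)" and g: "clinear g" "g b = (1::complex)"
    using assms exists_functional_nonzero by metis
  have bl: "cbilinear (\<lambda>x y. f x * g y)"
    unfolding cbilinear_def clinear_iff
    by (simp add: clinear_add[OF f(1)] clinear_add[OF g(1)] clinear_scale[OF f(1)]
        clinear_scale[OF g(1)], simp add: cscale_complex_def algebra_simps)
  have "tensor_lift (\<lambda>x y. f x * g y) (a \<otimes> b) = 1"
    by (simp add: tensor_lift_pure[OF bl] f g)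
  then show False
    by (simp add: * clinear_zero[OF clinear_tensor_lift[OF bl]])
qed

instantiation tensor :: (complex_alg, complex_alg) complex_alg
begin

definition one_tensor :: "'a \<otimes> 'b"
  where "one_tensor = 1 \<otimes> 1"

definition times_tensor :: "'a \<otimes> 'b \<Rightarrow> 'a \<otimes> 'b \<Rightarrow> 'a \<otimes> 'b"
  where "x * y = tensor_lift (\<lambda>a b. tensor_lift (\<lambda>c d. (a * c) \<otimes> (b * d)) y) x"

lemma tensor_mult_aux:
  fixes a :: 'a and b :: 'b
  shows "cbilinear (\<lambda>c d. (a * c) \<otimes> (b * d))"
  by (auto simp: cbilinear_def clinear_iff distrib_left cscale_mult_right pure_tensor_simps)

lemma tensor_mult_aux2:
  fixes y :: "'a \<otimes> 'b"
  shows "cbilinear (\<lambda>a b. tensor_lift (\<lambda>c d. (a * c) \<otimes> (b * d)) y)"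
proof -
  have pure: "tensor_lift (\<lambda>c d. (a * c) \<otimes> (b * d)) (c \<otimes> d) = (a * c) \<otimes> (b * d)"
    for a c :: 'a and b d :: 'b
    by (rule tensor_lift_pure[OF tensor_mult_aux])
  have add: "tensor_lift (\<lambda>c d. (a * c) \<otimes> (b * d)) (x + y)
      = tensor_lift (\<lambda>c d. (a * c) \<otimes> (b * d)) x + tensor_lift (\<lambda>c d. (a * c) \<otimes> (b * d)) y"
    for x y :: "'a \<otimes> 'b" and a b
    by (rule clinear_add[OF clinear_tensor_lift[OF tensor_mult_aux]])
  show ?thesis
    unfolding cbilinear_def clinear_iff
  proof (intro conjI allI)
    fix a a' :: 'a and b b' :: 'b and c
    show "tensor_lift (\<lambda>c d. (a * c) \<otimes> ((b + b') * d)) y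
        = tensor_lift (\<lambda>c d. (a * c) \<otimes> (b * d)) y + tensor_lift (\<lambda>c d. (a * c) \<otimes> (b' * d)) y"
      by (induction y rule: tensor_induct) (simp_all only: pure add, simp_all add: distrib_right pure_tensor_simps)
    show "tensor_lift (\<lambda>d e. (a * d) \<otimes> ((c *\<^sub>C b) * e)) y
        = c *\<^sub>C tensor_lift (\<lambda>d e. (a * d) \<otimes> (b * e)) y"
      by (induction y rule: tensor_induct)
        (simp_all only: pure add, simp_all only: cscale_mult_left pure_tensor_simps cscale_add_right)
    show "tensor_lift (\<lambda>c d. ((a + a') * c) \<otimes> (b * d)) y
        = tensor_lift (\<lambda>c d. (a * c) \<otimes> (b * d)) y + tensor_lift (\<lambda>c d. (a' * c) \<otimes> (b * d)) y"
      by (induction y rule: tensor_induct) (simp_all only: pure add, simp_all add: distrib_right pure_tensor_simps)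
    show "tensor_lift (\<lambda>d e. ((c *\<^sub>C a) * d) \<otimes> (b * e)) y
        = c *\<^sub>C tensor_lift (\<lambda>d e. (a * d) \<otimes> (b * e)) y"
      by (induction y rule: tensor_induct)
        (simp_all only: pure add, simp_all only: cscale_mult_left pure_tensor_simps cscale_add_right)
  qed
qed

lemma tensor_mult_pure:
  fixes a c :: 'a and b d :: 'b
  shows "(a \<otimes> b) * (c \<otimes> d) = (a * c) \<otimes> (b * d)"
  unfolding times_tensor_def tensor_lift_pure[OF tensor_mult_aux2]
  by (rule tensor_lift_pure[OF tensor_mult_aux])

lemma tensor_mult_left:
  fixes x y z :: "'a \<otimes> 'b"
  shows "(x + y) * z = x * z + y * z" "(c *\<^sub>C x) * z = c *\<^sub>C (x * z)"
  unfolding times_tensor_def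
  by (rule clinear_add[OF clinear_tensor_lift[OF tensor_mult_aux2]]
      clinear_scale[OF clinear_tensor_lift[OF tensor_mult_aux2]])+

lemma tensor_mult_right:
  fixes x y z :: "'a \<otimes> 'b"
  shows "x * (y + z) = x * y + x * z" "x * (c *\<^sub>C y) = c *\<^sub>C (x * y)"
proof -
  have "(a \<otimes> b) * (y + z) = (a \<otimes> b) * y + (a \<otimes> b) * z"
    "(a \<otimes> b) * (c *\<^sub>C y) = c *\<^sub>C ((a \<otimes> b) * y)" for a :: 'a and b :: 'b
    unfolding times_tensor_def tensor_lift_pure[OF tensor_mult_aux2]
    by (rule clinear_add[OF clinear_tensor_lift[OF tensor_mult_aux]]
        clinear_scale[OF clinear_tensor_lift[OF tensor_mult_aux]])+
  note * = this
  show "x * (y + z) = x * y + x * z"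
    by (induction x rule: tensor_induct) (simp_all add: * tensor_mult_left algebra_simps)
  show "x * (c *\<^sub>C y) = c *\<^sub>C (x * y)"
    by (induction x rule: tensor_induct) (simp_all add: * tensor_mult_left cscale_add_right)
qed

instance
proof
  fix x y z :: "'a \<otimes> 'b" and c :: complex
  have 1: "((a \<otimes> b) * (a' \<otimes> b')) * z = (a \<otimes> b) * ((a' \<otimes> b') * z)"
    for a a' :: 'a and b b' :: 'b
    by (induction z rule: tensor_induct)
      (simp_all add: tensor_mult_pure tensor_mult_right mult.assoc)
  have 2: "((a \<otimes> b) * y) * z = (a \<otimes> b) * (y * z)" for a :: 'a and b :: 'b
    by (induction y rule: tensor_induct)
      (simp_all add: 1 tensor_mult_left tensor_mult_right)
  show "x * y * z = x * (y * z)"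
    by (induction x rule: tensor_induct) (simp_all add: 2 tensor_mult_left)
  show "1 * x = x"
    by (induction x rule: tensor_induct)
      (simp_all add: one_tensor_def tensor_mult_pure tensor_mult_right)
  show "x * 1 = x"
    by (induction x rule: tensor_induct)
      (simp_all add: one_tensor_def tensor_mult_pure tensor_mult_left)
  show "(0 :: 'a \<otimes> 'b) \<noteq> 1"
    unfolding one_tensor_def by (rule pure_tensor_nonzero[symmetric]) simp_all
qed (rule tensor_mult_left tensor_mult_right)+

end

section \<open>The tensor algebra\<close>

text \<open>
  The free algebra on the elements of \<open>'v\<close> modulo multilinearity of words; \<open>word [v\<^sub>1, \<dots>, v\<^sub>n]\<close> is
  \<open>v\<^sub>1 \<otimes> \<dots> \<otimes> v\<^sub>n\<close>.
\<close>

definition word_relations :: "('v::complex_vec list \<Rightarrow>\<^sub>0 complex) set" where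
  "word_relations =
     {Poly_Mapping.single (xs @ (u + v) # ys) 1 - Poly_Mapping.single (xs @ u # ys) 1
        - Poly_Mapping.single (xs @ v # ys) 1 | xs u v ys. True}
   \<union> {Poly_Mapping.single (xs @ (c *\<^sub>C v) # ys) 1
        - c *\<^sub>C Poly_Mapping.single (xs @ v # ys) 1 | xs c v ys. True}"

quotient_type (overloaded) 'v tensor_alg =
    "'v::complex_vec list \<Rightarrow>\<^sub>0 complex" / "\<lambda>x y. x - y \<in> cvec.span word_relations"
  by (rule equivp_mod_span)

instantiation tensor_alg :: (complex_vec) complex_vec
begin
lift_definition zero_tensor_alg :: "'a tensor_alg" is 0 .
lift_definition plus_tensor_alg :: "'a tensor_alg \<Rightarrow> 'a tensor_alg \<Rightarrow> 'a tensor_alg" is "(+)"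
  by (drule (1) cvec.span_add) (simp add: algebra_simps)
lift_definition minus_tensor_alg :: "'a tensor_alg \<Rightarrow> 'a tensor_alg \<Rightarrow> 'a tensor_alg" is "(-)"
  by (drule (1) cvec.span_diff) (simp add: algebra_simps)
lift_definition uminus_tensor_alg :: "'a tensor_alg \<Rightarrow> 'a tensor_alg" is uminus
  by (drule cvec.span_neg) (simp add: algebra_simps)
lift_definition cscale_tensor_alg :: "complex \<Rightarrow> 'a tensor_alg \<Rightarrow> 'a tensor_alg" is cscale
  by (simp add: cvec.span_scale flip: cvec.scale_right_diff_distrib)
instance
proof
  fix x y z :: "'a tensor_alg" and c d :: complex
  show "x + y + z = x + (y + z)"
    by transfer (simp add: add.assoc cvec.span_zero)
  show "x + y = y + x"
    by transfer (simp add: add.commute cvec.span_zero)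
  show "0 + x = x"
    by transfer (simp add: cvec.span_zero)
  show "- x + x = 0"
    by transfer (simp add: cvec.span_zero)
  show "x - y = x + - y"
    by transfer (simp add: cvec.span_zero)
  show "c *\<^sub>C (x + y) = c *\<^sub>C x + c *\<^sub>C y"
    by transfer (simp add: cscale_add_right cvec.span_zero)
  show "(c + d) *\<^sub>C x = c *\<^sub>C x + d *\<^sub>C x"
    by transfer (simp add: cscale_add_left cvec.span_zero)
  show "c *\<^sub>C (d *\<^sub>C x) = (c * d) *\<^sub>C x"
    by transfer (simp add: cvec.span_zero)
  show "1 *\<^sub>C x = x"
    by transfer (simp add: cvec.span_zero)
qed
end

lift_definition word :: "'v::complex_vec list \<Rightarrow> 'v tensor_alg"
  is "\<lambda>xs. Poly_Mapping.single xs 1" .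

definition multilinear :: "('v::complex_vec list \<Rightarrow> 'a::complex_vec) \<Rightarrow> bool"
  where "multilinear f \<longleftrightarrow> (\<forall>xs ys. clinear (\<lambda>v. f (xs @ v # ys)))"

text \<open>For multilinear \<open>f\<close>, the unique linear map with \<open>word xs \<mapsto> f xs\<close>.\<close>

definition word_lift :: "('v::complex_vec list \<Rightarrow> 'a::complex_vec) \<Rightarrow> 'v tensor_alg \<Rightarrow> 'a"
  where "word_lift f x = free_extend f (rep_tensor_alg x)"

lemma tensor_alg_abs_cases:
  obtains p where "x = abs_tensor_alg p"
  by (rule that[OF sym, OF Quotient3_abs_rep[OF Quotient3_tensor_alg]])

lemma word_lift_abs:
  assumes "multilinear f"
  shows "word_lift f (abs_tensor_alg p) = free_extend f p"
proof -
  have f: "clinear (\<lambda>v. f (xs @ v # ys))" for xs ys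
    using assms by (auto simp: multilinear_def)
  have mem: "rep_tensor_alg (abs_tensor_alg p) - p \<in> cvec.span word_relations"
    by (rule rep_abs_rsp_left[OF Quotient3_tensor_alg]) (simp add: cvec.span_zero)
  have rel: "free_extend f r = 0" if "r \<in> word_relations" for r
    using that unfolding word_relations_def
    by (elim UnE CollectE exE conjE)
      (simp_all only: clinear_diff[OF clinear_free_extend] clinear_scale[OF clinear_free_extend]
        free_extend_single clinear_add[OF f] clinear_scale[OF f] add_diff_cancel_left' diff_self)
  have "free_extend f (rep_tensor_alg (abs_tensor_alg p) - p) = 0"
    by (rule span_vanish[OF clinear_free_extend rel mem])
  then show ?thesis
    by (simp add: word_lift_def clinear_diff[OF clinear_free_extend])
qed

lemma word_lift_word:
  assumes "multilinear f"
  shows "word_lift f (word xs) = f xs"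
  by (simp add: word.abs_eq word_lift_abs[OF assms] free_extend_single)

lemma clinear_word_lift:
  assumes "multilinear f"
  shows "clinear (word_lift f)"
proof (rule clinearI)
  fix x y :: "'a tensor_alg" and c
  obtain p where p: "x = abs_tensor_alg p"
    by (rule tensor_alg_abs_cases)
  obtain r where r: "y = abs_tensor_alg r"
    by (rule tensor_alg_abs_cases)
  show "word_lift f (x + y) = word_lift f x + word_lift f y"
    unfolding p r plus_tensor_alg.abs_eq word_lift_abs[OF assms]
    by (rule clinear_add[OF clinear_free_extend])
  show "word_lift f (c *\<^sub>C x) = c *\<^sub>C word_lift f x"
    unfolding p cscale_tensor_alg.abs_eq word_lift_abs[OF assms]
    by (rule clinear_scale[OF clinear_free_extend])
qed

lemma word_add: "word (xs @ (u + v) # ys) = word (xs @ u # ys) + word (xs @ v # ys)"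
  by transfer (rule cvec.span_base, unfold word_relations_def diff_diff_add[symmetric], fast)

lemma word_scale: "word (xs @ (c *\<^sub>C v) # ys) = c *\<^sub>C word (xs @ v # ys)"
  by transfer (rule cvec.span_base, unfold word_relations_def, fast)

lemma multilinear_word: "multilinear word"
  unfolding multilinear_def clinear_iff by (simp add: word_add word_scale)

lemma tensor_alg_induct [case_names word add scale]:
  assumes word: "\<And>xs. P (word xs)" and add: "\<And>x y. P x \<Longrightarrow> P y \<Longrightarrow> P (x + y)"
    and scale: "\<And>c x. P x \<Longrightarrow> P (c *\<^sub>C x)"
  shows "P x"
proof -
  obtain p where x: "x = abs_tensor_alg p"
    by (rule tensor_alg_abs_cases)
  have "P (abs_tensor_alg p)"
  proof (induction p rule: free_induct)
    case (1 i)
    show ?case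
      using word[of i] by (simp only: word.abs_eq)
  next
    case (2 x y)
    then show ?case
      using add[of "abs_tensor_alg x" "abs_tensor_alg y"] by (simp only: plus_tensor_alg.abs_eq)
  next
    case (3 c x)
    then show ?case
      using scale[of "abs_tensor_alg x" c] by (simp only: cscale_tensor_alg.abs_eq)
  qed
  then show ?thesis
    using x by simp
qed

instantiation tensor_alg :: (complex_vec) complex_alg
begin

definition one_tensor_alg :: "'a tensor_alg"
  where "one_tensor_alg = word []"

definition times_tensor_alg :: "'a tensor_alg \<Rightarrow> 'a tensor_alg \<Rightarrow> 'a tensor_alg"
  where "x * y = word_lift (\<lambda>xs. word_lift (\<lambda>ys. word (xs @ ys)) y) x"

lemma word_mult_aux:
  fixes xs :: "'a list"
  shows "multilinear (\<lambda>ys. word (xs @ ys))"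
  unfolding multilinear_def clinear_iff
  by (simp only: append_assoc[symmetric] word_add word_scale simp_thms)

lemma word_mult_aux2:
  fixes y :: "'a tensor_alg"
  shows "multilinear (\<lambda>xs. word_lift (\<lambda>ys. word (xs @ ys)) y)"
  unfolding multilinear_def clinear_iff
proof (intro conjI allI)
  fix xs ys :: "'a list" and u v :: 'a and c
  have w: "word_lift (\<lambda>ys. word (xs @ ys)) (word zs) = word (xs @ zs)" for xs zs :: "'a list"
    by (rule word_lift_word[OF word_mult_aux])
  have a: "word_lift (\<lambda>ys. word (xs @ ys)) (x + z)
      = word_lift (\<lambda>ys. word (xs @ ys)) x + word_lift (\<lambda>ys. word (xs @ ys)) z"
    for xs :: "'a list" and x z
    by (rule clinear_add[OF clinear_word_lift[OF word_mult_aux]])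
  have s: "word_lift (\<lambda>ys. word (xs @ ys)) (c *\<^sub>C x) = c *\<^sub>C word_lift (\<lambda>ys. word (xs @ ys)) x"
    for xs :: "'a list" and x c
    by (rule clinear_scale[OF clinear_word_lift[OF word_mult_aux]])
  show "word_lift (\<lambda>zs. word ((xs @ (u + v) # ys) @ zs)) y
      = word_lift (\<lambda>zs. word ((xs @ u # ys) @ zs)) y + word_lift (\<lambda>zs. word ((xs @ v # ys) @ zs)) y"
  proof (induction y rule: tensor_alg_induct)
    case (word zs)
    show ?case
      unfolding w unfolding append_assoc append_Cons by (rule word_add)
  next
    case (add x y)
    then show ?case
      unfolding a by (simp only: ac_simps)
  next
    case (scale c x)
    then show ?case
      unfolding s by (simp only: cscale_add_right)
  qed
  show "word_lift (\<lambda>zs. word ((xs @ (c *\<^sub>C v) # ys) @ zs)) y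
      = c *\<^sub>C word_lift (\<lambda>zs. word ((xs @ v # ys) @ zs)) y"
  proof (induction y rule: tensor_alg_induct)
    case (word zs)
    show ?case
      unfolding w unfolding append_assoc append_Cons by (rule word_scale)
  next
    case (add x y)
    then show ?case
      unfolding a by (simp only: cscale_add_right)
  next
    case (scale d x)
    then show ?case
      unfolding s by (simp only: cvec.scale_scale mult.commute)
  qed
qed

lemma word_mult_word:
  fixes xs ys :: "'a list"
  shows "word xs * word ys = word (xs @ ys)"
  unfolding times_tensor_alg_def word_lift_word[OF word_mult_aux2]
  by (rule word_lift_word[OF word_mult_aux])

lemma tensor_alg_mult_left:
  fixes x y z :: "'a tensor_alg"
  shows "(x + y) * z = x * z + y * z" "(c *\<^sub>C x) * z = c *\<^sub>C (x * z)"
  unfolding times_tensor_alg_def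
  by (rule clinear_add[OF clinear_word_lift[OF word_mult_aux2]]
      clinear_scale[OF clinear_word_lift[OF word_mult_aux2]])+

lemma tensor_alg_mult_right:
  fixes x y z :: "'a tensor_alg"
  shows "x * (y + z) = x * y + x * z" "x * (c *\<^sub>C y) = c *\<^sub>C (x * y)"
proof -
  have *: "word xs * (y + z) = word xs * y + word xs * z"
    "word xs * (c *\<^sub>C y) = c *\<^sub>C (word xs * y)" for xs :: "'a list"
    unfolding times_tensor_alg_def word_lift_word[OF word_mult_aux2]
    by (rule clinear_add[OF clinear_word_lift[OF word_mult_aux]]
        clinear_scale[OF clinear_word_lift[OF word_mult_aux]])+
  show "x * (y + z) = x * y + x * z"
    by (induction x rule: tensor_alg_induct)
      (simp_all only: * tensor_alg_mult_left cscale_add_right ac_simps)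
  show "x * (c *\<^sub>C y) = c *\<^sub>C (x * y)"
    by (induction x rule: tensor_alg_induct)
      (simp_all only: * tensor_alg_mult_left cscale_add_right cvec.scale_scale mult.commute)
qed

instance
proof
  fix x y z :: "'a tensor_alg" and c :: complex
  have 1: "(word xs * word ys) * z = word xs * (word ys * z)" for xs ys :: "'a list"
    by (induction z rule: tensor_alg_induct)
      (simp_all add: word_mult_word tensor_alg_mult_right)
  have 2: "(word xs * y) * z = word xs * (y * z)" for xs :: "'a list"
    by (induction y rule: tensor_alg_induct)
      (simp_all add: 1 tensor_alg_mult_left tensor_alg_mult_right)
  show "x * y * z = x * (y * z)"
    by (induction x rule: tensor_alg_induct) (simp_all add: 2 tensor_alg_mult_left)
  show "1 * x = x"
    by (induction x rule: tensor_alg_induct)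
      (simp_all add: one_tensor_alg_def word_mult_word tensor_alg_mult_right)
  show "x * 1 = x"
    by (induction x rule: tensor_alg_induct)
      (simp_all add: one_tensor_alg_def word_mult_word tensor_alg_mult_left)
  show "(0 :: 'a tensor_alg) \<noteq> 1"
  proof
    let ?f = "\<lambda>xs :: 'a list. if xs = [] then 1 else (0 :: complex)"
    assume "(0 :: 'a tensor_alg) = 1"
    then have *: "word_lift ?f (word []) = word_lift ?f 0"
      by (simp only: one_tensor_alg_def)
    have ml: "multilinear ?f"
      by (simp add: multilinear_def clinear_iff)
    show False
      using * by (simp add: word_lift_word[OF ml] clinear_zero[OF clinear_word_lift[OF ml]])
  qed
qed (rule tensor_alg_mult_left tensor_alg_mult_right)+

end

section \<open>Coquasitriangular Hopf algebras\<close>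

record (overloaded) ('a::complex_alg) cqt_hopf =
  comult :: "'a \<Rightarrow> 'a \<otimes> 'a"
  counit :: "'a \<Rightarrow> complex"
  antipode :: "'a \<Rightarrow> 'a"
  rform :: "'a \<Rightarrow> 'a \<Rightarrow> complex"

definition coalgebra :: "('a::complex_vec \<Rightarrow> 'a \<otimes> 'a) \<Rightarrow> ('a \<Rightarrow> complex) \<Rightarrow> bool" where
  "coalgebra \<Delta> \<epsilon> \<longleftrightarrow> clinear \<Delta> \<and> clinear \<epsilon>
     \<and> (\<forall>x. tensor_assoc (tensor_map \<Delta> id (\<Delta> x)) = tensor_map id \<Delta> (\<Delta> x))
     \<and> (\<forall>x. tensor_lift (\<lambda>x1 x2. \<epsilon> x1 *\<^sub>C x2) (\<Delta> x) = x)
     \<and> (\<forall>x. tensor_lift (\<lambda>x1 x2. \<epsilon> x2 *\<^sub>C x1) (\<Delta> x) = x)"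

definition hopf_algebra :: "('a::complex_alg) cqt_hopf \<Rightarrow> bool" where
  "hopf_algebra A \<longleftrightarrow> coalgebra (comult A) (counit A)
     \<and> algebra_hom (comult A) \<and> algebra_hom (counit A) \<and> clinear (antipode A)
     \<and> (\<forall>x. tensor_lift (\<lambda>x1 x2. antipode A x1 * x2) (comult A x) = counit A x *\<^sub>C 1)
     \<and> (\<forall>x. tensor_lift (\<lambda>x1 x2. x1 * antipode A x2) (comult A x) = counit A x *\<^sub>C 1)"

definition coquasitriangular_hopf :: "('a::complex_alg) cqt_hopf \<Rightarrow> bool" where
  "coquasitriangular_hopf A \<longleftrightarrow> hopf_algebra A
     \<and> cbilinear (rform A)
     \<and> (\<exists>R'. cbilinear R'
          \<and> (\<forall>x y. tensor_lift (\<lambda>x1 x2. tensor_lift (\<lambda>y1 y2. rform A x1 y1 * R' x2 y2)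
                (comult A y)) (comult A x) = counit A x * counit A y)
          \<and> (\<forall>x y. tensor_lift (\<lambda>x1 x2. tensor_lift (\<lambda>y1 y2. R' x1 y1 * rform A x2 y2)
                (comult A y)) (comult A x) = counit A x * counit A y))
     \<and> (\<forall>x y z. rform A (x * y) z
          = tensor_lift (\<lambda>z1 z2. rform A x z1 * rform A y z2) (comult A z))
     \<and> (\<forall>x y z. rform A x (y * z)
          = tensor_lift (\<lambda>x1 x2. rform A x1 z * rform A x2 y) (comult A x))
     \<and> (\<forall>x y. tensor_lift (\<lambda>x1 x2. tensor_lift (\<lambda>y1 y2. rform A x2 y2 *\<^sub>C (y1 * x1))
                (comult A y)) (comult A x)
            = tensor_lift (\<lambda>x1 x2. tensor_lift (\<lambda>y1 y2. rform A x1 y1 *\<^sub>C (x2 * y2))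
                (comult A y)) (comult A x))"

definition tensor_cqt_hopf ::
  "('a::complex_alg) cqt_hopf \<Rightarrow> ('b::complex_alg) cqt_hopf \<Rightarrow> ('a \<otimes> 'b) cqt_hopf" where
  "tensor_cqt_hopf A B =
     \<lparr> comult = tensor_lift (\<lambda>a b. tensor_lift (\<lambda>a1 a2. tensor_lift (\<lambda>b1 b2.
         (a1 \<otimes> b1) \<otimes> (a2 \<otimes> b2)) (comult B b)) (comult A a)),
       counit = tensor_lift (\<lambda>a b. counit A a * counit B b),
       antipode = tensor_map (antipode A) (antipode B),
       rform = (\<lambda>x y. tensor_lift (\<lambda>a b. tensor_lift (\<lambda>a' b'.
         rform A a a' * rform B b b') y) x) \<rparr>"

text \<open>\<open>\<complex>[t, t\<^sup>-\<^sup>1]\<close>, with the convolution product of \<open>poly_mapping\<close>, and \<open>t\<^sup>n\<close>.\<close>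

type_synonym laurent = "int \<Rightarrow>\<^sub>0 complex"

definition tpow :: "int \<Rightarrow> laurent"
  where "tpow n = Poly_Mapping.single n 1"

definition laurent_hopf :: "complex \<Rightarrow> complex \<Rightarrow> laurent cqt_hopf" where
  "laurent_hopf q \<alpha> =
     \<lparr> comult = free_extend (\<lambda>n. tpow n \<otimes> tpow n),
       counit = free_extend (\<lambda>n. 1),
       antipode = free_extend (\<lambda>n. tpow (- n)),
       rform = (\<lambda>x y. free_extend (\<lambda>m. free_extend (\<lambda>n.
         q powr (\<alpha> * of_int m * of_int n)) y) x) \<rparr>"

definition laurent_extension ::
  "complex \<Rightarrow> complex \<Rightarrow> ('g::complex_alg) cqt_hopf \<Rightarrow> ('g \<otimes> laurent) cqt_hopf"
  where "laurent_extension q \<alpha> G = tensor_cqt_hopf G (laurent_hopf q \<alpha>)"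


section \<open>Right comodules and their braiding\<close>

definition right_comodule ::
  "('h::complex_alg) cqt_hopf \<Rightarrow> ('v::complex_vec \<Rightarrow> 'v \<otimes> 'h) \<Rightarrow> bool" where
  "right_comodule H \<delta> \<longleftrightarrow> clinear \<delta>
     \<and> (\<forall>v. tensor_assoc (tensor_map \<delta> id (\<delta> v)) = tensor_map id (comult H) (\<delta> v))
     \<and> (\<forall>v. tensor_lift (\<lambda>v0 v1. counit H v1 *\<^sub>C v0) (\<delta> v) = v)"

definition comodule_map ::
  "('v::complex_vec \<Rightarrow> 'v \<otimes> 'h::complex_alg) \<Rightarrow> ('w::complex_vec \<Rightarrow> 'w \<otimes> 'h) \<Rightarrow> ('v \<Rightarrow> 'w) \<Rightarrow> bool"
  where "comodule_map \<delta>V \<delta>W f \<longleftrightarrow> clinear f \<and> (\<forall>v. \<delta>W (f v) = tensor_map f id (\<delta>V v))"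

definition tensor_coaction ::
  "('v::complex_vec \<Rightarrow> 'v \<otimes> 'h::complex_alg) \<Rightarrow> ('w::complex_vec \<Rightarrow> 'w \<otimes> 'h) \<Rightarrow>
    'v \<otimes> 'w \<Rightarrow> ('v \<otimes> 'w) \<otimes> 'h" where
  "tensor_coaction \<delta>V \<delta>W = tensor_lift (\<lambda>v w. tensor_lift (\<lambda>v0 v1. tensor_lift (\<lambda>w0 w1.
     (v0 \<otimes> w0) \<otimes> (v1 * w1)) (\<delta>W w)) (\<delta>V v))"

definition braid ::
  "('h::complex_alg) cqt_hopf \<Rightarrow> ('v::complex_vec \<Rightarrow> 'v \<otimes> 'h) \<Rightarrow> ('w::complex_vec \<Rightarrow> 'w \<otimes> 'h) \<Rightarrow>
    'v \<otimes> 'w \<Rightarrow> 'w \<otimes> 'v" where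
  "braid H \<delta>V \<delta>W = tensor_lift (\<lambda>v w. tensor_lift (\<lambda>v0 v1. tensor_lift (\<lambda>w0 w1.
     rform H v1 w1 *\<^sub>C (w0 \<otimes> v0)) (\<delta>W w)) (\<delta>V v))"

definition extend_coaction ::
  "('v::complex_vec \<Rightarrow> 'v \<otimes> 'g::complex_alg) \<Rightarrow> 'v \<Rightarrow> 'v \<otimes> ('g \<otimes> laurent)"
  where "extend_coaction \<delta> v = tensor_map id (\<lambda>g. g \<otimes> tpow 1) (\<delta> v)"

text \<open>
  \<open>\<complex>D\<close> is the type \<open>complex\<close>, with \<open>D = 1\<close>; a form \<open>\<eta> :: V \<otimes> V \<Rightarrow> \<complex>\<close> is thereby also
  the map \<open>x \<mapsto> \<eta> x D\<close> into \<open>\<complex>D\<close>.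
\<close>

definition D_coaction :: "complex \<Rightarrow> complex \<otimes> ('g::complex_alg \<otimes> laurent)"
  where "D_coaction z = z \<otimes> (1 \<otimes> tpow 2)"


section \<open>The braided symmetric algebra\<close>

text \<open>\<open>id\<^sup>\<otimes>\<^sup>i \<otimes> \<Psi> \<otimes> id\<close> on words longer than \<open>i + 1\<close>.\<close>

definition braid_at ::
  "('v::complex_vec \<otimes> 'v \<Rightarrow> 'v \<otimes> 'v) \<Rightarrow> nat \<Rightarrow> 'v tensor_alg \<Rightarrow> 'v tensor_alg" where
  "braid_at \<Psi> i = word_lift (\<lambda>xs.
     if Suc i < length xs
     then word (take i xs)
            * tensor_lift (\<lambda>v w. word [v, w]) (\<Psi> (xs ! i \<otimes> xs ! Suc i))
            * word (drop (Suc (Suc i)) xs)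
     else word xs)"

definition transposition_product :: "nat list \<Rightarrow> nat \<Rightarrow> nat"
  where "transposition_product is = foldr (\<lambda>i f. Transposition.transpose i (Suc i) \<circ> f) is id"

definition reduced_expression :: "nat \<Rightarrow> (nat \<Rightarrow> nat) \<Rightarrow> nat list \<Rightarrow> bool" where
  "reduced_expression n \<sigma> is \<longleftrightarrow>
     (\<forall>i\<in>set is. Suc i < n) \<and> transposition_product is = \<sigma>
     \<and> (\<forall>js. (\<forall>j\<in>set js. Suc j < n) \<and> transposition_product js = \<sigma> \<longrightarrow> length is \<le> length js)"

text \<open>
  \<open>\<Psi>\<^sub>\<sigma>\<close> does not depend on the reduced expression chosen, because \<open>\<Psi>\<close> satisfies the braid relation.
  \<open>braided_factorial\<close> is \<open>[n, \<Psi>]!\<close>; it is only meaningful on \<open>V\<^sup>\<otimes>\<^sup>n = tensor_degree n\<close>.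
\<close>

definition braid_perm ::
  "('v::complex_vec \<otimes> 'v \<Rightarrow> 'v \<otimes> 'v) \<Rightarrow> nat \<Rightarrow> (nat \<Rightarrow> nat) \<Rightarrow> 'v tensor_alg \<Rightarrow> 'v tensor_alg" where
  "braid_perm \<Psi> n \<sigma> = foldr (\<lambda>i f. braid_at \<Psi> i \<circ> f) (SOME is. reduced_expression n \<sigma> is) id"

definition braided_factorial ::
  "('v::complex_vec \<otimes> 'v \<Rightarrow> 'v \<otimes> 'v) \<Rightarrow> nat \<Rightarrow> 'v tensor_alg \<Rightarrow> 'v tensor_alg" where
  "braided_factorial \<Psi> n x = (\<Sum>\<sigma> | \<sigma> permutes {..<n}. braid_perm \<Psi> n \<sigma> x)"

definition tensor_degree :: "nat \<Rightarrow> 'v::complex_vec tensor_alg set"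
  where "tensor_degree n = cvec.span {word xs | xs. length xs = n}"

definition symmetric_relations :: "('v::complex_vec \<otimes> 'v \<Rightarrow> 'v \<otimes> 'v) \<Rightarrow> 'v tensor_alg set" where
  "symmetric_relations \<Psi> =
     cvec.span (\<Union>n. {x \<in> tensor_degree n. braided_factorial \<Psi> n x = 0})"

text \<open>\<open>\<pi> :: TV \<rightarrow> B\<close> presents the algebra \<open>B\<close> as \<open>B\<^sub>+(V)\<close>.\<close>

definition braided_symmetric_algebra ::
  "('v::complex_vec \<otimes> 'v \<Rightarrow> 'v \<otimes> 'v) \<Rightarrow> ('v tensor_alg \<Rightarrow> 'b::complex_alg) \<Rightarrow> bool" where
  "braided_symmetric_algebra \<Psi> \<pi> \<longleftrightarrow> algebra_hom \<pi> \<and> quotient_projection \<pi> (symmetric_relations \<Psi>)"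

definition tensor_alg_coaction ::
  "('v::complex_vec \<Rightarrow> 'v \<otimes> 'h::complex_alg) \<Rightarrow> 'v tensor_alg \<Rightarrow> 'v tensor_alg \<otimes> 'h" where
  "tensor_alg_coaction \<delta> =
     word_lift (\<lambda>xs. prod_list (map (\<lambda>v. tensor_map (\<lambda>u. word [u]) id (\<delta> v)) xs))"

text \<open>
  The coaction on \<open>B\<close> induced by the one on \<open>TV\<close>, whose kernel ideal is a subcomodule
  as \<open>\<Psi>\<close> is a comodule map.
\<close>

definition quotient_coaction ::
  "('v::complex_vec tensor_alg \<Rightarrow> 'b::complex_alg) \<Rightarrow> ('v \<Rightarrow> 'v \<otimes> 'h::complex_alg) \<Rightarrow> 'b \<Rightarrow> 'b \<otimes> 'h"
  where "quotient_coaction \<pi> \<delta> = descend \<pi> (\<lambda>x. tensor_map \<pi> id (tensor_alg_coaction \<delta> x))"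


section \<open>Bimodules\<close>

definition bimodule ::
  "('b::complex_alg \<Rightarrow> 'm::complex_vec \<Rightarrow> 'm) \<Rightarrow> ('m \<Rightarrow> 'b \<Rightarrow> 'm) \<Rightarrow> bool" where
  "bimodule l r \<longleftrightarrow> cbilinear l \<and> cbilinear r
     \<and> (\<forall>m. l 1 m = m) \<and> (\<forall>a b m. l (a * b) m = l a (l b m))
     \<and> (\<forall>m. r m 1 = m) \<and> (\<forall>m a b. r m (a * b) = r (r m a) b)
     \<and> (\<forall>a m b. r (l a m) b = l a (r m b))"

definition bimodule_map ::
  "('b::complex_alg \<Rightarrow> 'm::complex_vec \<Rightarrow> 'm) \<Rightarrow> ('m \<Rightarrow> 'b \<Rightarrow> 'm) \<Rightarrow>
    ('b \<Rightarrow> 'n::complex_vec \<Rightarrow> 'n) \<Rightarrow> ('n \<Rightarrow> 'b \<Rightarrow> 'n) \<Rightarrow> ('m \<Rightarrow> 'n) \<Rightarrow> bool" where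
  "bimodule_map l r l' r' f \<longleftrightarrow> bimodule l r \<and> bimodule l' r' \<and> clinear f
     \<and> (\<forall>b m. f (l b m) = l' b (f m)) \<and> (\<forall>m b. f (r m b) = r' (f m) b)"

text \<open>
  \<open>tensor_over r l p\<close>: the map \<open>p\<close> presents its codomain as \<open>M \<otimes>\<^sub>B N\<close>, for \<open>r\<close> the right action
  on \<open>M\<close> and \<open>l\<close> the left action on \<open>N\<close>.
\<close>

definition tensor_over ::
  "('m::complex_vec \<Rightarrow> 'b \<Rightarrow> 'm) \<Rightarrow> ('b \<Rightarrow> 'n::complex_vec \<Rightarrow> 'n) \<Rightarrow>
    ('m \<otimes> 'n \<Rightarrow> 'w::complex_vec) \<Rightarrow> bool" where
  "tensor_over r l p \<longleftrightarrow> quotient_projection p (cvec.span {r m b \<otimes> n - m \<otimes> l b n | m b n. True})"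

definition tensor_over_left ::
  "('m::complex_vec \<otimes> 'n::complex_vec \<Rightarrow> 'w) \<Rightarrow> ('b \<Rightarrow> 'm \<Rightarrow> 'm) \<Rightarrow> 'b \<Rightarrow> 'w \<Rightarrow> 'w"
  where "tensor_over_left p l b = descend p (\<lambda>x. p (tensor_map (l b) id x))"

definition tensor_over_right ::
  "('m::complex_vec \<otimes> 'n::complex_vec \<Rightarrow> 'w) \<Rightarrow> ('n \<Rightarrow> 'b \<Rightarrow> 'n) \<Rightarrow> 'w \<Rightarrow> 'b \<Rightarrow> 'w"
  where "tensor_over_right p r w b = descend p (\<lambda>x. p (tensor_map id (\<lambda>n. r n b) x)) w"


section \<open>The bimodules of one-forms and \<open>L\<^sub>\<plusminus>\<close>\<close>

text \<open>In the following \<open>\<Psi>BV :: B \<otimes> V \<rightarrow> V \<otimes> B\<close> and \<open>\<Psi>VB :: V \<otimes> B \<rightarrow> B \<otimes> V\<close> are the braidings.\<close>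

definition omega10_left ::
  "('b::complex_alg \<otimes> 'v::complex_vec \<Rightarrow> 'v \<otimes> 'b) \<Rightarrow> 'b \<Rightarrow> 'v \<otimes> 'b \<Rightarrow> 'v \<otimes> 'b"
  where "omega10_left \<Psi>BV b = tensor_lift (\<lambda>v c. tensor_map id (\<lambda>b'. b' * c) (\<Psi>BV (b \<otimes> v)))"

definition omega10_right :: "'v::complex_vec \<otimes> 'b::complex_alg \<Rightarrow> 'b \<Rightarrow> 'v \<otimes> 'b"
  where "omega10_right x b = tensor_map id (\<lambda>c. c * b) x"

definition omega01_left :: "'b::complex_alg \<Rightarrow> 'b \<otimes> 'v::complex_vec \<Rightarrow> 'b \<otimes> 'v"
  where "omega01_left b = tensor_map (\<lambda>c. b * c) id"

definition omega01_right ::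
  "('v::complex_vec \<otimes> 'b::complex_alg \<Rightarrow> 'b \<otimes> 'v) \<Rightarrow> 'b \<otimes> 'v \<Rightarrow> 'b \<Rightarrow> 'b \<otimes> 'v"
  where "omega01_right \<Psi>VB x b =
    tensor_lift (\<lambda>c v. tensor_map (\<lambda>b'. c * b') id (\<Psi>VB (v \<otimes> b))) x"

definition L_left :: "'b::complex_alg \<Rightarrow> 'b \<otimes> complex \<Rightarrow> 'b \<otimes> complex"
  where "L_left b = tensor_map (\<lambda>c. b * c) id"

text \<open>\<open>\<Phi> :: \<complex>D \<otimes> B \<rightarrow> B \<otimes> \<complex>D\<close> is the relevant one of \<open>\<Psi>\<^sup>-\<^sup>1\<close> (for \<open>L\<^sub>+\<close>) and \<open>\<Psi>\<close> (for \<open>L\<^sub>-\<close>).\<close>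

definition L_right ::
  "(complex \<otimes> 'b::complex_alg \<Rightarrow> 'b \<otimes> complex) \<Rightarrow> 'b \<otimes> complex \<Rightarrow> 'b \<Rightarrow> 'b \<otimes> complex"
  where "L_right \<Phi> x b = tensor_lift (\<lambda>c d. L_left c (\<Phi> (d \<otimes> b))) x"

text \<open>\<open>\<phi>\<^sub>-(a \<otimes> v \<otimes> w \<otimes> b) = a.\<eta>(v \<otimes> w).b\<close>, with \<open>\<complex>D \<subseteq> L\<close> as \<open>1 \<otimes> D\<close>.\<close>

definition phi ::
  "(complex \<otimes> 'b::complex_alg \<Rightarrow> 'b \<otimes> complex) \<Rightarrow> ('v::complex_vec \<otimes> 'v \<Rightarrow> complex) \<Rightarrow>
    ('b \<otimes> 'v) \<otimes> ('v \<otimes> 'b) \<Rightarrow> 'b \<otimes> complex" where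
  "phi \<Phi> \<eta> = tensor_lift (\<lambda>x y. tensor_lift (\<lambda>a v. tensor_lift (\<lambda>w b.
     L_right \<Phi> (L_left a (1 \<otimes> \<eta> (v \<otimes> w))) b) y) x)"

end

theory Submission
  imports Defs
begin

text \<open>
  Let \<open>\<rho>(h) = \<R>(h, t\<^sup>2) = \<R>(t\<^sup>2, h)\<close>, a character of \<open>H\<close>. Its action \<open>\<theta>(b) = b\<^sub>0 \<rho>(b\<^sub>1)\<close> is an algebra
  automorphism of \<open>B\<close>, and the right action on \<open>L\<^sub>\<plusminus>\<close> is right multiplication twisted by the inverse
  of \<open>\<theta>\<close>, respectively by \<open>\<theta>\<close>; this makes \<open>L\<^sub>\<plusminus>\<close> bimodules. As \<open>\<Omega>\<^sup>1\<^sup>,\<^sup>0\<close> is generated by \<open>V\<close> both from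
  the left and from the right, and the action of \<open>B\<close> on \<open>V\<close> is given by the braiding, \<open>\<psi>\<^sub>+\<close> descends
  to the tensor product over \<open>B\<close> as soon as
  \<open>\<eta>(v\<^sub>0 \<otimes> w) \<R>'(h, v\<^sub>1) = \<rho>'(h\<^sub>1) \<R>(h\<^sub>2, w\<^sub>1) \<eta>(v \<otimes> w\<^sub>0)\<close>, with \<open>\<R>'\<close> and \<open>\<rho>'\<close> the convolution inverses. Apply
  \<open>\<R>(h, \<cdot>)\<close> to the invariance \<open>\<eta>(v\<^sub>0 \<otimes> w\<^sub>0) v\<^sub>1 w\<^sub>1 = \<eta>(v \<otimes> w) t\<^sup>2\<close> and convolve with \<open>\<R>'\<close>. The case of \<open>\<psi>\<^sub>-\<close>
  is the mirror image, with \<open>\<R>(\<cdot>, h)\<close>.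

  The coaction descends to \<open>B\<^sub>+(V)\<close> because \<open>\<Psi>\<close>, and with it \<open>[n, \<Psi>]!\<close>, is a comodule map by
  quasi-commutativity, and because \<open>ker ([n, \<Psi>]! \<otimes> id) = ker [n, \<Psi>]! \<otimes> H\<close> over a field.
\<close>

section \<open>Multilinear maps on tensor products\<close>

text \<open>The sign of each twist is forced by the place of the inverse braiding. In \<psi>+ an
  element of B crosses v by the inverse of \<R> and w by \<R>; in \<psi>- it crosses v by \<R> and w
  by the inverse. Invariance says that crossing both by \<R> amounts to \<rho>. So crossing v by the
  inverse is crossing w by \<R>, corrected by the inverse of \<rho>, while crossing v by \<R> is
  crossing w by the inverse, corrected by \<rho>. The two evaluations at t^2 agree because \<R>(h,
  1) and \<R>(1, h) are both the counit: either gives q^(2 \<alpha> n) times the counit of g at g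
  \<otimes> t^n. Each letter of V carries one t, so \<theta> scales degree n by q^(2 \<alpha> n),
  the factor in the explicit right actions. The length comes from Sweedler calculus: sums are
  regrouped only by interchanging independent sums or by coassociativity for a trilinear summand. To
  keep t out of this, the form is studied over any coquasitriangular bialgebra with an element D
  having equal evaluations on both sides, and the module theory over maps known only to satisfy a
  multiplicativity law and a pairing law.\<close>

named_theorems lin

lemma clinear_ident [lin]: "clinear (\<lambda>x. x)"
  by (simp add: clinear_iff)

lemma clinear_id [lin]: "clinear id"
  by (simp add: clinear_iff)

lemma cbilinearI [lin]:
  "(\<And>x. clinear (f x)) \<Longrightarrow> (\<And>y. clinear (\<lambda>x. f x y)) \<Longrightarrow> cbilinear f"
  by (simp add: cbilinear_def)

text \<open>Kept out of \<open>lin\<close>, where the pattern \<open>f (g x)\<close> would match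
  almost any term. Instances with the outer map fixed by \<open>OF\<close> are added instead, so
  that \<open>intro lin\<close> stays directed by the shape of the term.\<close>

lemma clinear_comp: "clinear f \<Longrightarrow> clinear g \<Longrightarrow> clinear (\<lambda>x. f (g x))"
  by (simp add: clinear_iff)

lemma cbilinear_right: "cbilinear f \<Longrightarrow> clinear g \<Longrightarrow> clinear (\<lambda>x. f a (g x))"
  by (auto simp: cbilinear_def clinear_iff)

lemma cbilinear_left: "cbilinear f \<Longrightarrow> clinear g \<Longrightarrow> clinear (\<lambda>x. f (g x) b)"
  by (auto simp: cbilinear_def clinear_iff)

lemma clinear_pure_left [lin]: "clinear f \<Longrightarrow> clinear (\<lambda>x. f x \<otimes> b)"
  by (simp add: clinear_iff pure_tensor_simps)

lemma clinear_pure_right [lin]: "clinear g \<Longrightarrow> clinear (\<lambda>x. a \<otimes> g x)"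
  by (simp add: clinear_iff pure_tensor_simps)

lemma clinear_mult_left [lin]: "clinear f \<Longrightarrow> clinear (\<lambda>x. f x * (b::'a::complex_alg))"
  and clinear_mult_right [lin]: "clinear g \<Longrightarrow> clinear (\<lambda>x. (a::'a::complex_alg) * g x)"
  by (simp_all add: clinear_iff distrib_left distrib_right cscale_mult_left cscale_mult_right)

lemma clinear_cscale_left [lin]: "clinear f \<Longrightarrow> clinear (\<lambda>x. f x *\<^sub>C b)"
  and clinear_cscale_right [lin]: "clinear g \<Longrightarrow> clinear (\<lambda>x. c *\<^sub>C g x)"
  by (simp_all only: clinear_iff cscale_add_left cscale_add_right)
    (simp_all add: cscale_complex_def mult.commute)

lemma clinear_sum [lin]: "(\<And>i. i \<in> I \<Longrightarrow> clinear (f i)) \<Longrightarrow> clinear (\<lambda>x. \<Sum>i\<in>I. f i x)"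
  by (simp add: clinear_iff sum.distrib cvec.scale_sum_right)

lemma clinear_sum_apply:
  assumes "clinear L"
  shows "L (\<Sum>i\<in>I. g i) = (\<Sum>i\<in>I. L (g i))"
  by (induction I rule: infinite_finite_induct)
    (simp_all add: clinear_zero[OF assms] clinear_add[OF assms])

lemma tensor_lift_sum:
  "tensor_lift f x = (\<Sum>i\<in>Poly_Mapping.keys (rep_tensor x).
     poly_mapping.lookup (rep_tensor x) i *\<^sub>C f (fst i) (snd i))"
  by (simp add: tensor_lift_def free_extend_def case_prod_beta)

text \<open>
  \<^const>\<open>tensor_lift\<close> evaluates its function on a fixed representative, so it is linear in the
  function even without bilinearity.
\<close>

lemma clinear_tensor_lift_fun [lin]:
  assumes "\<And>a b. clinear (\<lambda>z. F z a b)"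
  shows "clinear (\<lambda>z. tensor_lift (\<lambda>a b. F z a b) x)"
  unfolding tensor_lift_sum
  by (intro clinear_sum clinear_cscale_right assms)

lemma clinear_tensor_lift_arg [lin]:
  "cbilinear F \<Longrightarrow> clinear g \<Longrightarrow> clinear (\<lambda>z. tensor_lift F (g z))"
  by (rule clinear_comp[OF clinear_tensor_lift])

text \<open>Both sides are the same finite sum over the representative of \<open>x\<close>. This is
  the basic rule for moving a linear map under a Sweedler sum.\<close>

lemma clinear_tensor_liftI:
  assumes "clinear L"
  shows "L (tensor_lift F x) = tensor_lift (\<lambda>a b. L (F a b)) x"
  by (simp add: tensor_lift_sum clinear_sum_apply[OF assms] clinear_scale[OF assms])

text \<open>Interchange of two finite sums; neither \<open>x\<close> nor \<open>y\<close> may depend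
  on the variables bound by the other sum.\<close>

lemma tensor_lift_swap:
  "tensor_lift (\<lambda>a b. tensor_lift (\<lambda>c d. F a b c d) y) x
    = tensor_lift (\<lambda>c d. tensor_lift (\<lambda>a b. F a b c d) x) y"
  unfolding tensor_lift_sum
  by (simp add: cvec.scale_sum_right mult.commute) (rule sum.swap)

lemma tensor_lift_scale: "tensor_lift (\<lambda>a b. c *\<^sub>C F a b) x = c *\<^sub>C tensor_lift F x"
  by (rule clinear_tensor_liftI[symmetric]) (intro lin)

lemma tensor_lift_mult_left:
  "tensor_lift (\<lambda>a b. c * F a b) x = (c::'a::complex_alg) * tensor_lift F x"
  by (rule clinear_tensor_liftI[symmetric]) (intro lin)

lemma tensor_lift_mult_right:
  "tensor_lift (\<lambda>a b. F a b * c) x = tensor_lift F x * (c::'a::complex_alg)"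
  by (rule clinear_tensor_liftI[symmetric]) (intro lin)

lemma tensor_lift_scale_left: "tensor_lift (\<lambda>a b. F a b *\<^sub>C c) x = tensor_lift F x *\<^sub>C c"
  by (rule clinear_tensor_liftI[symmetric]) (intro lin)

lemma tensor_lift_pure_ident: "tensor_lift (\<otimes>) x = x"
  by (rule tensor_lift_eqI) (intro lin cbilinear_pure, rule lin, rule tensor_lift_pure[OF cbilinear_pure])

lemma tensor_lift_map:
  assumes "cbilinear F"
  shows "tensor_lift F (tensor_map f g x) = tensor_lift (\<lambda>a b. F (f a) (g b)) x"
  unfolding tensor_map_def clinear_tensor_liftI[OF clinear_tensor_lift[OF assms]]
  by (simp add: tensor_lift_pure[OF assms])

lemma clinear_tensor_map:
  assumes "clinear f" "clinear g"
  shows "clinear (tensor_map f g)"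
  unfolding tensor_map_def
  by (intro lin clinear_comp[OF assms(1)] clinear_comp[OF assms(2)])

lemma clinear_tensor_map_arg [lin]:
  "clinear f \<Longrightarrow> clinear g \<Longrightarrow> clinear h \<Longrightarrow> clinear (\<lambda>x. tensor_map f g (h x))"
  by (rule clinear_comp[OF clinear_tensor_map])

lemma tensor_map_pure:
  assumes "clinear f" "clinear g"
  shows "tensor_map f g (a \<otimes> b) = f a \<otimes> g b"
  unfolding tensor_map_def
  by (rule tensor_lift_pure) (intro lin clinear_comp[OF assms(1)] clinear_comp[OF assms(2)])

lemma tensor_map_map:
  assumes "clinear f" "clinear g"
  shows "tensor_map f g (tensor_map f' g' x) = tensor_map (\<lambda>a. f (f' a)) (\<lambda>b. g (g' b)) x"
  unfolding tensor_map_def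
  by (rule tensor_lift_map[unfolded tensor_map_def])
    (intro lin clinear_comp[OF assms(1)] clinear_comp[OF assms(2)])

lemma tensor_map_id: "tensor_map id id x = x"
  by (simp add: tensor_map_def tensor_lift_pure_ident)

lemma tensor_assoc_pure: "tensor_assoc ((a \<otimes> b) \<otimes> c) = a \<otimes> (b \<otimes> c)"
  unfolding tensor_assoc_def
  by (subst tensor_lift_pure, intro lin, subst tensor_lift_pure, intro lin, rule refl)

lemma clinear_tensor_assoc: "clinear tensor_assoc"
  unfolding tensor_assoc_def by (intro lin)

lemma tensor_lift_mult:
  fixes x y :: "'a::complex_alg \<otimes> 'b::complex_alg"
  assumes "cbilinear F"
  shows "tensor_lift F (x * y) = tensor_lift (\<lambda>a b. tensor_lift (\<lambda>c d. F (a * c) (b * d)) y) x"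
  unfolding times_tensor_def clinear_tensor_liftI[OF clinear_tensor_lift[OF assms]]
  by (simp add: tensor_lift_pure[OF assms])

lemma clinear_eqI2:
  assumes "cbilinear f" "cbilinear g" "\<And>a b c d. f (a \<otimes> b) (c \<otimes> d) = g (a \<otimes> b) (c \<otimes> d)"
  shows "f x y = g x y"
proof (rule tensor_lift_eqI[where f = "\<lambda>x. f x y" and g = "\<lambda>x. g x y"])
  fix a b
  show "f (a \<otimes> b) y = g (a \<otimes> b) y"
    by (rule tensor_lift_eqI[where f = "f (a \<otimes> b)"])
      (use assms in \<open>auto simp: cbilinear_def\<close>)
qed (use assms in \<open>auto simp: cbilinear_def\<close>)

lemma cbilinear_mult_compose:
  assumes "clinear (f::'a::complex_alg \<Rightarrow> 'b::complex_alg)"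
  shows "cbilinear (\<lambda>x y. f (x * y))" "cbilinear (\<lambda>x y. f x * f y)"
  by (intro lin clinear_comp[OF assms])+

lemma algebra_hom_tensor_map:
  assumes "algebra_hom f" "algebra_hom g"
  shows "algebra_hom (tensor_map f g)"
proof -
  have f: "clinear f" and g: "clinear g"
    using assms by (auto simp: algebra_hom_def)
  note lin' = clinear_tensor_map[OF f g] and pure = tensor_map_pure[OF f g]
  have "tensor_map f g (x * y) = tensor_map f g x * tensor_map f g y" for x y
    by (rule clinear_eqI2[OF cbilinear_mult_compose[OF lin']])
      (use assms in \<open>simp add: pure tensor_mult_pure algebra_hom_def\<close>)
  then show ?thesis
    using assms by (simp add: lin' pure algebra_hom_def one_tensor_def)
qed

lemma algebra_hom_tensor_assoc:
  "algebra_hom (tensor_assoc :: ('a::complex_alg \<otimes> 'b::complex_alg) \<otimes> 'c::complex_alg \<Rightarrow> _)"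
proof -
  note L = cbilinear_mult_compose[OF clinear_tensor_assoc]
  have 1: "tensor_assoc ((a \<otimes> b) * (a' \<otimes> b')) = tensor_assoc (a \<otimes> b) * tensor_assoc (a' \<otimes> b')"
    for a a' :: "'a \<otimes> 'b" and b b' :: 'c
    by (rule clinear_eqI2[where f = "\<lambda>a a'. tensor_assoc ((a \<otimes> b) * (a' \<otimes> b'))"])
     (intro lin clinear_comp[OF clinear_tensor_assoc] | simp add: tensor_mult_pure tensor_assoc_pure)+
  show ?thesis
    unfolding algebra_hom_def
    by (auto simp: clinear_tensor_assoc one_tensor_def tensor_assoc_pure
        intro!: clinear_eqI2[OF L] 1)
qed

lemma algebra_hom_id: "algebra_hom id"
  by (simp add: algebra_hom_def clinear_id)

lemma algebra_hom_comp: "algebra_hom f \<Longrightarrow> algebra_hom g \<Longrightarrow> algebra_hom (\<lambda>x. f (g x))"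
  by (auto simp: algebra_hom_def intro: clinear_comp)

lemma clinear_eq_on_basis: "clinear (f :: ('i \<Rightarrow>\<^sub>0 complex) \<Rightarrow> 'a::complex_vec) \<Longrightarrow> clinear g
    \<Longrightarrow> (\<And>i. f (Poly_Mapping.single i 1) = g (Poly_Mapping.single i 1)) \<Longrightarrow> f x = g x"
  by (induction x rule: free_induct) (simp_all add: clinear_iff)

\<comment> \<open>Sweedler sums and coassociativity\<close>
syntax
  "_sweedler" :: "pttrn \<Rightarrow> pttrn \<Rightarrow> 'a \<Rightarrow> 'b \<Rightarrow> 'b"  ("(3\<^bold>\<Sum>_ _\<leftarrow>_./ _)" [1000, 1000, 51, 10] 10)
translations
  "\<^bold>\<Sum>a b\<leftarrow>x. e" \<rightleftharpoons> "CONST tensor_lift (\<lambda>a b. e) x"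

text \<open>Applies only while the outermost sums on both sides run over the same tensor. Hence
  \<open>intro tensor_lift_cong tensor_lift_swap\<close> descends to the first level at which the
  sums differ and interchanges them there.\<close>

lemma tensor_lift_cong: "(\<And>a b. F a b = G a b) \<Longrightarrow> tensor_lift F x = tensor_lift G x"
  by presburger

definition ctrilinear ::
  "('a::complex_vec \<Rightarrow> 'b::complex_vec \<Rightarrow> 'c::complex_vec \<Rightarrow> 'd::complex_vec) \<Rightarrow> bool" where
  "ctrilinear T \<longleftrightarrow> (\<forall>a b. clinear (T a b)) \<and> (\<forall>a c. clinear (\<lambda>b. T a b c))
     \<and> (\<forall>b c. clinear (\<lambda>a. T a b c))"

lemma ctrilinearI [lin]:
  assumes "\<And>a b. clinear (T a b)" "\<And>a c. clinear (\<lambda>b. T a b c)" "\<And>b c. clinear (\<lambda>a. T a b c)"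
  shows "ctrilinear T"
  using assms by (simp add: ctrilinear_def)

lemma ctrilinear_args:
  assumes "ctrilinear T"
  shows "clinear (\<lambda>z. T z b c)" "clinear (\<lambda>z. T a z c)" "clinear (\<lambda>z. T a b z)"
  using assms by (simp_all add: ctrilinear_def)

text \<open>A trilinear \<open>T\<close> induces a linear map \<open>L\<close> on the threefold
  tensor product, and \<open>L\<close> is applied to both sides of \<open>eq\<close>. With
  \<open>x\<close>, \<open>y\<close>, \<open>f\<close> and \<open>g\<close> left general, coactions
  and comultiplications are covered by one statement.\<close>

lemma coassoc_lift:
  assumes T: "ctrilinear T"
    and eq: "tensor_assoc (tensor_map f id x) = tensor_map id g y"
  shows "(\<^bold>\<Sum>a c\<leftarrow>x. \<^bold>\<Sum>u v\<leftarrow>f a. T u v c) = (\<^bold>\<Sum>a b\<leftarrow>y. \<^bold>\<Sum>u v\<leftarrow>g b. T a u v)"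
proof -
  define L where "L = tensor_lift (\<lambda>a. tensor_lift (T a))"
  note T' = ctrilinear_args[OF T]
  have bil: "cbilinear (\<lambda>a. tensor_lift (T a))" "cbilinear (T a)" for a
    by (intro lin T')+
  have pure: "L (u \<otimes> (v \<otimes> c)) = T u v c" for u v c
    unfolding L_def by (simp add: tensor_lift_pure[OF bil(1)] tensor_lift_pure[OF bil(2)])
  have L: "clinear L"
    unfolding L_def by (rule clinear_tensor_lift[OF bil(1)])
  have "L (tensor_assoc z) = (\<^bold>\<Sum>a c\<leftarrow>z. \<^bold>\<Sum>u v\<leftarrow>a. T u v c)" for z
    by (simp add: tensor_assoc_def clinear_tensor_liftI[OF L] pure)
  moreover have "cbilinear (\<lambda>a c. \<^bold>\<Sum>u v\<leftarrow>a. T u v c)"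
    by (intro lin T')
  ultimately have "L (tensor_assoc (tensor_map f id x)) = (\<^bold>\<Sum>a c\<leftarrow>x. \<^bold>\<Sum>u v\<leftarrow>f a. T u v c)"
    by (simp add: tensor_lift_map)
  moreover have "L (tensor_map id g y) = (\<^bold>\<Sum>a b\<leftarrow>y. \<^bold>\<Sum>u v\<leftarrow>g b. T a u v)"
    unfolding L_def by (simp add: tensor_lift_map[OF bil(1)])
  ultimately show ?thesis
    using eq by simp
qed

lemma clinear_complex_mult: "clinear f \<Longrightarrow> f (c *\<^sub>C x) = (c::complex) * f x"
  by (simp add: clinear_scale cscale_complex_def)

section \<open>Comodules of coquasitriangular bialgebras\<close>

locale comodule =
  fixes H :: "('h::complex_alg) cqt_hopf" and \<delta> :: "'v::complex_vec \<Rightarrow> 'v \<otimes> 'h"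
  assumes comodule: "right_comodule H \<delta>"
begin

lemma clinear_coaction: "clinear \<delta>"
  using comodule by (simp add: right_comodule_def)

lemmas clinear_coaction_arg [lin] = clinear_comp[OF clinear_coaction]

lemma coaction_coassoc:
  assumes "ctrilinear T"
  shows "(\<^bold>\<Sum>a c\<leftarrow>\<delta> v. \<^bold>\<Sum>x y\<leftarrow>\<delta> a. T x y c) = (\<^bold>\<Sum>a b\<leftarrow>\<delta> v. \<^bold>\<Sum>x y\<leftarrow>comult H b. T a x y)"
  by (rule coassoc_lift[OF assms]) (use comodule in \<open>simp add: right_comodule_def\<close>)

lemma coaction_counit:
  assumes "clinear f"
  shows "(\<^bold>\<Sum>a h\<leftarrow>\<delta> v. counit H h *\<^sub>C f a) = f v"
proof -
  have "f (\<^bold>\<Sum>a h\<leftarrow>\<delta> v. counit H h *\<^sub>C a) = f v"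
    using comodule by (simp add: right_comodule_def)
  then show ?thesis
    by (simp add: clinear_tensor_liftI[OF assms] clinear_scale[OF assms])
qed

end

text \<open>Composing two maps built from coactions coacts twice on v and twice on w. Both second
  coactions are traded for comultiplications at once, \<open>T\<close> being trilinear in the pieces
  of v and in the pieces of w.\<close>

lemma coaction_coassoc2:
  fixes H :: "('h::complex_alg) cqt_hopf"
  assumes V: "right_comodule H \<delta>V" and W: "right_comodule H \<delta>W" and "clinear (comult H)"
    and T: "\<And>x y z. ctrilinear (\<lambda>a b c. T a b c x y z)" "\<And>a b c. ctrilinear (T a b c)"
  shows "(\<^bold>\<Sum>v0 v1\<leftarrow>\<delta>V v. \<^bold>\<Sum>w0 w1\<leftarrow>\<delta>W w. \<^bold>\<Sum>a b\<leftarrow>\<delta>V v0. \<^bold>\<Sum>c d\<leftarrow>\<delta>W w0. T a b v1 c d w1)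
    = (\<^bold>\<Sum>v0 v1\<leftarrow>\<delta>V v. \<^bold>\<Sum>w0 w1\<leftarrow>\<delta>W w. \<^bold>\<Sum>a b\<leftarrow>comult H v1. \<^bold>\<Sum>c d\<leftarrow>comult H w1. T v0 a b w0 c d)"
proof -
  interpret V: comodule H \<delta>V by unfold_locales (rule V)
  interpret W: comodule H \<delta>W by unfold_locales (rule W)
  note [lin] = ctrilinear_args[OF T(1)] ctrilinear_args[OF T(2)] clinear_comp[OF assms(3)]
  have "(\<^bold>\<Sum>v0 v1\<leftarrow>\<delta>V v. \<^bold>\<Sum>w0 w1\<leftarrow>\<delta>W w. \<^bold>\<Sum>a b\<leftarrow>\<delta>V v0. \<^bold>\<Sum>c d\<leftarrow>\<delta>W w0. T a b v1 c d w1)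
      = (\<^bold>\<Sum>v0 v1\<leftarrow>\<delta>V v. \<^bold>\<Sum>a b\<leftarrow>\<delta>V v0. \<^bold>\<Sum>w0 w1\<leftarrow>\<delta>W w. \<^bold>\<Sum>c d\<leftarrow>\<delta>W w0. T a b v1 c d w1)"
    by (intro tensor_lift_cong tensor_lift_swap)
  also have "\<dots> = (\<^bold>\<Sum>v0 v1\<leftarrow>\<delta>V v. \<^bold>\<Sum>a b\<leftarrow>\<delta>V v0. \<^bold>\<Sum>w0 w1\<leftarrow>\<delta>W w. \<^bold>\<Sum>c d\<leftarrow>comult H w1. T a b v1 w0 c d)"
    by (intro tensor_lift_cong W.coaction_coassoc T)
  also have "\<dots> = (\<^bold>\<Sum>v0 v1\<leftarrow>\<delta>V v. \<^bold>\<Sum>a b\<leftarrow>comult H v1. \<^bold>\<Sum>w0 w1\<leftarrow>\<delta>W w. \<^bold>\<Sum>c d\<leftarrow>comult H w1. T v0 a b w0 c d)"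
    by (intro V.coaction_coassoc) (intro lin)
  also have "\<dots> = (\<^bold>\<Sum>v0 v1\<leftarrow>\<delta>V v. \<^bold>\<Sum>w0 w1\<leftarrow>\<delta>W w. \<^bold>\<Sum>a b\<leftarrow>comult H v1. \<^bold>\<Sum>c d\<leftarrow>comult H w1. T v0 a b w0 c d)"
    by (intro tensor_lift_cong tensor_lift_swap)
  finally show ?thesis .
qed

text \<open>\<open>Rb\<close> names the convolution inverse of \<R>, which the definition of a
  coquasitriangular Hopf algebra asserts only to exist. As a parameter it gives a formula for the
  inverse braiding.\<close>

locale cqt_bialgebra =
  fixes H :: "('h::complex_alg) cqt_hopf" and Rb :: "'h \<Rightarrow> 'h \<Rightarrow> complex"
  assumes coalgebra: "coalgebra (comult H) (counit H)"
    and comult_hom: "algebra_hom (comult H)"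
    and counit_hom: "algebra_hom (counit H)"
    and rform_bilinear: "cbilinear (rform H)"
    and rinv_bilinear: "cbilinear Rb"
    and rform_rinv: "\<And>x y. (\<^bold>\<Sum>x1 x2\<leftarrow>comult H x. \<^bold>\<Sum>y1 y2\<leftarrow>comult H y. rform H x1 y1 * Rb x2 y2)
      = counit H x * counit H y"
    and rinv_rform: "\<And>x y. (\<^bold>\<Sum>x1 x2\<leftarrow>comult H x. \<^bold>\<Sum>y1 y2\<leftarrow>comult H y. Rb x1 y1 * rform H x2 y2)
      = counit H x * counit H y"
    and rform_mult_left: "\<And>x y z. rform H (x * y) z
      = (\<^bold>\<Sum>z1 z2\<leftarrow>comult H z. rform H x z1 * rform H y z2)"
    and rform_mult_right: "\<And>x y z. rform H x (y * z)
      = (\<^bold>\<Sum>x1 x2\<leftarrow>comult H x. rform H x1 z * rform H x2 y)"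
    and quasi_commutative: "\<And>x y.
      (\<^bold>\<Sum>x1 x2\<leftarrow>comult H x. \<^bold>\<Sum>y1 y2\<leftarrow>comult H y. rform H x2 y2 *\<^sub>C (y1 * x1))
      = (\<^bold>\<Sum>x1 x2\<leftarrow>comult H x. \<^bold>\<Sum>y1 y2\<leftarrow>comult H y. rform H x1 y1 *\<^sub>C (x2 * y2))"
begin

lemma clinear_comult: "clinear (comult H)" and clinear_counit: "clinear (counit H)"
  using coalgebra by (simp_all add: coalgebra_def)

lemmas [lin] = clinear_comp[OF clinear_comult] clinear_comp[OF clinear_counit]
  cbilinear_left[OF rform_bilinear] cbilinear_right[OF rform_bilinear]
  cbilinear_left[OF rinv_bilinear] cbilinear_right[OF rinv_bilinear]

lemma comult_one: "comult H 1 = 1 \<otimes> 1"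
  using comult_hom by (simp add: algebra_hom_def one_tensor_def)

lemma comult_mult: "comult H (x * y) = comult H x * comult H y"
  using comult_hom by (simp add: algebra_hom_def)

lemma counit_one: "counit H 1 = 1"
  using counit_hom by (simp add: algebra_hom_def)

lemma counit_mult: "counit H (x * y) = counit H x * counit H y"
  using counit_hom by (simp add: algebra_hom_def)

lemma comult_coassoc:
  assumes "ctrilinear T"
  shows "(\<^bold>\<Sum>a c\<leftarrow>comult H h. \<^bold>\<Sum>x y\<leftarrow>comult H a. T x y c)
    = (\<^bold>\<Sum>a b\<leftarrow>comult H h. \<^bold>\<Sum>x y\<leftarrow>comult H b. T a x y)"
  by (rule coassoc_lift[OF assms]) (use coalgebra in \<open>simp add: coalgebra_def\<close>)

lemma counit_left:
  assumes "clinear f"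
  shows "(\<^bold>\<Sum>a b\<leftarrow>comult H h. counit H a *\<^sub>C f b) = f h"
proof -
  have "f (\<^bold>\<Sum>a b\<leftarrow>comult H h. counit H a *\<^sub>C b) = f h"
    using coalgebra by (simp add: coalgebra_def)
  then show ?thesis
    by (simp add: clinear_tensor_liftI[OF assms] clinear_scale[OF assms])
qed

lemma counit_right:
  assumes "clinear f"
  shows "(\<^bold>\<Sum>a b\<leftarrow>comult H h. counit H b *\<^sub>C f a) = f h"
proof -
  have "f (\<^bold>\<Sum>a b\<leftarrow>comult H h. counit H b *\<^sub>C a) = f h"
    using coalgebra by (simp add: coalgebra_def)
  then show ?thesis
    by (simp add: clinear_tensor_liftI[OF assms] clinear_scale[OF assms])
qed

text \<open>\<open>\<R>(1, \<cdot>)\<close> and \<open>\<R>(\<cdot>, 1)\<close> are idempotent and invertible for convolution.\<close>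

lemma idempotent_convolution_counit:
  assumes f: "clinear f" and g: "clinear g"
    and idem: "\<And>h. (\<^bold>\<Sum>a b\<leftarrow>comult H h. f a * f b) = (f h :: complex)"
    and inv: "\<And>h. (\<^bold>\<Sum>a b\<leftarrow>comult H h. f a * g b) = counit H h"
  shows "f h = counit H h"
proof -
  note [lin] = clinear_comp[OF f] clinear_comp[OF g]
  have "f h = (\<^bold>\<Sum>a b\<leftarrow>comult H h. counit H b *\<^sub>C f a)"
    by (rule counit_right[OF f, symmetric])
  \<comment> \<open>The counit is replaced by the convolution of f and g; reassociating then brings
    f next to f, where idempotence removes one copy.\<close>
  also have "\<dots> = (\<^bold>\<Sum>a b\<leftarrow>comult H h. \<^bold>\<Sum>x y\<leftarrow>comult H b. f a * (f x * g y))"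
    by (simp only: tensor_lift_mult_left inv cscale_complex_def mult.commute)
  also have "\<dots> = (\<^bold>\<Sum>a b\<leftarrow>comult H h. \<^bold>\<Sum>x y\<leftarrow>comult H a. f x * (f y * g b))"
    by (rule comult_coassoc[symmetric]) (intro lin)
  also have "\<dots> = (\<^bold>\<Sum>a b\<leftarrow>comult H h. f a * g b)"
    by (simp only: mult.assoc[symmetric] tensor_lift_mult_right idem)
  finally show ?thesis
    by (simp only: inv)
qed

lemma rform_one_left: "rform H 1 h = counit H h"
proof (rule idempotent_convolution_counit[where g = "Rb 1"])
  fix h
  show "(\<^bold>\<Sum>a b\<leftarrow>comult H h. rform H 1 a * rform H 1 b) = rform H 1 h"
    using rform_mult_left[of 1 1 h] by simp
  have "cbilinear (\<lambda>x1 x2. \<^bold>\<Sum>y1 y2\<leftarrow>comult H h. rform H x1 y1 * Rb x2 y2)"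
    by (intro lin)
  from tensor_lift_pure[OF this] rform_rinv[where x = 1 and y = h]
  show "(\<^bold>\<Sum>a b\<leftarrow>comult H h. rform H 1 a * Rb 1 b) = counit H h"
    by (simp add: comult_one counit_one)
qed (intro lin)+

lemma rform_one_right: "rform H h 1 = counit H h"
proof (rule idempotent_convolution_counit[where f = "\<lambda>h. rform H h 1" and g = "\<lambda>h. Rb h 1"])
  fix h
  show "(\<^bold>\<Sum>a b\<leftarrow>comult H h. rform H a 1 * rform H b 1) = rform H h 1"
    using rform_mult_right[of h 1 1] by simp
  have "cbilinear (\<lambda>y1 y2. rform H a y1 * Rb b y2)" for a b
    by (intro lin)
  from tensor_lift_pure[OF this] rform_rinv[where x = h and y = 1]
  show "(\<^bold>\<Sum>a b\<leftarrow>comult H h. rform H a 1 * Rb b 1) = counit H h"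
    by (simp add: comult_one counit_one)
qed (intro lin)+

end

section \<open>Braidings, their inverses and tensor product coactions\<close>

definition braid_inverse ::
  "('h \<Rightarrow> 'h \<Rightarrow> complex) \<Rightarrow> ('v::complex_vec \<Rightarrow> 'v \<otimes> 'h::complex_alg)
    \<Rightarrow> ('w::complex_vec \<Rightarrow> 'w \<otimes> 'h) \<Rightarrow> 'w \<otimes> 'v \<Rightarrow> 'v \<otimes> 'w" where
  "braid_inverse Rb \<delta>V \<delta>W = tensor_lift (\<lambda>w v. \<^bold>\<Sum>v0 v1\<leftarrow>\<delta>V v. \<^bold>\<Sum>w0 w1\<leftarrow>\<delta>W w. Rb v1 w1 *\<^sub>C (v0 \<otimes> w0))"

locale comodule_pair = cqt_bialgebra H Rb + V: comodule H \<delta>V + W: comodule H \<delta>W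
  for H :: "('h::complex_alg) cqt_hopf" and Rb \<delta>V \<delta>W
begin

lemma clinear_braid: "clinear (braid H \<delta>V \<delta>W)"
  unfolding braid_def by (intro lin)

lemma braid_pure:
  "braid H \<delta>V \<delta>W (v \<otimes> w) = (\<^bold>\<Sum>v0 v1\<leftarrow>\<delta>V v. \<^bold>\<Sum>w0 w1\<leftarrow>\<delta>W w. rform H v1 w1 *\<^sub>C (w0 \<otimes> v0))"
  unfolding braid_def by (rule tensor_lift_pure) (intro lin)

lemma clinear_braid_inverse: "clinear (braid_inverse Rb \<delta>V \<delta>W)"
  unfolding braid_inverse_def by (intro lin)

lemma braid_inverse_pure:
  "braid_inverse Rb \<delta>V \<delta>W (w \<otimes> v) = (\<^bold>\<Sum>v0 v1\<leftarrow>\<delta>V v. \<^bold>\<Sum>w0 w1\<leftarrow>\<delta>W w. Rb v1 w1 *\<^sub>C (v0 \<otimes> w0))"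
  unfolding braid_inverse_def by (rule tensor_lift_pure) (intro lin)

lemma counit_pair:
  assumes "cbilinear F"
  shows "(\<^bold>\<Sum>v0 v1\<leftarrow>\<delta>V v. \<^bold>\<Sum>w0 w1\<leftarrow>\<delta>W w. (counit H v1 * counit H w1) *\<^sub>C F v0 w0) = F v w"
  by (simp add: cvec.scale_scale[symmetric] tensor_lift_scale V.coaction_counit[OF cbilinear_left[OF assms clinear_ident]]
      W.coaction_counit[OF cbilinear_right[OF assms clinear_ident]] del: cvec.scale_scale)

text \<open>Coassociativity gathers the values of \<open>Rb\<close> and of \<R> into their
  convolution, which is the product of two counits.\<close>

lemma braid_inverse_braid: "braid_inverse Rb \<delta>V \<delta>W (braid H \<delta>V \<delta>W x) = x"
proof (rule tensor_lift_eqI[where g = "\<lambda>x. x"])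
  fix v w
  have "braid_inverse Rb \<delta>V \<delta>W (braid H \<delta>V \<delta>W (v \<otimes> w))
      = (\<^bold>\<Sum>v0 v1\<leftarrow>\<delta>V v. \<^bold>\<Sum>w0 w1\<leftarrow>\<delta>W w. \<^bold>\<Sum>a b\<leftarrow>\<delta>V v0. \<^bold>\<Sum>c d\<leftarrow>\<delta>W w0.
          (Rb b d * rform H v1 w1) *\<^sub>C (a \<otimes> c))"
    by (simp add: braid_pure clinear_tensor_liftI[OF clinear_braid_inverse]
        clinear_scale[OF clinear_braid_inverse] braid_inverse_pure tensor_lift_scale[symmetric] mult.commute)
  also have "\<dots> = (\<^bold>\<Sum>v0 v1\<leftarrow>\<delta>V v. \<^bold>\<Sum>w0 w1\<leftarrow>\<delta>W w. \<^bold>\<Sum>a b\<leftarrow>comult H v1. \<^bold>\<Sum>c d\<leftarrow>comult H w1.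
          (Rb a c * rform H b d) *\<^sub>C (v0 \<otimes> w0))"
    by (rule coaction_coassoc2[OF V.comodule W.comodule clinear_comult]; intro lin)
  also have "\<dots> = v \<otimes> w"
    by (simp add: tensor_lift_scale_left rinv_rform counit_pair[OF cbilinear_pure])
  finally show "braid_inverse Rb \<delta>V \<delta>W (braid H \<delta>V \<delta>W (v \<otimes> w)) = v \<otimes> w" .
qed (intro lin clinear_comp[OF clinear_braid_inverse] clinear_braid)+

lemma braid_braid_inverse: "braid H \<delta>V \<delta>W (braid_inverse Rb \<delta>V \<delta>W x) = x"
proof (rule tensor_lift_eqI[where g = "\<lambda>x. x"])
  fix w v
  have "braid H \<delta>V \<delta>W (braid_inverse Rb \<delta>V \<delta>W (w \<otimes> v))
      = (\<^bold>\<Sum>v0 v1\<leftarrow>\<delta>V v. \<^bold>\<Sum>w0 w1\<leftarrow>\<delta>W w. \<^bold>\<Sum>a b\<leftarrow>\<delta>V v0. \<^bold>\<Sum>c d\<leftarrow>\<delta>W w0.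
          (rform H b d * Rb v1 w1) *\<^sub>C (c \<otimes> a))"
    by (simp add: braid_pure clinear_tensor_liftI[OF clinear_braid]
        clinear_scale[OF clinear_braid] braid_inverse_pure tensor_lift_scale[symmetric] mult.commute)
  also have "\<dots> = (\<^bold>\<Sum>v0 v1\<leftarrow>\<delta>V v. \<^bold>\<Sum>w0 w1\<leftarrow>\<delta>W w. \<^bold>\<Sum>a b\<leftarrow>comult H v1. \<^bold>\<Sum>c d\<leftarrow>comult H w1.
          (rform H a c * Rb b d) *\<^sub>C (w0 \<otimes> v0))"
    by (rule coaction_coassoc2[OF V.comodule W.comodule clinear_comult]; intro lin)
  also have "\<dots> = w \<otimes> v"
    using counit_pair[of "\<lambda>v w. w \<otimes> v"]
    by (simp add: tensor_lift_scale_left rform_rinv cbilinearI clinear_pure_left clinear_pure_right clinear_ident)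
  finally show "braid H \<delta>V \<delta>W (braid_inverse Rb \<delta>V \<delta>W (w \<otimes> v)) = w \<otimes> v" .
qed (intro lin clinear_comp[OF clinear_braid] clinear_braid_inverse)+

lemma bij_braid: "bij (braid H \<delta>V \<delta>W)"
  by (metis bijI' braid_braid_inverse braid_inverse_braid)

lemma inv_braid: "inv (braid H \<delta>V \<delta>W) = braid_inverse Rb \<delta>V \<delta>W"
  using braid_braid_inverse braid_inverse_braid by (metis inv_equality ext)

lemma clinear_tensor_coaction: "clinear (tensor_coaction \<delta>V \<delta>W)"
  unfolding tensor_coaction_def by (intro lin)

lemma tensor_coaction_pure:
  "tensor_coaction \<delta>V \<delta>W (v \<otimes> w)
    = (\<^bold>\<Sum>v0 v1\<leftarrow>\<delta>V v. \<^bold>\<Sum>w0 w1\<leftarrow>\<delta>W w. (v0 \<otimes> w0) \<otimes> (v1 * w1))"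
  unfolding tensor_coaction_def by (rule tensor_lift_pure) (intro lin)

end

text \<open>Coassociativity rewrites both composites as sums over comultiplications of v1 and w1;
  there the components in H are the two sides of \<open>quasi_commutative\<close>.\<close>

lemma (in comodule_pair) comodule_map_braid:
  "comodule_map (tensor_coaction \<delta>V \<delta>W) (tensor_coaction \<delta>W \<delta>V) (braid H \<delta>V \<delta>W)"
proof -
  interpret WV: comodule_pair H Rb \<delta>W \<delta>V
    by unfold_locales
  note lin_braid = clinear_tensor_map[OF clinear_braid clinear_id]
  have "tensor_coaction \<delta>W \<delta>V (braid H \<delta>V \<delta>W x)
      = tensor_map (braid H \<delta>V \<delta>W) id (tensor_coaction \<delta>V \<delta>W x)" for x
  proof (rule tensor_lift_eqI[where f = "\<lambda>x. tensor_coaction \<delta>W \<delta>V (braid H \<delta>V \<delta>W x)"])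
    fix v w
    have "tensor_coaction \<delta>W \<delta>V (braid H \<delta>V \<delta>W (v \<otimes> w))
        = (\<^bold>\<Sum>v0 v1\<leftarrow>\<delta>V v. \<^bold>\<Sum>w0 w1\<leftarrow>\<delta>W w. \<^bold>\<Sum>c d\<leftarrow>\<delta>W w0. \<^bold>\<Sum>a b\<leftarrow>\<delta>V v0.
            rform H v1 w1 *\<^sub>C ((c \<otimes> a) \<otimes> (d * b)))"
      by (simp add: braid_pure clinear_tensor_liftI[OF WV.clinear_tensor_coaction]
          clinear_scale[OF WV.clinear_tensor_coaction] WV.tensor_coaction_pure tensor_lift_scale)
    also have "\<dots> = (\<^bold>\<Sum>v0 v1\<leftarrow>\<delta>V v. \<^bold>\<Sum>w0 w1\<leftarrow>\<delta>W w. \<^bold>\<Sum>a b\<leftarrow>\<delta>V v0. \<^bold>\<Sum>c d\<leftarrow>\<delta>W w0.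
            rform H v1 w1 *\<^sub>C ((c \<otimes> a) \<otimes> (d * b)))"
      by (intro tensor_lift_cong tensor_lift_swap)
    also have "\<dots> = (\<^bold>\<Sum>v0 v1\<leftarrow>\<delta>V v. \<^bold>\<Sum>w0 w1\<leftarrow>\<delta>W w. \<^bold>\<Sum>a b\<leftarrow>comult H v1. \<^bold>\<Sum>c d\<leftarrow>comult H w1.
            rform H b d *\<^sub>C ((w0 \<otimes> v0) \<otimes> (c * a)))"
      by (rule coaction_coassoc2[OF V.comodule W.comodule clinear_comult]; intro lin)
    also have "\<dots> = (\<^bold>\<Sum>v0 v1\<leftarrow>\<delta>V v. \<^bold>\<Sum>w0 w1\<leftarrow>\<delta>W w. (w0 \<otimes> v0) \<otimes>
            (\<^bold>\<Sum>a b\<leftarrow>comult H v1. \<^bold>\<Sum>c d\<leftarrow>comult H w1. rform H b d *\<^sub>C (c * a)))"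
      by (simp add: pure_tensor_simps clinear_tensor_liftI[OF clinear_pure_right[OF clinear_ident]])
    also have "\<dots> = (\<^bold>\<Sum>v0 v1\<leftarrow>\<delta>V v. \<^bold>\<Sum>w0 w1\<leftarrow>\<delta>W w. (w0 \<otimes> v0) \<otimes>
            (\<^bold>\<Sum>a b\<leftarrow>comult H v1. \<^bold>\<Sum>c d\<leftarrow>comult H w1. rform H a c *\<^sub>C (b * d)))"
      by (simp only: quasi_commutative)
    also have "\<dots> = (\<^bold>\<Sum>v0 v1\<leftarrow>\<delta>V v. \<^bold>\<Sum>w0 w1\<leftarrow>\<delta>W w. \<^bold>\<Sum>a b\<leftarrow>comult H v1. \<^bold>\<Sum>c d\<leftarrow>comult H w1.
            rform H a c *\<^sub>C ((w0 \<otimes> v0) \<otimes> (b * d)))"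
      by (simp add: pure_tensor_simps clinear_tensor_liftI[OF clinear_pure_right[OF clinear_ident]])
    also have "\<dots> = (\<^bold>\<Sum>v0 v1\<leftarrow>\<delta>V v. \<^bold>\<Sum>w0 w1\<leftarrow>\<delta>W w. \<^bold>\<Sum>a b\<leftarrow>\<delta>V v0. \<^bold>\<Sum>c d\<leftarrow>\<delta>W w0.
            rform H b d *\<^sub>C ((c \<otimes> a) \<otimes> (v1 * w1)))"
      by (rule coaction_coassoc2[OF V.comodule W.comodule clinear_comult, symmetric]; intro lin)
    also have "\<dots> = tensor_map (braid H \<delta>V \<delta>W) id (tensor_coaction \<delta>V \<delta>W (v \<otimes> w))"
      by (simp add: tensor_coaction_pure clinear_tensor_liftI[OF lin_braid]
          tensor_map_pure[OF clinear_braid clinear_id] braid_pure pure_tensor_simps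
          clinear_tensor_liftI[OF clinear_pure_left[OF clinear_ident]])
    finally show "tensor_coaction \<delta>W \<delta>V (braid H \<delta>V \<delta>W (v \<otimes> w))
        = tensor_map (braid H \<delta>V \<delta>W) id (tensor_coaction \<delta>V \<delta>W (v \<otimes> w))" .
  qed (intro clinear_comp[OF WV.clinear_tensor_coaction] clinear_braid
      clinear_comp[OF lin_braid] clinear_tensor_coaction)+
  then show ?thesis
    by (simp add: comodule_map_def clinear_braid)
qed

section \<open>Tensor products over an algebra\<close>

text \<open>The representative picked by \<open>SOME\<close> differs from \<open>x\<close> by an
  element of the kernel of \<open>p\<close>, where \<open>f\<close> vanishes.\<close>

lemma descend_apply:
  assumes p: "clinear p" and f: "clinear f" and ker: "\<And>x. p x = 0 \<Longrightarrow> f x = 0"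
  shows "descend p f (p x) = f x"
proof -
  have "p (SOME y. p y = p x) = p x"
    by (rule someI) simp
  then have "f ((SOME y. p y = p x) - x) = 0"
    by (intro ker) (simp add: clinear_diff[OF p])
  then show ?thesis
    by (simp add: descend_def clinear_diff[OF f])
qed

lemma clinear_descend:
  assumes p: "clinear p" and "surj p" and f: "clinear f" and ker: "\<And>x. p x = 0 \<Longrightarrow> f x = 0"
  shows "clinear (descend p f)"
proof (rule clinearI)
  fix a b c
  obtain x y where xy: "a = p x" "b = p y"
    using \<open>surj p\<close> by (metis surjD)
  show "descend p f (a + b) = descend p f a + descend p f b"
    using descend_apply[OF p f ker, of "x + y"]
    by (simp add: xy descend_apply[OF p f ker] clinear_add[OF p] clinear_add[OF f])
  show "descend p f (c *\<^sub>C a) = c *\<^sub>C descend p f a"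
    using descend_apply[OF p f ker, of "c *\<^sub>C x"]
    by (simp add: xy descend_apply[OF p f ker] clinear_scale[OF p] clinear_scale[OF f])
qed

locale balanced_tensor =
  fixes lM :: "'b::complex_alg \<Rightarrow> 'm::complex_vec \<Rightarrow> 'm" and rM
    and lN :: "'b \<Rightarrow> 'n::complex_vec \<Rightarrow> 'n" and rN
    and p :: "'m \<otimes> 'n \<Rightarrow> 'w::complex_vec"
  assumes M: "bimodule lM rM" and N: "bimodule lN rN" and p: "tensor_over rM lN p"
begin

lemma clinear_p: "clinear p" and surj_p: "surj p"
  using p by (simp_all add: tensor_over_def quotient_projection_def)

lemma bilinear_actions: "cbilinear lM" "cbilinear rM" "cbilinear lN" "cbilinear rN"
  using M N by (simp_all add: bimodule_def)

lemmas [lin] = clinear_comp[OF clinear_p]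
  cbilinear_left[OF bilinear_actions(1)] cbilinear_right[OF bilinear_actions(1)]
  cbilinear_left[OF bilinear_actions(2)] cbilinear_right[OF bilinear_actions(2)]
  cbilinear_left[OF bilinear_actions(3)] cbilinear_right[OF bilinear_actions(3)]
  cbilinear_left[OF bilinear_actions(4)] cbilinear_right[OF bilinear_actions(4)]

lemma action_simps:
  "lM 1 m = m" "lM (a * b) m = lM a (lM b m)" "rM (lM a m) b = lM a (rM m b)"
  "rN n 1 = n" "rN n (a * b) = rN (rN n a) b" "rN (lN a n) b = lN a (rN n b)"
  using M N by (simp_all add: bimodule_def)

lemma p_balanced: "p (rM m b \<otimes> n) = p (m \<otimes> lN b n)"
proof -
  have "rM m b \<otimes> n - m \<otimes> lN b n \<in> {x. p x = 0}"
    using p unfolding tensor_over_def quotient_projection_def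
    by (metis (mono_tags, lifting) cvec.span_base mem_Collect_eq)
  then show ?thesis
    by (simp add: clinear_diff[OF clinear_p])
qed

lemma kernel_vanish:
  assumes f: "clinear f" and bal: "\<And>m b n. f (rM m b \<otimes> n) = f (m \<otimes> lN b n)" and "p x = 0"
  shows "f x = 0"
proof (rule span_vanish[OF f])
  show "x \<in> cvec.span {rM m b \<otimes> n - m \<otimes> lN b n | m b n. True}"
    using p \<open>p x = 0\<close> by (auto simp: tensor_over_def quotient_projection_def)
qed (auto simp: clinear_diff[OF f] bal)

lemma descend_balanced:
  assumes f: "clinear f" and bal: "\<And>m b n. f (rM m b \<otimes> n) = f (m \<otimes> lN b n)"
  shows "descend p f (p x) = f x" "clinear (descend p f)"
  using descend_apply[OF clinear_p f kernel_vanish[OF f bal]]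
    clinear_descend[OF clinear_p surj_p f kernel_vanish[OF f bal]] by blast+

lemma clinear_actions: "clinear (lM b)" "clinear (\<lambda>n. rN n b)"
  by (intro lin)+

text \<open>The left action on M commutes with its right action, hence preserves the balancing
  relations and descends. The same holds for the right action on N below.\<close>

lemma left_action: "tensor_over_left p lM b (p x) = p (tensor_map (lM b) id x)"
  and clinear_left_action: "clinear (tensor_over_left p lM b)"
  unfolding tensor_over_left_def
  by (intro descend_balanced lin clinear_actions;
      simp add: tensor_map_pure clinear_actions clinear_id p_balanced action_simps(3)[symmetric])+

lemma right_action: "tensor_over_right p rN (p x) b = p (tensor_map id (\<lambda>n. rN n b) x)"
  and clinear_right_action: "clinear (\<lambda>w. tensor_over_right p rN w b)"
  unfolding tensor_over_right_def
  by (intro descend_balanced lin clinear_actions;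
      simp add: tensor_map_pure clinear_actions clinear_id p_balanced action_simps)+

lemma action_pure:
  "tensor_over_left p lM b (p (m \<otimes> n)) = p (lM b m \<otimes> n)"
  "tensor_over_right p rN (p (m \<otimes> n)) b = p (m \<otimes> rN n b)"
  by (simp_all add: left_action right_action tensor_map_pure clinear_actions clinear_id)

lemma p_induct:
  assumes "\<And>m n. P (p (m \<otimes> n))" "\<And>x y. P x \<Longrightarrow> P y \<Longrightarrow> P (x + y)"
  shows "P w"
proof -
  obtain x where "w = p x"
    using surj_p by (metis surjD)
  moreover have "P (p x)"
    by (induction x rule: tensor_induct) (simp_all add: assms clinear_add[OF clinear_p])
  ultimately show ?thesis
    by simp
qed

lemma bimodule_balanced_tensor: "bimodule (tensor_over_left p lM) (tensor_over_right p rN)"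
proof -
  note [lin] = clinear_comp[OF clinear_left_action] clinear_comp[OF clinear_right_action]
  \<comment> \<open>The action is defined through \<open>descend\<close>, so linearity in the acting
    element becomes visible only once \<open>w\<close> is written as \<open>p x\<close> with
    \<open>x\<close> independent of \<open>b\<close>.\<close>
  have [lin]: "clinear (\<lambda>b. tensor_over_left p lM b w)" for w
  proof -
    obtain x where "w = p x"
      using surj_p by (metis surjD)
    then show ?thesis
      by (simp add: left_action tensor_map_def) (intro lin)
  qed
  have [lin]: "clinear (\<lambda>b. tensor_over_right p rN w b)" for w
  proof -
    obtain x where "w = p x"
      using surj_p by (metis surjD)
    then show ?thesis
      by (simp add: right_action tensor_map_def) (intro lin)
  qed
  note simps = action_pure action_simps clinear_add[OF clinear_left_action]
    clinear_add[OF clinear_right_action]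
  show ?thesis
    unfolding bimodule_def
  proof (intro conjI allI)
    fix a b w
    show "tensor_over_left p lM 1 w = w"
      by (induction w rule: p_induct) (simp_all add: simps)
    show "tensor_over_left p lM (a * b) w = tensor_over_left p lM a (tensor_over_left p lM b w)"
      by (induction w rule: p_induct) (simp_all add: simps)
    show "tensor_over_right p rN w 1 = w"
      by (induction w rule: p_induct) (simp_all add: simps)
    show "tensor_over_right p rN w (a * b) = tensor_over_right p rN (tensor_over_right p rN w a) b"
      by (induction w rule: p_induct) (simp_all add: simps)
    show "tensor_over_right p rN (tensor_over_left p lM a w) b
        = tensor_over_left p lM a (tensor_over_right p rN w b)"
      by (induction w rule: p_induct) (simp_all add: simps)
  qed (intro lin clinear_left_action clinear_right_action)+
qed

text \<open>Everything is tested on pure tensors: the images \<open>p (m \<otimes> n)\<close>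
  generate the balanced tensor product additively, and all maps involved are additive.\<close>

lemma bimodule_map_descend:
  assumes L: "bimodule l r" and f: "clinear f"
    and bal: "\<And>m b n. f (rM m b \<otimes> n) = f (m \<otimes> lN b n)"
    and left: "\<And>b m n. f (lM b m \<otimes> n) = l b (f (m \<otimes> n))"
    and right: "\<And>m n b. f (m \<otimes> rN n b) = r (f (m \<otimes> n)) b"
  shows "\<exists>\<psi>. bimodule_map (tensor_over_left p lM) (tensor_over_right p rN) l r \<psi>
    \<and> (\<forall>x. \<psi> (p x) = f x)"
proof (intro exI[of _ "descend p f"] conjI allI)
  note d = descend_balanced[OF f bal]
  have lr: "cbilinear l" "cbilinear r"
    using L by (simp_all add: bimodule_def)
  note simps = action_pure d(1) left right clinear_add[OF clinear_left_action]
    clinear_add[OF clinear_right_action] clinear_add[OF d(2)]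
    clinear_add[OF cbilinear_right[OF lr(1) clinear_ident]]
    clinear_add[OF cbilinear_left[OF lr(2) clinear_ident]]
  have "descend p f (tensor_over_left p lM b w) = l b (descend p f w)" for b w
    by (induction w rule: p_induct) (simp_all add: simps)
  moreover have "descend p f (tensor_over_right p rN w b) = r (descend p f w) b" for b w
    by (induction w rule: p_induct) (simp_all add: simps)
  ultimately show "bimodule_map (tensor_over_left p lM) (tensor_over_right p rN) l r (descend p f)"
    by (simp add: bimodule_map_def bimodule_balanced_tensor L d(2))
qed (rule descend_balanced[OF f bal])

end

section \<open>Pairings of one-forms\<close>

lemma clinear_inv:
  assumes "clinear f" "bij f"
  shows "clinear (inv f)"
proof (rule clinearI)
  have f: "f (inv f x) = x" for x
    using assms(2) by (simp add: bij_is_surj surj_f_inv_f)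
  have g: "inv f (f x) = x" for x
    using assms(2) by (simp add: bij_is_inj inv_f_f)
  fix x y c
  show "inv f (x + y) = inv f x + inv f y"
    using g[of "inv f x + inv f y"] by (simp add: clinear_add[OF assms(1)] f)
  show "inv f (c *\<^sub>C x) = c *\<^sub>C inv f x"
    using g[of "c *\<^sub>C inv f x"] by (simp add: clinear_scale[OF assms(1)] f)
qed

lemma algebra_homD:
  assumes "algebra_hom f"
  shows "clinear f" "f 1 = 1" "f (x * y) = f x * f y"
  using assms by (simp_all add: algebra_hom_def)

section \<open>The bimodules L and the pairing phi\<close>

lemma L_left_pure: "L_left a (c \<otimes> z) = (a * c) \<otimes> z"
  unfolding L_left_def by (subst tensor_map_pure) (intro lin | simp)+

lemma cbilinear_L_left: "cbilinear L_left"
  unfolding L_left_def tensor_map_def by (intro lin)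

lemmas [lin] = cbilinear_left[OF cbilinear_L_left] cbilinear_right[OF cbilinear_L_left]

lemma L_left_mult: "L_left (a * b) x = L_left a (L_left b x)"
  by (induction x rule: tensor_induct)
    (simp_all add: L_left_pure mult.assoc clinear_add[OF cbilinear_right[OF cbilinear_L_left clinear_ident]])

lemma L_left_one: "L_left 1 x = x"
  by (induction x rule: tensor_induct)
    (simp_all add: L_left_pure clinear_add[OF cbilinear_right[OF cbilinear_L_left clinear_ident]])

text \<open>This is the braided commutativity of the image of \<eta>: a value of \<eta> sits in L as
  \<open>1 \<otimes> z\<close>, and multiplying by 1 from the left changes nothing.\<close>

lemma L_right_unit:
  assumes "clinear \<Phi>"
  shows "L_right \<Phi> (1 \<otimes> z) b = \<Phi> (z \<otimes> b)"
  unfolding L_right_def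
  by (subst tensor_lift_pure) (intro lin clinear_comp[OF assms] | simp add: L_left_one)+

text \<open>A braiding of B with a one-dimensional object is the flip combined with an algebra
  endomorphism \<sigma>. Multiplicativity of \<sigma> gives associativity of the right action. L+ is
  the case of \<open>\<theta>'\<close>, L- that of \<open>\<theta>\<close>.\<close>

locale twisted_line =
  fixes \<Phi> :: "complex \<otimes> 'b::complex_alg \<Rightarrow> 'b \<otimes> complex" and \<sigma> :: "'b \<Rightarrow> 'b"
  assumes clinear_\<Phi>: "clinear \<Phi>" and \<sigma>_hom: "algebra_hom \<sigma>"
    and \<Phi>_pure: "\<And>z b. \<Phi> (z \<otimes> b) = \<sigma> b \<otimes> z"
begin

lemmas \<sigma>_simps = algebra_homD(2,3)[OF \<sigma>_hom]

lemmas [lin] = clinear_comp[OF clinear_\<Phi>] clinear_comp[OF algebra_homD(1)[OF \<sigma>_hom]]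

lemma cbilinear_L_right: "cbilinear (L_right \<Phi>)"
  unfolding L_right_def by (intro lin)

lemma L_right_pure: "L_right \<Phi> (c \<otimes> z) b = (c * \<sigma> b) \<otimes> z"
  unfolding L_right_def
  by (subst tensor_lift_pure) (intro lin | simp add: \<Phi>_pure L_left_pure)+

lemmas L_simps = L_left_pure L_right_pure
  clinear_add[OF cbilinear_left[OF cbilinear_L_right clinear_ident]]
  clinear_add[OF cbilinear_right[OF cbilinear_L_left clinear_ident]]

lemma bimodule_L: "bimodule L_left (L_right \<Phi>)"
  unfolding bimodule_def
proof (intro conjI allI)
  fix a b :: 'b and x :: "'b \<otimes> complex"
  show "L_right \<Phi> x 1 = x"
    by (induction x rule: tensor_induct) (simp_all add: L_simps \<sigma>_simps)
  show "L_right \<Phi> x (a * b) = L_right \<Phi> (L_right \<Phi> x a) b"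
    by (induction x rule: tensor_induct) (simp_all add: L_simps \<sigma>_simps mult.assoc)
  show "L_right \<Phi> (L_left a x) b = L_left a (L_right \<Phi> x b)"
    by (induction x rule: tensor_induct) (simp_all add: L_simps mult.assoc)
qed (rule cbilinear_L_left cbilinear_L_right L_left_one L_left_mult)+

lemma L_left_right: "L_right \<Phi> (L_left a x) b = L_left a (L_right \<Phi> x b)"
  using bimodule_L by (simp add: bimodule_def)

end

locale twisted_pairing = twisted_line \<Phi> \<sigma>
  for \<Phi> :: "complex \<otimes> 'b::complex_alg \<Rightarrow> 'b \<otimes> complex" and \<sigma> +
  fixes \<eta> :: "'v::complex_vec \<otimes> 'v \<Rightarrow> complex"
  assumes clinear_\<eta>: "clinear \<eta>"
begin

lemmas [lin] = clinear_comp[OF clinear_\<eta>]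
  cbilinear_left[OF cbilinear_L_right] cbilinear_right[OF cbilinear_L_right]

lemma phi_bilinear:
  "cbilinear (\<lambda>x y. \<^bold>\<Sum>a v\<leftarrow>x. \<^bold>\<Sum>w b\<leftarrow>y. L_right \<Phi> (L_left a (1 \<otimes> \<eta> (v \<otimes> w))) b)"
  by (intro lin)

lemma clinear_phi: "clinear (phi \<Phi> \<eta>)"
  unfolding phi_def by (rule clinear_tensor_lift[OF phi_bilinear])

lemma phi_pure: "phi \<Phi> \<eta> ((a \<otimes> v) \<otimes> (w \<otimes> b)) = (a * \<sigma> b) \<otimes> \<eta> (v \<otimes> w)"
proof -
  have bil: "cbilinear (\<lambda>a v. \<^bold>\<Sum>w b\<leftarrow>y. L_right \<Phi> (L_left a (1 \<otimes> \<eta> (v \<otimes> w))) b)"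
    "cbilinear (\<lambda>w b. L_right \<Phi> (L_left a (1 \<otimes> \<eta> (v \<otimes> w))) b)" for y a v
    by (intro lin)+
  show ?thesis
    unfolding phi_def
    by (subst tensor_lift_pure[OF phi_bilinear], subst tensor_lift_pure[OF bil(1)],
        subst tensor_lift_pure[OF bil(2)]) (simp add: L_left_pure L_right_pure)
qed

lemma omega10_right_pure: "omega10_right (v \<otimes> c) b = v \<otimes> (c * b)" for v :: 'v and b c :: 'b
  unfolding omega10_right_def by (subst tensor_map_pure) (intro lin | simp)+

lemma omega01_left_pure: "omega01_left a (c \<otimes> v) = (a * c) \<otimes> v" for v :: 'v and a c :: 'b
  unfolding omega01_left_def by (subst tensor_map_pure) (intro lin | simp)+

lemma cbilinear_omega10_right: "cbilinear (omega10_right :: 'v \<otimes> 'b \<Rightarrow> _)"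
  unfolding omega10_right_def tensor_map_def by (intro lin)

lemma cbilinear_omega01_left: "cbilinear (omega01_left :: 'b \<Rightarrow> 'b \<otimes> 'v \<Rightarrow> _)"
  unfolding omega01_left_def tensor_map_def by (intro lin)

lemmas [lin] = clinear_comp[OF clinear_phi]
  cbilinear_left[OF cbilinear_omega10_right] cbilinear_right[OF cbilinear_omega10_right]
  cbilinear_left[OF cbilinear_omega01_left] cbilinear_right[OF cbilinear_omega01_left]

lemma omega10_right_action: "omega10_right x 1 = x"
    "omega10_right x (a * b) = omega10_right (omega10_right x a) b" for x :: "'v \<otimes> 'b"
  by (induction x rule: tensor_induct;
    simp add: omega10_right_pure mult.assoc clinear_add[OF cbilinear_left[OF cbilinear_omega10_right clinear_ident]])+

lemma omega01_left_action: "omega01_left 1 x = x"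
    "omega01_left (a * b) x = omega01_left a (omega01_left b x)" for x :: "'b \<otimes> 'v"
  by (induction x rule: tensor_induct;
    simp add: omega01_left_pure mult.assoc clinear_add[OF cbilinear_right[OF cbilinear_omega01_left clinear_ident]])+

lemma phi_left: "phi \<Phi> \<eta> (omega01_left a x \<otimes> y) = L_left a (phi \<Phi> \<eta> (x \<otimes> y))"
  by (rule clinear_eqI2[where f = "\<lambda>x y. phi \<Phi> \<eta> (omega01_left a x \<otimes> y)"])
    ((intro lin)[1], (intro lin)[1], simp add: omega01_left_pure phi_pure L_left_pure mult.assoc)

lemma phi_right: "phi \<Phi> \<eta> (x \<otimes> omega10_right y b) = L_right \<Phi> (phi \<Phi> \<eta> (x \<otimes> y)) b"
  by (rule clinear_eqI2[where f = "\<lambda>x y. phi \<Phi> \<eta> (x \<otimes> omega10_right y b)"])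
    ((intro lin)[1], (intro lin)[1], simp add: omega10_right_pure phi_pure L_right_pure \<sigma>_simps mult.assoc)

end

text \<open>\<open>\<Psi>_mult\<close> is the hexagon identity for B \<otimes> B \<otimes> V
  followed by multiplication in B. \<open>\<Psi>_pairing\<close> is balancedness for generators v
  and w. The rest of the locale is module theory.\<close>

locale holomorphic_pairing = twisted_pairing \<Phi> \<sigma> \<eta>
  for \<Phi> :: "complex \<otimes> 'b::complex_alg \<Rightarrow> 'b \<otimes> complex" and \<sigma>
    and \<eta> :: "'v::complex_vec \<otimes> 'v \<Rightarrow> complex" +
  fixes \<Psi> :: "'b \<otimes> 'v \<Rightarrow> 'v \<otimes> 'b"
  assumes clinear_\<Psi>: "clinear \<Psi>" and bij_\<Psi>: "bij \<Psi>"
    and \<Psi>_mult: "\<And>a b v. omega10_left \<Psi> a (\<Psi> (b \<otimes> v)) = \<Psi> ((a * b) \<otimes> v)"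
    and \<Psi>_pairing: "\<And>v d w. phi \<Phi> \<eta> (inv \<Psi> (v \<otimes> d) \<otimes> (w \<otimes> 1)) = phi \<Phi> \<eta> ((1 \<otimes> v) \<otimes> \<Psi> (d \<otimes> w))"
begin

lemma \<Psi>_inv: "\<Psi> (inv \<Psi> x) = x" and inv_\<Psi>: "inv \<Psi> (\<Psi> y) = y"
  using bij_\<Psi> by (simp_all add: bij_is_surj surj_f_inv_f bij_is_inj inv_f_f)

lemmas clinear_inv_\<Psi> = clinear_inv[OF clinear_\<Psi> bij_\<Psi>]

lemmas [lin] = clinear_comp[OF clinear_\<Psi>] clinear_comp[OF clinear_inv_\<Psi>]

lemma cbilinear_omega10_left: "cbilinear (omega10_left \<Psi>)"
  unfolding omega10_left_def tensor_map_def by (intro lin)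

lemmas [lin] = cbilinear_left[OF cbilinear_omega10_left] cbilinear_right[OF cbilinear_omega10_left]

lemma omega10_left_pure: "omega10_left \<Psi> b (v \<otimes> c) = omega10_right (\<Psi> (b \<otimes> v)) c"
  unfolding omega10_left_def omega10_right_def tensor_map_def
  by (subst tensor_lift_pure) (intro lin | simp)+

lemma omega10_left_right: "omega10_left \<Psi> a (omega10_right x b) = omega10_right (omega10_left \<Psi> a x) b"
  by (rule tensor_lift_eqI[where f = "\<lambda>x. omega10_left \<Psi> a (omega10_right x b)"])
    ((intro lin)[1], (intro lin)[1], simp add: omega10_right_pure omega10_left_pure omega10_right_action)

text \<open>\<open>\<Psi>\<close> is an isomorphism onto the left module of (1,0)-forms from B
  \<otimes> V with plain left multiplication. The left module axioms and the left linearity of the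
  pairing are carried over from B \<otimes> V.\<close>

lemma omega10_left_\<Psi>: "omega10_left \<Psi> a (\<Psi> z) = \<Psi> (omega01_left a z)"
  by (rule tensor_lift_eqI[where f = "\<lambda>z. omega10_left \<Psi> a (\<Psi> z)"])
    ((intro lin)[1], (intro lin)[1], simp add: \<Psi>_mult omega01_left_pure)

lemma omega10_pure: "v \<otimes> c = omega10_right (v \<otimes> 1) c" for v :: 'v and c :: 'b
  by (simp add: omega10_right_pure)

lemma bimodule_omega10: "bimodule (omega10_left \<Psi>) (omega10_right :: 'v \<otimes> 'b \<Rightarrow> _)"
  unfolding bimodule_def
proof (intro conjI allI)
  fix a b and x :: "'v \<otimes> 'b"
  show "omega10_left \<Psi> 1 x = x"
    using omega10_left_\<Psi>[of 1 "inv \<Psi> x"] by (simp add: \<Psi>_inv omega01_left_action)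
  show "omega10_left \<Psi> (a * b) x = omega10_left \<Psi> a (omega10_left \<Psi> b x)"
    using omega10_left_\<Psi>[of _ "inv \<Psi> x"] by (simp add: \<Psi>_inv omega10_left_\<Psi> omega01_left_action)
qed (rule cbilinear_omega10_left cbilinear_omega10_right omega10_right_action omega10_left_right[symmetric])+

lemma tensor_map_inv_\<Psi>: "tensor_map (inv \<Psi>) id (x \<otimes> y) = inv \<Psi> x \<otimes> y"
  by (simp add: tensor_map_pure clinear_inv_\<Psi> clinear_id)

lemma pairing_left:
  "phi \<Phi> \<eta> (inv \<Psi> (omega10_left \<Psi> a x) \<otimes> y) = L_left a (phi \<Phi> \<eta> (inv \<Psi> x \<otimes> y))"
  using omega10_left_\<Psi>[of a "inv \<Psi> x"] by (simp add: \<Psi>_inv inv_\<Psi> phi_left)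

text \<open>
  \<open>\<Omega>\<^sup>1\<^sup>,\<^sup>0\<close> is generated by \<open>V\<close> as a left and as a right module, so balancedness need only be
  checked on generators.
\<close>

lemma pairing_balanced:
  "phi \<Phi> \<eta> (inv \<Psi> (omega10_right x d) \<otimes> y) = phi \<Phi> \<eta> (inv \<Psi> x \<otimes> omega10_left \<Psi> d y)"
proof -
  \<comment> \<open>Writing the first form as \<open>\<Psi> z\<close> with
    \<open>z = b \<otimes> v\<close> exhibits it as b.v, while the second one,
    \<open>w \<otimes> c\<close>, is w.c. Then b leaves on the left and c on the right, and
    \<open>\<Psi>_pairing\<close> remains.\<close>
  have "phi \<Phi> \<eta> (inv \<Psi> (omega10_right (\<Psi> z) d) \<otimes> y) = phi \<Phi> \<eta> (z \<otimes> omega10_left \<Psi> d y)" for z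
  proof (rule clinear_eqI2[where f = "\<lambda>z y. phi \<Phi> \<eta> (inv \<Psi> (omega10_right (\<Psi> z) d) \<otimes> y)"])
    fix b v w c
    have "phi \<Phi> \<eta> (inv \<Psi> (omega10_right (\<Psi> (b \<otimes> v)) d) \<otimes> (w \<otimes> c))
        = L_left b (L_right \<Phi> (phi \<Phi> \<eta> (inv \<Psi> (v \<otimes> d) \<otimes> (w \<otimes> 1))) c)"
      by (simp add: omega10_pure[of w c] omega10_left_pure[symmetric] phi_right pairing_left L_left_right)
    also have "\<dots> = L_left b (L_right \<Phi> (phi \<Phi> \<eta> ((1 \<otimes> v) \<otimes> \<Psi> (d \<otimes> w))) c)"
      by (simp only: \<Psi>_pairing)
    also have "\<dots> = phi \<Phi> \<eta> ((b \<otimes> v) \<otimes> omega10_left \<Psi> d (w \<otimes> c))"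
      by (simp add: omega10_left_pure phi_right phi_left[symmetric] omega01_left_pure L_left_right[symmetric])
    finally show "phi \<Phi> \<eta> (inv \<Psi> (omega10_right (\<Psi> (b \<otimes> v)) d) \<otimes> (w \<otimes> c))
      = phi \<Phi> \<eta> ((b \<otimes> v) \<otimes> omega10_left \<Psi> d (w \<otimes> c))" .
  qed (intro lin)+
  from this[of "inv \<Psi> x"] show ?thesis
    by (simp add: \<Psi>_inv)
qed

lemma bimodule_map_pairing:
  assumes "tensor_over omega10_right (omega10_left \<Psi>) p"
  shows "\<exists>\<psi>. bimodule_map (tensor_over_left p (omega10_left \<Psi>)) (tensor_over_right p omega10_right)
      L_left (L_right \<Phi>) \<psi> \<and> (\<forall>x. \<psi> (p x) = phi \<Phi> \<eta> (tensor_map (inv \<Psi>) id x))"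
proof -
  interpret balanced_tensor "omega10_left \<Psi>" omega10_right "omega10_left \<Psi>" omega10_right p
    by unfold_locales (rule bimodule_omega10 assms)+
  show ?thesis
    by (rule bimodule_map_descend[OF bimodule_L])
      ((intro lin clinear_inv_\<Psi>)[1],
       simp_all add: tensor_map_inv_\<Psi> pairing_balanced pairing_left phi_right)
qed

end

text \<open>Mirror image of \<open>holomorphic_pairing\<close>: (0,1)-forms have the plain action on
  the left and the braided one on the right, so the inverse braiding acts on the second
  factor.\<close>

locale antiholomorphic_pairing = twisted_pairing \<Phi> \<sigma> \<eta>
  for \<Phi> :: "complex \<otimes> 'b::complex_alg \<Rightarrow> 'b \<otimes> complex" and \<sigma>
    and \<eta> :: "'v::complex_vec \<otimes> 'v \<Rightarrow> complex" +
  fixes \<Psi> :: "'v \<otimes> 'b \<Rightarrow> 'b \<otimes> 'v"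
  assumes clinear_\<Psi>: "clinear \<Psi>" and bij_\<Psi>: "bij \<Psi>"
    and \<Psi>_mult: "\<And>a b v. omega01_right \<Psi> (\<Psi> (v \<otimes> a)) b = \<Psi> (v \<otimes> (a * b))"
    and \<Psi>_pairing: "\<And>v d w. phi \<Phi> \<eta> (\<Psi> (v \<otimes> d) \<otimes> (w \<otimes> 1)) = phi \<Phi> \<eta> ((1 \<otimes> v) \<otimes> inv \<Psi> (d \<otimes> w))"
begin

lemma \<Psi>_inv: "\<Psi> (inv \<Psi> x) = x" and inv_\<Psi>: "inv \<Psi> (\<Psi> y) = y"
  using bij_\<Psi> by (simp_all add: bij_is_surj surj_f_inv_f bij_is_inj inv_f_f)

lemmas clinear_inv_\<Psi> = clinear_inv[OF clinear_\<Psi> bij_\<Psi>]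

lemmas [lin] = clinear_comp[OF clinear_\<Psi>] clinear_comp[OF clinear_inv_\<Psi>]

lemma cbilinear_omega01_right: "cbilinear (omega01_right \<Psi>)"
  unfolding omega01_right_def tensor_map_def by (intro lin)

lemmas [lin] = cbilinear_left[OF cbilinear_omega01_right] cbilinear_right[OF cbilinear_omega01_right]

lemma omega01_right_pure: "omega01_right \<Psi> (c \<otimes> v) b = omega01_left c (\<Psi> (v \<otimes> b))"
  unfolding omega01_right_def omega01_left_def tensor_map_def
  by (subst tensor_lift_pure) (intro lin | simp)+

lemma omega01_right_left: "omega01_right \<Psi> (omega01_left a x) b = omega01_left a (omega01_right \<Psi> x b)"
  by (rule tensor_lift_eqI[where f = "\<lambda>x. omega01_right \<Psi> (omega01_left a x) b"])
    ((intro lin)[1], (intro lin)[1], simp add: omega01_right_pure omega01_left_pure omega01_left_action)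

text \<open>Here \<open>\<Psi>\<close> is an isomorphism of right modules, from V \<otimes> B with
  right multiplication onto the (0,1)-forms, and it transports the right module axioms.\<close>

lemma omega01_right_\<Psi>: "omega01_right \<Psi> (\<Psi> z) b = \<Psi> (omega10_right z b)"
  by (rule tensor_lift_eqI[where f = "\<lambda>z. omega01_right \<Psi> (\<Psi> z) b"])
    ((intro lin)[1], (intro lin)[1], simp add: \<Psi>_mult omega10_right_pure)

lemma omega01_pure: "c \<otimes> v = omega01_left c (1 \<otimes> v)" for v :: 'v and c :: 'b
  by (simp add: omega01_left_pure)

lemma bimodule_omega01: "bimodule omega01_left (omega01_right \<Psi>)"
  unfolding bimodule_def
proof (intro conjI allI)
  fix a b and x :: "'b \<otimes> 'v"
  show "omega01_right \<Psi> x 1 = x"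
    using omega01_right_\<Psi>[of "inv \<Psi> x" 1] by (simp add: \<Psi>_inv omega10_right_action)
  show "omega01_right \<Psi> x (a * b) = omega01_right \<Psi> (omega01_right \<Psi> x a) b"
    using omega01_right_\<Psi>[of "inv \<Psi> x"] by (simp add: \<Psi>_inv omega01_right_\<Psi> omega10_right_action)
qed (rule cbilinear_omega01_right cbilinear_omega01_left omega01_left_action omega01_right_left)+

lemma tensor_map_inv_\<Psi>: "tensor_map id (inv \<Psi>) (x \<otimes> y) = x \<otimes> inv \<Psi> y"
  by (simp add: tensor_map_pure clinear_inv_\<Psi> clinear_id)

lemma pairing_right:
  "phi \<Phi> \<eta> (x \<otimes> inv \<Psi> (omega01_right \<Psi> y b)) = L_right \<Phi> (phi \<Phi> \<eta> (x \<otimes> inv \<Psi> y)) b"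
  using omega01_right_\<Psi>[of "inv \<Psi> y" b] by (simp add: \<Psi>_inv inv_\<Psi> phi_right)

text \<open>The first form is b.v and the second, written as \<open>\<Psi> (w \<otimes> c)\<close>,
  is w.c. The outer b and c split off, which leaves the pairing law for v and w.\<close>

lemma pairing_balanced:
  "phi \<Phi> \<eta> (omega01_right \<Psi> x d \<otimes> inv \<Psi> y) = phi \<Phi> \<eta> (x \<otimes> inv \<Psi> (omega01_left d y))"
proof -
  have "phi \<Phi> \<eta> (omega01_right \<Psi> x d \<otimes> z) = phi \<Phi> \<eta> (x \<otimes> inv \<Psi> (omega01_left d (\<Psi> z)))" for z
  proof (rule clinear_eqI2[where f = "\<lambda>x z. phi \<Phi> \<eta> (omega01_right \<Psi> x d \<otimes> z)"])
    fix b v w c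
    have "phi \<Phi> \<eta> (omega01_right \<Psi> (b \<otimes> v) d \<otimes> (w \<otimes> c))
        = L_left b (L_right \<Phi> (phi \<Phi> \<eta> (\<Psi> (v \<otimes> d) \<otimes> (w \<otimes> 1))) c)"
      by (simp add: omega01_right_pure phi_left phi_right[symmetric] omega10_right_pure)
    also have "\<dots> = L_left b (L_right \<Phi> (phi \<Phi> \<eta> ((1 \<otimes> v) \<otimes> inv \<Psi> (d \<otimes> w))) c)"
      by (simp only: \<Psi>_pairing)
    also have "\<dots> = phi \<Phi> \<eta> ((b \<otimes> v) \<otimes> inv \<Psi> (omega01_left d (\<Psi> (w \<otimes> c))))"
      by (simp add: omega01_pure[of b v] phi_left omega01_right_pure[symmetric] pairing_right L_left_right)
    finally show "phi \<Phi> \<eta> (omega01_right \<Psi> (b \<otimes> v) d \<otimes> (w \<otimes> c))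
      = phi \<Phi> \<eta> ((b \<otimes> v) \<otimes> inv \<Psi> (omega01_left d (\<Psi> (w \<otimes> c))))" .
  qed (intro lin)+
  from this[of "inv \<Psi> y"] show ?thesis
    by (simp add: \<Psi>_inv)
qed

lemma bimodule_map_pairing:
  assumes "tensor_over (omega01_right \<Psi>) omega01_left p"
  shows "\<exists>\<psi>. bimodule_map (tensor_over_left p omega01_left) (tensor_over_right p (omega01_right \<Psi>))
      L_left (L_right \<Phi>) \<psi> \<and> (\<forall>x. \<psi> (p x) = phi \<Phi> \<eta> (tensor_map id (inv \<Psi>) x))"
proof -
  interpret balanced_tensor omega01_left "omega01_right \<Psi>" omega01_left "omega01_right \<Psi>" p
    by unfold_locales (rule bimodule_omega01 assms)+
  show ?thesis
    by (rule bimodule_map_descend[OF bimodule_L])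
      ((intro lin clinear_inv_\<Psi>)[1],
       simp_all add: tensor_map_inv_\<Psi> pairing_balanced pairing_right phi_left)
qed

end

text \<open>Oriented so that the simplifier moves factors into the sums, ending with a single
  product under all of them.\<close>

lemmas tensor_lift_factor = tensor_lift_mult_left[symmetric] tensor_lift_mult_right[symmetric]

section \<open>Invariant forms on comodules\<close>

text \<open>The left action on a right comodule of a functional \<rho>, seen as an element of the
  convolution algebra dual to H. Characters act on a comodule algebra by algebra
  homomorphisms.\<close>

definition twist :: "('v::complex_vec \<Rightarrow> 'v \<otimes> 'h::complex_vec) \<Rightarrow> ('h \<Rightarrow> complex) \<Rightarrow> 'v \<Rightarrow> 'v"
  where "twist \<delta> \<rho> v = (\<^bold>\<Sum>v0 v1\<leftarrow>\<delta> v. \<rho> v1 *\<^sub>C v0)"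

lemma algebra_hom_twist:
  fixes \<delta> :: "'b::complex_alg \<Rightarrow> 'b \<otimes> 'h::complex_alg"
  assumes "algebra_hom \<delta>" "algebra_hom \<rho>"
  shows "algebra_hom (twist \<delta> \<rho>)"
proof -
  note \<delta> = algebra_homD[OF assms(1)] and \<rho> = algebra_homD[OF assms(2)]
  note [lin] = clinear_comp[OF \<rho>(1)] clinear_comp[OF \<delta>(1)]
  have bil: "cbilinear (\<lambda>v0 v1. \<rho> v1 *\<^sub>C (v0::'b))"
    by (intro lin)
  have "twist \<delta> \<rho> (x * y) = twist \<delta> \<rho> x * twist \<delta> \<rho> y" for x y
  proof -
    have "twist \<delta> \<rho> (x * y) = (\<^bold>\<Sum>a b\<leftarrow>\<delta> x. \<^bold>\<Sum>c d\<leftarrow>\<delta> y. (\<rho> b *\<^sub>C a) * (\<rho> d *\<^sub>C c))"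
      by (simp add: twist_def \<delta> tensor_lift_mult[OF bil] \<rho> cscale_mult_left cscale_mult_right mult.commute)
    then show ?thesis
      by (simp only: twist_def tensor_lift_mult_left tensor_lift_mult_right)
  qed
  moreover have "twist \<delta> \<rho> 1 = 1"
    by (simp add: twist_def \<delta> one_tensor_def tensor_lift_pure[OF bil] \<rho>)
  moreover have "clinear (twist \<delta> \<rho>)"
    unfolding twist_def by (intro lin)
  ultimately show ?thesis
    by (simp add: algebra_hom_def)
qed

text \<open>By coassociativity, composing two such actions is acting by the convolution product,
  here the counit.\<close>

lemma (in comodule) twist_twist:
  assumes \<rho>: "clinear \<rho>" "clinear \<rho>'"
    and inv: "\<And>h. (\<^bold>\<Sum>a b\<leftarrow>comult H h. \<rho> a * \<rho>' b) = counit H h"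
  shows "twist \<delta> \<rho> (twist \<delta> \<rho>' v) = v"
proof -
  note [lin] = clinear_comp[OF \<rho>(1)] clinear_comp[OF \<rho>(2)]
  have lin_twist: "clinear (twist \<delta> \<rho>)"
    unfolding twist_def by (intro lin)
  have "twist \<delta> \<rho> (twist \<delta> \<rho>' v) = (\<^bold>\<Sum>v0 v1\<leftarrow>\<delta> v. \<^bold>\<Sum>a b\<leftarrow>\<delta> v0. (\<rho> b * \<rho>' v1) *\<^sub>C a)"
    unfolding twist_def[of _ \<rho>' v] clinear_tensor_liftI[OF lin_twist] clinear_scale[OF lin_twist]
    by (simp add: twist_def tensor_lift_scale[symmetric] mult.commute)
  also have "\<dots> = (\<^bold>\<Sum>v0 v1\<leftarrow>\<delta> v. \<^bold>\<Sum>a b\<leftarrow>comult H v1. (\<rho> a * \<rho>' b) *\<^sub>C v0)"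
    by (rule coaction_coassoc) (intro lin)
  also have "\<dots> = v"
    by (simp add: tensor_lift_scale_left inv coaction_counit[OF clinear_ident])
  finally show ?thesis .
qed

text \<open>\<open>D\<close> stands for t^2 and \<open>\<rho>\<close> for its pairing with H. As
  \<open>rform_D\<close> gives the same \<open>\<rho>\<close> on both sides, one automorphism
  \<open>\<theta>\<close> governs the braidings of B with the line in either order.\<close>

locale invariant_form = cqt_bialgebra H Rb + V: comodule H \<delta>V + B: comodule H \<delta>B
  for H :: "('h::complex_alg) cqt_hopf" and Rb
    and \<delta>V :: "'v::complex_vec \<Rightarrow> 'v \<otimes> 'h" and \<delta>B :: "'b::complex_alg \<Rightarrow> 'b \<otimes> 'h" +
  fixes D :: 'h and \<rho> \<rho>' :: "'h \<Rightarrow> complex" and \<eta> :: "'v \<otimes> 'v \<Rightarrow> complex"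
  assumes \<delta>B_hom: "algebra_hom \<delta>B"
    and \<rho>_hom: "algebra_hom \<rho>" and \<rho>'_hom: "algebra_hom \<rho>'"
    and \<rho>_inverse: "\<And>h. (\<^bold>\<Sum>a b\<leftarrow>comult H h. \<rho> a * \<rho>' b) = counit H h"
      "\<And>h. (\<^bold>\<Sum>a b\<leftarrow>comult H h. \<rho>' a * \<rho> b) = counit H h"
    and rform_D: "\<And>h. rform H h D = \<rho> h" "\<And>h. rform H D h = \<rho> h"
    and clinear_\<eta>: "clinear \<eta>"
    and \<eta>_invariant: "\<And>v w. (\<^bold>\<Sum>v0 v1\<leftarrow>\<delta>V v. \<^bold>\<Sum>w0 w1\<leftarrow>\<delta>V w. \<eta> (v0 \<otimes> w0) *\<^sub>C (v1 * w1)) = \<eta> (v \<otimes> w) *\<^sub>C D"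
begin

sublocale BV: comodule_pair H Rb \<delta>B \<delta>V
  by unfold_locales

sublocale VB: comodule_pair H Rb \<delta>V \<delta>B
  by unfold_locales

lemmas clinear_\<rho> = algebra_homD(1)[OF \<rho>_hom] algebra_homD(1)[OF \<rho>'_hom]

lemmas [lin] = clinear_comp[OF clinear_\<eta>] clinear_comp[OF clinear_\<rho>(1)] clinear_comp[OF clinear_\<rho>(2)]

text \<open>\<open>\<eta>_invariant\<close> with the functional \<open>rform H h\<close> applied to
  both sides. A product in the second argument of \<R> expands in reversed order, so w1 meets the
  first part of h.\<close>

lemma \<rho>_\<eta>_right: "\<rho> h * \<eta> (v \<otimes> w) = (\<^bold>\<Sum>v0 v1\<leftarrow>\<delta>V v. \<^bold>\<Sum>w0 w1\<leftarrow>\<delta>V w. \<^bold>\<Sum>a b\<leftarrow>comult H h.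
    (rform H a w1 * rform H b v1) * \<eta> (v0 \<otimes> w0))"
proof -
  have L: "clinear (rform H h)"
    by (intro lin)
  have "\<rho> h * \<eta> (v \<otimes> w) = rform H h (\<eta> (v \<otimes> w) *\<^sub>C D)"
    by (simp add: clinear_complex_mult[OF L] rform_D)
  then show ?thesis
    by (simp add: \<eta>_invariant[symmetric] clinear_tensor_liftI[OF L] clinear_complex_mult[OF L]
        rform_mult_right tensor_lift_factor mult.commute)
qed

text \<open>As for \<open>\<rho>_\<eta>_right\<close>, but a product in the first argument of \<R>
  keeps its order: v1 meets the first part of h.\<close>

lemma \<rho>_\<eta>_left: "\<rho> h * \<eta> (v \<otimes> w) = (\<^bold>\<Sum>v0 v1\<leftarrow>\<delta>V v. \<^bold>\<Sum>w0 w1\<leftarrow>\<delta>V w. \<^bold>\<Sum>a b\<leftarrow>comult H h.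
    (rform H v1 a * rform H w1 b) * \<eta> (v0 \<otimes> w0))"
proof -
  have L: "clinear (\<lambda>x. rform H x h)"
    by (intro lin)
  have "\<rho> h * \<eta> (v \<otimes> w) = rform H (\<eta> (v \<otimes> w) *\<^sub>C D) h"
    by (simp add: clinear_complex_mult[OF L] rform_D)
  then show ?thesis
    by (simp add: \<eta>_invariant[symmetric] clinear_tensor_liftI[OF L] clinear_complex_mult[OF L]
        rform_mult_left tensor_lift_factor mult.commute)
qed

text \<open>Inserting \<R> and its inverse on w yields \<R>(v1, h1) \<R>(w1, h2) Rb(w2, h3). The
  first two factors combine to \<open>\<rho>\<close> by invariance, and the inverse on w
  survives.\<close>

lemma pairing_identity_left:
  "(\<^bold>\<Sum>v0 v1\<leftarrow>\<delta>V v. rform H v1 h * \<eta> (v0 \<otimes> w))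
    = (\<^bold>\<Sum>w0 w1\<leftarrow>\<delta>V w. \<^bold>\<Sum>a b\<leftarrow>comult H h. (\<rho> a * Rb w1 b) * \<eta> (v \<otimes> w0))"
proof -
  let ?\<Delta> = "comult H"
  have "(\<^bold>\<Sum>v0 v1\<leftarrow>\<delta>V v. rform H v1 h * \<eta> (v0 \<otimes> w))
    = (\<^bold>\<Sum>v0 v1\<leftarrow>\<delta>V v. \<^bold>\<Sum>w0 w1\<leftarrow>\<delta>V w. \<^bold>\<Sum>a b\<leftarrow>?\<Delta> h.
        (counit H w1 * counit H b) * (rform H v1 a * \<eta> (v0 \<otimes> w0)))"
  proof (rule tensor_lift_cong)
    fix v0 v1
    have "(\<^bold>\<Sum>w0 w1\<leftarrow>\<delta>V w. \<^bold>\<Sum>a b\<leftarrow>?\<Delta> h. (counit H w1 * counit H b) * (rform H v1 a * \<eta> (v0 \<otimes> w0)))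
      = (\<^bold>\<Sum>w0 w1\<leftarrow>\<delta>V w. counit H w1 *\<^sub>C (\<^bold>\<Sum>a b\<leftarrow>?\<Delta> h. counit H b *\<^sub>C (rform H v1 a * \<eta> (v0 \<otimes> w0))))"
      by (simp add: cscale_complex_def tensor_lift_factor mult.assoc)
    also have "\<dots> = (\<^bold>\<Sum>w0 w1\<leftarrow>\<delta>V w. counit H w1 *\<^sub>C (rform H v1 h * \<eta> (v0 \<otimes> w0)))"
      by (subst counit_right) ((intro lin)[1], simp)
    also have "\<dots> = rform H v1 h * \<eta> (v0 \<otimes> w)"
      by (rule V.coaction_counit) (intro lin)
    finally show "rform H v1 h * \<eta> (v0 \<otimes> w) = (\<^bold>\<Sum>w0 w1\<leftarrow>\<delta>V w. \<^bold>\<Sum>a b\<leftarrow>?\<Delta> h.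
        (counit H w1 * counit H b) * (rform H v1 a * \<eta> (v0 \<otimes> w0)))" ..
  qed
  \<comment> \<open>The counits inserted for w1 and for the second part of h become the convolution
    of \<R> with its inverse.\<close>
  also have "\<dots> = (\<^bold>\<Sum>v0 v1\<leftarrow>\<delta>V v. \<^bold>\<Sum>w0 w1\<leftarrow>\<delta>V w. \<^bold>\<Sum>a b\<leftarrow>?\<Delta> h. \<^bold>\<Sum>x y\<leftarrow>?\<Delta> w1. \<^bold>\<Sum>c d\<leftarrow>?\<Delta> b.
        (rform H x c * Rb y d) * (rform H v1 a * \<eta> (v0 \<otimes> w0)))"
    by (simp add: rform_rinv[symmetric] tensor_lift_factor)
  also have "\<dots> = (\<^bold>\<Sum>v0 v1\<leftarrow>\<delta>V v. \<^bold>\<Sum>w0 w1\<leftarrow>\<delta>V w. \<^bold>\<Sum>x y\<leftarrow>?\<Delta> w1. \<^bold>\<Sum>a b\<leftarrow>?\<Delta> h. \<^bold>\<Sum>c d\<leftarrow>?\<Delta> b.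
        (rform H x c * Rb y d) * (rform H v1 a * \<eta> (v0 \<otimes> w0)))"
    by (intro tensor_lift_cong tensor_lift_swap)
  also have "\<dots> = (\<^bold>\<Sum>v0 v1\<leftarrow>\<delta>V v. \<^bold>\<Sum>w0 w1\<leftarrow>\<delta>V w. \<^bold>\<Sum>x y\<leftarrow>?\<Delta> w1. \<^bold>\<Sum>a b\<leftarrow>?\<Delta> h. \<^bold>\<Sum>c d\<leftarrow>?\<Delta> a.
        (rform H x d * Rb y b) * (rform H v1 c * \<eta> (v0 \<otimes> w0)))"
    by (rule tensor_lift_cong, rule tensor_lift_cong, rule tensor_lift_cong, rule comult_coassoc[symmetric])
      (intro lin)
  also have "\<dots> = (\<^bold>\<Sum>v0 v1\<leftarrow>\<delta>V v. \<^bold>\<Sum>w0 w1\<leftarrow>\<delta>V w. \<^bold>\<Sum>x y\<leftarrow>\<delta>V w0. \<^bold>\<Sum>a b\<leftarrow>?\<Delta> h. \<^bold>\<Sum>c d\<leftarrow>?\<Delta> a.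
        (rform H y d * Rb w1 b) * (rform H v1 c * \<eta> (v0 \<otimes> x)))"
    by (rule tensor_lift_cong, rule V.coaction_coassoc[symmetric]) (intro lin)
  also have "\<dots> = (\<^bold>\<Sum>w0 w1\<leftarrow>\<delta>V w. \<^bold>\<Sum>v0 v1\<leftarrow>\<delta>V v. \<^bold>\<Sum>x y\<leftarrow>\<delta>V w0. \<^bold>\<Sum>a b\<leftarrow>?\<Delta> h. \<^bold>\<Sum>c d\<leftarrow>?\<Delta> a.
        (rform H y d * Rb w1 b) * (rform H v1 c * \<eta> (v0 \<otimes> x)))"
    by (rule tensor_lift_swap)
  also have "\<dots> = (\<^bold>\<Sum>w0 w1\<leftarrow>\<delta>V w. \<^bold>\<Sum>v0 v1\<leftarrow>\<delta>V v. \<^bold>\<Sum>a b\<leftarrow>?\<Delta> h. \<^bold>\<Sum>x y\<leftarrow>\<delta>V w0. \<^bold>\<Sum>c d\<leftarrow>?\<Delta> a.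
        (rform H y d * Rb w1 b) * (rform H v1 c * \<eta> (v0 \<otimes> x)))"
    by (intro tensor_lift_cong tensor_lift_swap)
  also have "\<dots> = (\<^bold>\<Sum>w0 w1\<leftarrow>\<delta>V w. \<^bold>\<Sum>a b\<leftarrow>?\<Delta> h. \<^bold>\<Sum>v0 v1\<leftarrow>\<delta>V v. \<^bold>\<Sum>x y\<leftarrow>\<delta>V w0. \<^bold>\<Sum>c d\<leftarrow>?\<Delta> a.
        (rform H y d * Rb w1 b) * (rform H v1 c * \<eta> (v0 \<otimes> x)))"
    by (intro tensor_lift_cong tensor_lift_swap)
  \<comment> \<open>The three inner sums are the right-hand side of
    \<open>\<rho>_\<eta>_left\<close> for a, v and w0.\<close>
  also have "\<dots> = (\<^bold>\<Sum>w0 w1\<leftarrow>\<delta>V w. \<^bold>\<Sum>a b\<leftarrow>?\<Delta> h. Rb w1 b * (\<rho> a * \<eta> (v \<otimes> w0)))"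
    by (simp add: \<rho>_\<eta>_left tensor_lift_factor mult_ac)
  finally show ?thesis
    by (simp add: mult_ac)
qed

text \<open>In \<R>(h1, w1) \<R>(h2, v1) Rb(h3, v2) the last two factors cancel, which gives Y, and
  the first two combine to \<open>\<rho>\<close>, which leaves \<open>\<rho>\<close> convolved with
  X. Here X is the sum to be computed, so \<open>\<rho>\<close> is still to be removed, by
  convolving with \<open>\<rho>'\<close> on the left.\<close>

lemma pairing_identity_right:
  "(\<^bold>\<Sum>v0 v1\<leftarrow>\<delta>V v. Rb h v1 * \<eta> (v0 \<otimes> w))
    = (\<^bold>\<Sum>a b\<leftarrow>comult H h. \<^bold>\<Sum>w0 w1\<leftarrow>\<delta>V w. (\<rho>' a * rform H b w1) * \<eta> (v \<otimes> w0))"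
proof -
  let ?\<Delta> = "comult H"
  define X where "X h = (\<^bold>\<Sum>v0 v1\<leftarrow>\<delta>V v. Rb h v1 * \<eta> (v0 \<otimes> w))" for h
  define Y where "Y h = (\<^bold>\<Sum>w0 w1\<leftarrow>\<delta>V w. rform H h w1 * \<eta> (v \<otimes> w0))" for h
  have X: "clinear X"
    unfolding X_def by (intro lin)
  note [lin] = clinear_comp[OF X]
  have Y: "Y h = (\<^bold>\<Sum>a b\<leftarrow>?\<Delta> h. \<rho> a * X b)" for h
  proof -
    have "Y h = (\<^bold>\<Sum>w0 w1\<leftarrow>\<delta>V w. \<^bold>\<Sum>v0 v1\<leftarrow>\<delta>V v. \<^bold>\<Sum>a b\<leftarrow>?\<Delta> h.
        (counit H b * counit H v1) * (rform H a w1 * \<eta> (v0 \<otimes> w0)))"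
      unfolding Y_def
    proof (rule tensor_lift_cong)
      fix w0 w1
      have "(\<^bold>\<Sum>v0 v1\<leftarrow>\<delta>V v. \<^bold>\<Sum>a b\<leftarrow>?\<Delta> h. (counit H b * counit H v1) * (rform H a w1 * \<eta> (v0 \<otimes> w0)))
        = (\<^bold>\<Sum>v0 v1\<leftarrow>\<delta>V v. counit H v1 *\<^sub>C (\<^bold>\<Sum>a b\<leftarrow>?\<Delta> h. counit H b *\<^sub>C (rform H a w1 * \<eta> (v0 \<otimes> w0))))"
        by (simp add: cscale_complex_def tensor_lift_factor mult_ac)
      also have "\<dots> = (\<^bold>\<Sum>v0 v1\<leftarrow>\<delta>V v. counit H v1 *\<^sub>C (rform H h w1 * \<eta> (v0 \<otimes> w0)))"
        by (subst counit_right) ((intro lin)[1], simp)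
      also have "\<dots> = rform H h w1 * \<eta> (v \<otimes> w0)"
        by (rule V.coaction_counit) (intro lin)
      finally show "rform H h w1 * \<eta> (v \<otimes> w0) = (\<^bold>\<Sum>v0 v1\<leftarrow>\<delta>V v. \<^bold>\<Sum>a b\<leftarrow>?\<Delta> h.
          (counit H b * counit H v1) * (rform H a w1 * \<eta> (v0 \<otimes> w0)))" ..
    qed
    also have "\<dots> = (\<^bold>\<Sum>w0 w1\<leftarrow>\<delta>V w. \<^bold>\<Sum>v0 v1\<leftarrow>\<delta>V v. \<^bold>\<Sum>a b\<leftarrow>?\<Delta> h. \<^bold>\<Sum>c d\<leftarrow>?\<Delta> b. \<^bold>\<Sum>x y\<leftarrow>?\<Delta> v1.
        (rform H c x * Rb d y) * (rform H a w1 * \<eta> (v0 \<otimes> w0)))"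
      by (simp add: rform_rinv[symmetric] tensor_lift_factor)
    also have "\<dots> = (\<^bold>\<Sum>w0 w1\<leftarrow>\<delta>V w. \<^bold>\<Sum>v0 v1\<leftarrow>\<delta>V v. \<^bold>\<Sum>a b\<leftarrow>?\<Delta> h. \<^bold>\<Sum>c d\<leftarrow>?\<Delta> a. \<^bold>\<Sum>x y\<leftarrow>?\<Delta> v1.
        (rform H d x * Rb b y) * (rform H c w1 * \<eta> (v0 \<otimes> w0)))"
      by (rule tensor_lift_cong, rule tensor_lift_cong, rule comult_coassoc[symmetric]) (intro lin)
    also have "\<dots> = (\<^bold>\<Sum>w0 w1\<leftarrow>\<delta>V w. \<^bold>\<Sum>v0 v1\<leftarrow>\<delta>V v. \<^bold>\<Sum>a b\<leftarrow>?\<Delta> h. \<^bold>\<Sum>x y\<leftarrow>?\<Delta> v1. \<^bold>\<Sum>c d\<leftarrow>?\<Delta> a.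
        (rform H d x * Rb b y) * (rform H c w1 * \<eta> (v0 \<otimes> w0)))"
      by (intro tensor_lift_cong tensor_lift_swap)
    also have "\<dots> = (\<^bold>\<Sum>w0 w1\<leftarrow>\<delta>V w. \<^bold>\<Sum>v0 v1\<leftarrow>\<delta>V v. \<^bold>\<Sum>x y\<leftarrow>?\<Delta> v1. \<^bold>\<Sum>a b\<leftarrow>?\<Delta> h. \<^bold>\<Sum>c d\<leftarrow>?\<Delta> a.
        (rform H d x * Rb b y) * (rform H c w1 * \<eta> (v0 \<otimes> w0)))"
      by (intro tensor_lift_cong tensor_lift_swap)
    also have "\<dots> = (\<^bold>\<Sum>w0 w1\<leftarrow>\<delta>V w. \<^bold>\<Sum>v0 v1\<leftarrow>\<delta>V v. \<^bold>\<Sum>x y\<leftarrow>\<delta>V v0. \<^bold>\<Sum>a b\<leftarrow>?\<Delta> h. \<^bold>\<Sum>c d\<leftarrow>?\<Delta> a.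
        (rform H d y * Rb b v1) * (rform H c w1 * \<eta> (x \<otimes> w0)))"
      by (rule tensor_lift_cong, rule V.coaction_coassoc[symmetric]) (intro lin)
    also have "\<dots> = (\<^bold>\<Sum>w0 w1\<leftarrow>\<delta>V w. \<^bold>\<Sum>v0 v1\<leftarrow>\<delta>V v. \<^bold>\<Sum>a b\<leftarrow>?\<Delta> h. \<^bold>\<Sum>x y\<leftarrow>\<delta>V v0. \<^bold>\<Sum>c d\<leftarrow>?\<Delta> a.
        (rform H d y * Rb b v1) * (rform H c w1 * \<eta> (x \<otimes> w0)))"
      by (intro tensor_lift_cong tensor_lift_swap)
    also have "\<dots> = (\<^bold>\<Sum>w0 w1\<leftarrow>\<delta>V w. \<^bold>\<Sum>a b\<leftarrow>?\<Delta> h. \<^bold>\<Sum>v0 v1\<leftarrow>\<delta>V v. \<^bold>\<Sum>x y\<leftarrow>\<delta>V v0. \<^bold>\<Sum>c d\<leftarrow>?\<Delta> a.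
        (rform H d y * Rb b v1) * (rform H c w1 * \<eta> (x \<otimes> w0)))"
      by (intro tensor_lift_cong tensor_lift_swap)
    also have "\<dots> = (\<^bold>\<Sum>a b\<leftarrow>?\<Delta> h. \<^bold>\<Sum>w0 w1\<leftarrow>\<delta>V w. \<^bold>\<Sum>v0 v1\<leftarrow>\<delta>V v. \<^bold>\<Sum>x y\<leftarrow>\<delta>V v0. \<^bold>\<Sum>c d\<leftarrow>?\<Delta> a.
        (rform H d y * Rb b v1) * (rform H c w1 * \<eta> (x \<otimes> w0)))"
      by (rule tensor_lift_swap)
    also have "\<dots> = (\<^bold>\<Sum>a b\<leftarrow>?\<Delta> h. \<^bold>\<Sum>v0 v1\<leftarrow>\<delta>V v. \<^bold>\<Sum>w0 w1\<leftarrow>\<delta>V w. \<^bold>\<Sum>x y\<leftarrow>\<delta>V v0. \<^bold>\<Sum>c d\<leftarrow>?\<Delta> a.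
        (rform H d y * Rb b v1) * (rform H c w1 * \<eta> (x \<otimes> w0)))"
      by (rule tensor_lift_cong, rule tensor_lift_swap)
    also have "\<dots> = (\<^bold>\<Sum>a b\<leftarrow>?\<Delta> h. \<^bold>\<Sum>v0 v1\<leftarrow>\<delta>V v. \<^bold>\<Sum>x y\<leftarrow>\<delta>V v0. \<^bold>\<Sum>w0 w1\<leftarrow>\<delta>V w. \<^bold>\<Sum>c d\<leftarrow>?\<Delta> a.
        (rform H d y * Rb b v1) * (rform H c w1 * \<eta> (x \<otimes> w0)))"
      by (rule tensor_lift_cong, rule tensor_lift_cong, rule tensor_lift_swap)
    also have "\<dots> = (\<^bold>\<Sum>a b\<leftarrow>?\<Delta> h. \<^bold>\<Sum>v0 v1\<leftarrow>\<delta>V v. Rb b v1 * (\<rho> a * \<eta> (v0 \<otimes> w)))"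
      by (simp add: \<rho>_\<eta>_right tensor_lift_factor mult_ac)
    finally show ?thesis
      by (simp add: X_def tensor_lift_factor mult_ac)
  qed
  have "(\<^bold>\<Sum>a b\<leftarrow>?\<Delta> h. \<rho>' a * Y b) = (\<^bold>\<Sum>a b\<leftarrow>?\<Delta> h. \<^bold>\<Sum>c d\<leftarrow>?\<Delta> b. (\<rho>' a * \<rho> c) * X d)"
    by (simp add: Y tensor_lift_factor mult_ac)
  \<comment> \<open>Reassociation brings \<open>\<rho>'\<close> next to \<open>\<rho>\<close>; their
    convolution is the counit.\<close>
  also have "\<dots> = (\<^bold>\<Sum>a b\<leftarrow>?\<Delta> h. \<^bold>\<Sum>c d\<leftarrow>?\<Delta> a. (\<rho>' c * \<rho> d) * X b)"
    by (rule comult_coassoc[symmetric]) (intro lin)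
  also have "\<dots> = (\<^bold>\<Sum>a b\<leftarrow>?\<Delta> h. counit H a *\<^sub>C X b)"
    by (simp only: tensor_lift_mult_right \<rho>_inverse cscale_complex_def)
  also have "\<dots> = X h"
    by (rule counit_left[OF X])
  finally show ?thesis
    by (simp add: X_def Y_def tensor_lift_factor mult_ac)
qed

section \<open>Braidings with the line spanned by D\<close>

abbreviation "\<delta>D \<equiv> (\<lambda>z::complex. z \<otimes> D)"

abbreviation "\<theta> \<equiv> twist \<delta>B \<rho>"
abbreviation "\<theta>' \<equiv> twist \<delta>B \<rho>'"

lemma \<theta>_hom: "algebra_hom \<theta>" "algebra_hom \<theta>'"
  by (intro algebra_hom_twist \<delta>B_hom \<rho>_hom \<rho>'_hom)+

lemma \<theta>_inverse: "\<theta> (\<theta>' b) = b" "\<theta>' (\<theta> b) = b"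
  by (intro B.twist_twist clinear_\<rho> \<rho>_inverse)+

lemmas [lin] = clinear_comp[OF algebra_homD(1)[OF \<theta>_hom(1)]] clinear_comp[OF algebra_homD(1)[OF \<theta>_hom(2)]]

lemma clinear_braid_D: "clinear (braid H \<delta>D \<delta>B)" "clinear (braid H \<delta>B \<delta>D)"
  unfolding braid_def by (intro lin)+

lemma braid_DB: "braid H \<delta>D \<delta>B (z \<otimes> b) = \<theta> b \<otimes> z"
proof -
  have "cbilinear (\<lambda>v0 v1. \<^bold>\<Sum>w0 w1\<leftarrow>\<delta>B b. rform H v1 w1 *\<^sub>C (w0 \<otimes> (v0::complex)))"
    "cbilinear (\<lambda>v w. \<^bold>\<Sum>v0 v1\<leftarrow>\<delta>D v. \<^bold>\<Sum>w0 w1\<leftarrow>\<delta>B w. rform H v1 w1 *\<^sub>C (w0 \<otimes> (v0::complex)))"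
    by (intro lin)+
  then show ?thesis
    by (simp add: braid_def tensor_lift_pure rform_D twist_def pure_tensor_simps
        clinear_tensor_liftI[OF clinear_pure_left[OF clinear_ident]])
qed

lemma braid_BD: "braid H \<delta>B \<delta>D (b \<otimes> z) = z \<otimes> \<theta> b"
proof -
  have bil: "cbilinear (\<lambda>w0 w1. rform H v1 w1 *\<^sub>C ((w0::complex) \<otimes> v0))" for v1 and v0 :: 'b
    by (intro lin)
  have "cbilinear (\<lambda>v w. \<^bold>\<Sum>v0 v1\<leftarrow>\<delta>B v. \<^bold>\<Sum>w0 w1\<leftarrow>\<delta>D w. rform H v1 w1 *\<^sub>C ((w0::complex) \<otimes> v0))"
    by (intro lin)
  from tensor_lift_pure[OF this] show ?thesis
    by (simp add: braid_def tensor_lift_pure[OF bil] rform_D twist_def pure_tensor_simps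
        clinear_tensor_liftI[OF clinear_pure_right[OF clinear_ident]])
qed

text \<open>The braiding from B \<otimes> CD to CD \<otimes> B is a flip twisted by
  \<open>\<theta>\<close>, so its inverse starts at CD \<otimes> B, as L+ requires, and is twisted
  by \<open>\<theta>'\<close>.\<close>

lemma bij_braid_BD: "bij (braid H \<delta>B \<delta>D)"
  and inv_braid_BD: "inv (braid H \<delta>B \<delta>D) (z \<otimes> b) = \<theta>' b \<otimes> z"
proof -
  define g where "g = tensor_lift (\<lambda>(z::complex) b. \<theta>' b \<otimes> z)"
  have bil: "cbilinear (\<lambda>(z::complex) b. \<theta>' b \<otimes> z)"
    by (intro lin)
  have g: "g (z \<otimes> b) = \<theta>' b \<otimes> z" "clinear g" for z b
    unfolding g_def by (rule tensor_lift_pure[OF bil] clinear_tensor_lift[OF bil])+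
  have 1: "braid H \<delta>B \<delta>D (g x) = x" for x
    by (rule tensor_lift_eqI[OF clinear_comp[OF clinear_braid_D(2) g(2)] clinear_ident])
      (simp add: g braid_BD \<theta>_inverse)
  have 2: "g (braid H \<delta>B \<delta>D x) = x" for x
    by (rule tensor_lift_eqI[OF clinear_comp[OF g(2) clinear_braid_D(2)] clinear_ident])
      (simp add: g braid_BD \<theta>_inverse)
  show "bij (braid H \<delta>B \<delta>D)"
    by (metis bijI' 1 2)
  show "inv (braid H \<delta>B \<delta>D) (z \<otimes> b) = \<theta>' b \<otimes> z"
    by (metis inv_equality 1 2 g(1))
qed

section \<open>Multiplicativity of the braidings and the two pairing laws\<close>

lemma \<delta>B_simps: "\<delta>B 1 = 1 \<otimes> 1" "\<delta>B (a * b) = \<delta>B a * \<delta>B b"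
  using \<delta>B_hom by (simp_all add: algebra_hom_def one_tensor_def)

text \<open>Crossing w with b and then with a collects \<R>(a1, w1) \<R>(b1, w2), which is \<R>(a1
  b1, w1); the coaction of B being multiplicative, this is the braiding of ab.\<close>

lemma braid_mult_left:
  "omega10_left (braid H \<delta>B \<delta>V) a (braid H \<delta>B \<delta>V (b \<otimes> v)) = braid H \<delta>B \<delta>V ((a * b) \<otimes> v)"
proof -
  note [lin] = clinear_comp[OF BV.clinear_braid]
  have l: "clinear (omega10_left (braid H \<delta>B \<delta>V) a)"
    unfolding omega10_left_def tensor_map_def by (intro lin)
  have m: "clinear (tensor_map id (\<lambda>b'. b' * c))" for c :: 'b
    by (intro clinear_tensor_map lin)
  have "cbilinear (\<lambda>v c. tensor_map id (\<lambda>b'. b' * c) (braid H \<delta>B \<delta>V (a \<otimes> v)))"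
    unfolding tensor_map_def by (intro lin)
  from tensor_lift_pure[OF this] have p: "omega10_left (braid H \<delta>B \<delta>V) a (w \<otimes> c)
      = (\<^bold>\<Sum>a0 a1\<leftarrow>\<delta>B a. \<^bold>\<Sum>w0 w1\<leftarrow>\<delta>V w. rform H a1 w1 *\<^sub>C (w0 \<otimes> (a0 * c)))" for w c
    by (simp add: omega10_left_def BV.braid_pure clinear_tensor_liftI[OF m] clinear_scale[OF m]
        tensor_map_pure clinear_id clinear_mult_left clinear_ident)
  have "omega10_left (braid H \<delta>B \<delta>V) a (braid H \<delta>B \<delta>V (b \<otimes> v))
      = (\<^bold>\<Sum>b0 b1\<leftarrow>\<delta>B b. \<^bold>\<Sum>v0 v1\<leftarrow>\<delta>V v. \<^bold>\<Sum>a0 a1\<leftarrow>\<delta>B a. \<^bold>\<Sum>x y\<leftarrow>\<delta>V v0.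
          (rform H a1 y * rform H b1 v1) *\<^sub>C (x \<otimes> (a0 * b0)))"
    by (simp add: BV.braid_pure clinear_tensor_liftI[OF l] clinear_scale[OF l] p
        tensor_lift_scale[symmetric] mult.commute)
  also have "\<dots> = (\<^bold>\<Sum>b0 b1\<leftarrow>\<delta>B b. \<^bold>\<Sum>a0 a1\<leftarrow>\<delta>B a. \<^bold>\<Sum>v0 v1\<leftarrow>\<delta>V v. \<^bold>\<Sum>x y\<leftarrow>\<delta>V v0.
          (rform H a1 y * rform H b1 v1) *\<^sub>C (x \<otimes> (a0 * b0)))"
    by (intro tensor_lift_cong tensor_lift_swap)
  also have "\<dots> = (\<^bold>\<Sum>a0 a1\<leftarrow>\<delta>B a. \<^bold>\<Sum>b0 b1\<leftarrow>\<delta>B b. \<^bold>\<Sum>v0 v1\<leftarrow>\<delta>V v. \<^bold>\<Sum>x y\<leftarrow>\<delta>V v0.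
          (rform H a1 y * rform H b1 v1) *\<^sub>C (x \<otimes> (a0 * b0)))"
    by (rule tensor_lift_swap)
  also have "\<dots> = (\<^bold>\<Sum>a0 a1\<leftarrow>\<delta>B a. \<^bold>\<Sum>b0 b1\<leftarrow>\<delta>B b. \<^bold>\<Sum>v0 v1\<leftarrow>\<delta>V v. \<^bold>\<Sum>x y\<leftarrow>comult H v1.
          (rform H a1 x * rform H b1 y) *\<^sub>C (v0 \<otimes> (a0 * b0)))"
    by (rule tensor_lift_cong, rule tensor_lift_cong, rule V.coaction_coassoc) (intro lin)
  also have "\<dots> = (\<^bold>\<Sum>a0 a1\<leftarrow>\<delta>B a. \<^bold>\<Sum>b0 b1\<leftarrow>\<delta>B b. \<^bold>\<Sum>v0 v1\<leftarrow>\<delta>V v.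
          rform H (a1 * b1) v1 *\<^sub>C (v0 \<otimes> (a0 * b0)))"
    by (simp add: tensor_lift_scale_left rform_mult_left)
  also have "\<dots> = braid H \<delta>B \<delta>V ((a * b) \<otimes> v)"
    by (simp only: BV.braid_pure \<delta>B_simps, rule tensor_lift_mult[symmetric]) (intro lin)
  finally show ?thesis .
qed

text \<open>The reversed order in \<open>rform_mult_right\<close> is the one produced by crossing a
  first: the second coaction on v yields the earlier part of v1 and meets b.\<close>

lemma braid_mult_right:
  "omega01_right (braid H \<delta>V \<delta>B) (braid H \<delta>V \<delta>B (v \<otimes> a)) b = braid H \<delta>V \<delta>B (v \<otimes> (a * b))"
proof -
  note [lin] = clinear_comp[OF VB.clinear_braid]
  have l: "clinear (\<lambda>x. omega01_right (braid H \<delta>V \<delta>B) x b)"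
    unfolding omega01_right_def tensor_map_def by (intro lin)
  have m: "clinear (tensor_map (\<lambda>b'. c * b') id)" for c :: 'b
    by (intro clinear_tensor_map lin)
  have "cbilinear (\<lambda>c v. tensor_map (\<lambda>b'. c * b') id (braid H \<delta>V \<delta>B (v \<otimes> b)))"
    unfolding tensor_map_def by (intro lin)
  from tensor_lift_pure[OF this] have p: "omega01_right (braid H \<delta>V \<delta>B) (c \<otimes> w) b
      = (\<^bold>\<Sum>w0 w1\<leftarrow>\<delta>V w. \<^bold>\<Sum>b0 b1\<leftarrow>\<delta>B b. rform H w1 b1 *\<^sub>C ((c * b0) \<otimes> w0))" for w c
    by (simp add: omega01_right_def VB.braid_pure clinear_tensor_liftI[OF m] clinear_scale[OF m]
        tensor_map_pure clinear_id clinear_mult_right clinear_ident)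
  have bil: "cbilinear (\<lambda>w0 w1. rform H v1 w1 *\<^sub>C ((w0::'b) \<otimes> v0))" for v1 and v0 :: 'v
    by (intro lin)
  have "omega01_right (braid H \<delta>V \<delta>B) (braid H \<delta>V \<delta>B (v \<otimes> a)) b
      = (\<^bold>\<Sum>v0 v1\<leftarrow>\<delta>V v. \<^bold>\<Sum>a0 a1\<leftarrow>\<delta>B a. \<^bold>\<Sum>x y\<leftarrow>\<delta>V v0. \<^bold>\<Sum>b0 b1\<leftarrow>\<delta>B b.
          (rform H y b1 * rform H v1 a1) *\<^sub>C ((a0 * b0) \<otimes> x))"
    by (simp add: VB.braid_pure clinear_tensor_liftI[OF l] clinear_scale[OF l] p
        tensor_lift_scale[symmetric] mult.commute)
  also have "\<dots> = (\<^bold>\<Sum>v0 v1\<leftarrow>\<delta>V v. \<^bold>\<Sum>x y\<leftarrow>\<delta>V v0. \<^bold>\<Sum>a0 a1\<leftarrow>\<delta>B a. \<^bold>\<Sum>b0 b1\<leftarrow>\<delta>B b.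
          (rform H y b1 * rform H v1 a1) *\<^sub>C ((a0 * b0) \<otimes> x))"
    by (intro tensor_lift_cong tensor_lift_swap)
  also have "\<dots> = (\<^bold>\<Sum>v0 v1\<leftarrow>\<delta>V v. \<^bold>\<Sum>x y\<leftarrow>comult H v1. \<^bold>\<Sum>a0 a1\<leftarrow>\<delta>B a. \<^bold>\<Sum>b0 b1\<leftarrow>\<delta>B b.
          (rform H x b1 * rform H y a1) *\<^sub>C ((a0 * b0) \<otimes> v0))"
    by (rule V.coaction_coassoc) (intro lin)
  also have "\<dots> = (\<^bold>\<Sum>v0 v1\<leftarrow>\<delta>V v. \<^bold>\<Sum>a0 a1\<leftarrow>\<delta>B a. \<^bold>\<Sum>x y\<leftarrow>comult H v1. \<^bold>\<Sum>b0 b1\<leftarrow>\<delta>B b.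
          (rform H x b1 * rform H y a1) *\<^sub>C ((a0 * b0) \<otimes> v0))"
    by (intro tensor_lift_cong tensor_lift_swap)
  also have "\<dots> = (\<^bold>\<Sum>v0 v1\<leftarrow>\<delta>V v. \<^bold>\<Sum>a0 a1\<leftarrow>\<delta>B a. \<^bold>\<Sum>b0 b1\<leftarrow>\<delta>B b. \<^bold>\<Sum>x y\<leftarrow>comult H v1.
          (rform H x b1 * rform H y a1) *\<^sub>C ((a0 * b0) \<otimes> v0))"
    by (intro tensor_lift_cong tensor_lift_swap)
  also have "\<dots> = (\<^bold>\<Sum>v0 v1\<leftarrow>\<delta>V v. \<^bold>\<Sum>a0 a1\<leftarrow>\<delta>B a. \<^bold>\<Sum>b0 b1\<leftarrow>\<delta>B b.
          rform H v1 (a1 * b1) *\<^sub>C ((a0 * b0) \<otimes> v0))"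
    by (simp add: tensor_lift_scale_left rform_mult_right)
  also have "\<dots> = braid H \<delta>V \<delta>B (v \<otimes> (a * b))"
    by (simp add: VB.braid_pure \<delta>B_simps tensor_lift_mult[OF bil])
  finally show ?thesis .
qed

text \<open>The spectator \<open>d\<close> allows the scalar identity to be applied under the sum
  over the coaction of B.\<close>

lemma pairing_identity_left_tensor:
  "(\<^bold>\<Sum>v0 v1\<leftarrow>\<delta>V v. rform H v1 h *\<^sub>C (d \<otimes> \<eta> (v0 \<otimes> w)))
    = (\<^bold>\<Sum>w0 w1\<leftarrow>\<delta>V w. \<^bold>\<Sum>a b\<leftarrow>comult H h. (\<rho> a * Rb w1 b) *\<^sub>C (d \<otimes> \<eta> (v \<otimes> w0)))"
  using arg_cong[OF pairing_identity_left, of "(\<otimes>) d"]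
  by (simp add: clinear_tensor_liftI[OF clinear_pure_right[OF clinear_ident]]
      pure_tensor_scale_right[symmetric] cscale_complex_def)

lemma pairing_identity_right_tensor:
  "(\<^bold>\<Sum>v0 v1\<leftarrow>\<delta>V v. Rb h v1 *\<^sub>C (d \<otimes> \<eta> (v0 \<otimes> w)))
    = (\<^bold>\<Sum>a b\<leftarrow>comult H h. \<^bold>\<Sum>w0 w1\<leftarrow>\<delta>V w. (\<rho>' a * rform H b w1) *\<^sub>C (d \<otimes> \<eta> (v \<otimes> w0)))"
  using arg_cong[OF pairing_identity_right, of "(\<otimes>) d"]
  by (simp add: clinear_tensor_liftI[OF clinear_pure_right[OF clinear_ident]]
      pure_tensor_scale_right[symmetric] cscale_complex_def)

lemmas linear_simps =
  clinear_add[OF clinear_\<eta>] clinear_scale[OF clinear_\<eta>]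
  clinear_add[OF clinear_braid_D(1)] clinear_scale[OF clinear_braid_D(1)]
  clinear_add[OF clinear_inv[OF clinear_braid_D(2) bij_braid_BD]]
  clinear_scale[OF clinear_inv[OF clinear_braid_D(2) bij_braid_BD]]
  clinear_add[OF BV.clinear_braid] clinear_scale[OF BV.clinear_braid]
  clinear_add[OF VB.clinear_braid] clinear_scale[OF VB.clinear_braid]

text \<open>The pairing law is \<open>pairing_identity_right\<close> with h the coaction component
  of d. Coassociativity attaches \<open>\<rho>'\<close> to d0, where it becomes
  \<open>\<theta>'\<close>: exactly the twist that d0 acquires in \<open>phi\<close> when it acts
  from the right.\<close>

sublocale holomorphic: holomorphic_pairing "inv (braid H \<delta>B \<delta>D)" \<theta>' \<eta> "braid H \<delta>B \<delta>V"
proof (unfold_locales)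
  \<comment> \<open>Interpreted ahead of the full locale, so that the formula for \<open>phi\<close>
    is available while the pairing law is being proved.\<close>
  interpret twisted_pairing "inv (braid H \<delta>B \<delta>D)" \<theta>' \<eta>
    by unfold_locales
      (simp_all add: linear_simps \<theta>_hom inv_braid_BD)
  note phi_simps = clinear_tensor_liftI[OF clinear_phi] clinear_scale[OF clinear_phi]
    clinear_tensor_liftI[OF clinear_comp[OF clinear_phi clinear_pure_left[OF clinear_ident]]]
    clinear_tensor_liftI[OF clinear_comp[OF clinear_phi clinear_pure_right[OF clinear_ident]]]
    pure_tensor_simps phi_pure \<sigma>_simps
  let ?phi = "phi (inv (braid H \<delta>B \<delta>D)) \<eta>"
  fix v d w
  have "?phi (inv (braid H \<delta>B \<delta>V) (v \<otimes> d) \<otimes> (w \<otimes> 1))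
      = (\<^bold>\<Sum>d0 d1\<leftarrow>\<delta>B d. \<^bold>\<Sum>v0 v1\<leftarrow>\<delta>V v. Rb d1 v1 *\<^sub>C (d0 \<otimes> \<eta> (v0 \<otimes> w)))"
    by (simp add: BV.inv_braid BV.braid_inverse_pure phi_simps)
  also have "\<dots> = (\<^bold>\<Sum>d0 d1\<leftarrow>\<delta>B d. \<^bold>\<Sum>a b\<leftarrow>comult H d1. \<^bold>\<Sum>w0 w1\<leftarrow>\<delta>V w.
        (\<rho>' a * rform H b w1) *\<^sub>C (d0 \<otimes> \<eta> (v \<otimes> w0)))"
    by (simp only: pairing_identity_right_tensor)
  also have "\<dots> = (\<^bold>\<Sum>d0 d1\<leftarrow>\<delta>B d. \<^bold>\<Sum>a b\<leftarrow>\<delta>B d0. \<^bold>\<Sum>w0 w1\<leftarrow>\<delta>V w.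
        (\<rho>' b * rform H d1 w1) *\<^sub>C (a \<otimes> \<eta> (v \<otimes> w0)))"
    by (rule B.coaction_coassoc[symmetric]) (intro lin)
  also have "\<dots> = (\<^bold>\<Sum>d0 d1\<leftarrow>\<delta>B d. \<^bold>\<Sum>w0 w1\<leftarrow>\<delta>V w. \<^bold>\<Sum>a b\<leftarrow>\<delta>B d0.
        (\<rho>' b * rform H d1 w1) *\<^sub>C (a \<otimes> \<eta> (v \<otimes> w0)))"
    by (intro tensor_lift_cong tensor_lift_swap)
  also have "\<dots> = (\<^bold>\<Sum>d0 d1\<leftarrow>\<delta>B d. \<^bold>\<Sum>w0 w1\<leftarrow>\<delta>V w. rform H d1 w1 *\<^sub>C (\<theta>' d0 \<otimes> \<eta> (v \<otimes> w0)))"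
    by (simp add: twist_def clinear_tensor_liftI[OF clinear_pure_left[OF clinear_ident]]
        pure_tensor_scale_left tensor_lift_scale[symmetric] mult_ac)
  also have "\<dots> = ?phi ((1 \<otimes> v) \<otimes> braid H \<delta>B \<delta>V (d \<otimes> w))"
    by (simp add: BV.braid_pure phi_simps)
  finally show "?phi (inv (braid H \<delta>B \<delta>V) (v \<otimes> d) \<otimes> (w \<otimes> 1))
      = ?phi ((1 \<otimes> v) \<otimes> braid H \<delta>B \<delta>V (d \<otimes> w))" .
qed (simp_all add: linear_simps \<theta>_hom inv_braid_BD BV.bij_braid braid_mult_left)

text \<open>Here \<open>pairing_identity_left\<close> is used, and the \<open>\<rho>\<close> it
  produces turns into \<open>\<theta>\<close> on d0, the twist belonging to the direct braiding in
  L-.\<close>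

sublocale antiholomorphic: antiholomorphic_pairing "braid H \<delta>D \<delta>B" \<theta> \<eta> "braid H \<delta>V \<delta>B"
proof (unfold_locales)
  interpret twisted_pairing "braid H \<delta>D \<delta>B" \<theta> \<eta>
    by unfold_locales (simp_all add: linear_simps \<theta>_hom braid_DB)
  note phi_simps = clinear_tensor_liftI[OF clinear_phi] clinear_scale[OF clinear_phi]
    clinear_tensor_liftI[OF clinear_comp[OF clinear_phi clinear_pure_left[OF clinear_ident]]]
    clinear_tensor_liftI[OF clinear_comp[OF clinear_phi clinear_pure_right[OF clinear_ident]]]
    pure_tensor_simps phi_pure \<sigma>_simps
  let ?phi = "phi (braid H \<delta>D \<delta>B) \<eta>"
  fix v d w
  have "?phi (braid H \<delta>V \<delta>B (v \<otimes> d) \<otimes> (w \<otimes> 1))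
      = (\<^bold>\<Sum>v0 v1\<leftarrow>\<delta>V v. \<^bold>\<Sum>d0 d1\<leftarrow>\<delta>B d. rform H v1 d1 *\<^sub>C (d0 \<otimes> \<eta> (v0 \<otimes> w)))"
    by (simp add: VB.braid_pure phi_simps)
  also have "\<dots> = (\<^bold>\<Sum>d0 d1\<leftarrow>\<delta>B d. \<^bold>\<Sum>v0 v1\<leftarrow>\<delta>V v. rform H v1 d1 *\<^sub>C (d0 \<otimes> \<eta> (v0 \<otimes> w)))"
    by (rule tensor_lift_swap)
  also have "\<dots> = (\<^bold>\<Sum>d0 d1\<leftarrow>\<delta>B d. \<^bold>\<Sum>w0 w1\<leftarrow>\<delta>V w. \<^bold>\<Sum>a b\<leftarrow>comult H d1.
        (\<rho> a * Rb w1 b) *\<^sub>C (d0 \<otimes> \<eta> (v \<otimes> w0)))"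
    by (simp only: pairing_identity_left_tensor)
  also have "\<dots> = (\<^bold>\<Sum>w0 w1\<leftarrow>\<delta>V w. \<^bold>\<Sum>d0 d1\<leftarrow>\<delta>B d. \<^bold>\<Sum>a b\<leftarrow>comult H d1.
        (\<rho> a * Rb w1 b) *\<^sub>C (d0 \<otimes> \<eta> (v \<otimes> w0)))"
    by (rule tensor_lift_swap)
  also have "\<dots> = (\<^bold>\<Sum>w0 w1\<leftarrow>\<delta>V w. \<^bold>\<Sum>d0 d1\<leftarrow>\<delta>B d. \<^bold>\<Sum>a b\<leftarrow>\<delta>B d0.
        (\<rho> b * Rb w1 d1) *\<^sub>C (a \<otimes> \<eta> (v \<otimes> w0)))"
    by (rule tensor_lift_cong, rule B.coaction_coassoc[symmetric]) (intro lin)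
  also have "\<dots> = (\<^bold>\<Sum>w0 w1\<leftarrow>\<delta>V w. \<^bold>\<Sum>d0 d1\<leftarrow>\<delta>B d. Rb w1 d1 *\<^sub>C (\<theta> d0 \<otimes> \<eta> (v \<otimes> w0)))"
    by (simp add: twist_def clinear_tensor_liftI[OF clinear_pure_left[OF clinear_ident]]
        pure_tensor_scale_left tensor_lift_scale[symmetric] mult_ac)
  also have "\<dots> = ?phi ((1 \<otimes> v) \<otimes> inv (braid H \<delta>V \<delta>B) (d \<otimes> w))"
    by (simp add: VB.inv_braid VB.braid_inverse_pure phi_simps)
  finally show "?phi (braid H \<delta>V \<delta>B (v \<otimes> d) \<otimes> (w \<otimes> 1))
      = ?phi ((1 \<otimes> v) \<otimes> inv (braid H \<delta>V \<delta>B) (d \<otimes> w))" .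
qed (simp_all add: linear_simps \<theta>_hom braid_DB VB.bij_braid braid_mult_right)

end

section \<open>The coaction on the braided symmetric algebra\<close>

lemma clinear_eq_on_span:
  assumes f: "clinear f" and g: "clinear g" and eq: "\<And>x. x \<in> S \<Longrightarrow> f x = g x" and "x \<in> cvec.span S"
  shows "f x = g x"
  using assms(4)
  by (induction rule: cvec.span_induct_alt)
    (simp_all add: clinear_zero[OF f] clinear_add[OF f] clinear_scale[OF f]
      clinear_zero[OF g] clinear_add[OF g] clinear_scale[OF g] eq)

lemma tensor_alg_eqI:
  assumes f: "clinear f" and g: "clinear g" and eq: "\<And>xs. f (word xs) = g (word xs)"
  shows "f x = g x"
  by (induction x rule: tensor_alg_induct)
    (simp_all add: clinear_add[OF f] clinear_scale[OF f] clinear_add[OF g] clinear_scale[OF g] eq)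

lemma algebra_hom_word:
  assumes "algebra_hom f"
  shows "f (word xs) = prod_list (map (\<lambda>v. f (word [v])) xs)"
proof (induction xs)
  case Nil
  then show ?case
    using algebra_homD(2)[OF assms] by (simp add: one_tensor_alg_def)
next
  case (Cons v xs)
  then show ?case
    using algebra_homD(3)[OF assms, of "word [v]" "word xs"] by (simp add: word_mult_word)
qed

lemma tensor_alg_hom_eqI:
  assumes "algebra_hom f" "algebra_hom g" "\<And>v. f (word [v]) = g (word [v])"
  shows "f x = g x"
  by (rule tensor_alg_eqI[OF algebra_homD(1)[OF assms(1)] algebra_homD(1)[OF assms(2)]])
    (subst algebra_hom_word[OF assms(1)], subst algebra_hom_word[OF assms(2)], simp add: assms(3))

lemma clinear_word [lin]: "clinear (\<lambda>v. word (xs @ v # ys))"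
  using multilinear_word unfolding multilinear_def by blast

lemma clinear_word_simps [lin]:
  "clinear (\<lambda>v. word [v])" "clinear (\<lambda>v. word (v # ys))" "clinear (\<lambda>v. word [w, v])"
  using clinear_word[of "[]" "[]"] clinear_word[of "[]"] clinear_word[of "[w]" "[]"] by simp_all

lemma multilinear_prod_list:
  assumes "clinear (f :: 'v::complex_vec \<Rightarrow> 'a::complex_alg)"
  shows "multilinear (\<lambda>xs. prod_list (map f xs))"
  unfolding multilinear_def by (simp, intro allI lin clinear_comp[OF assms])

locale tensor_algebra_comodule = comodule H \<delta>
  for H :: "('h::complex_alg) cqt_hopf" and \<delta> :: "'v::complex_vec \<Rightarrow> 'v \<otimes> 'h"
begin

abbreviation "\<delta>T \<equiv> tensor_alg_coaction \<delta>"

abbreviation "letter \<equiv> (\<lambda>v. tensor_map (\<lambda>u. word [u]) id (\<delta> v))"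

lemma multilinear_coaction: "multilinear (\<lambda>xs. prod_list (map letter xs))"
  by (intro multilinear_prod_list lin)

lemma coaction_word: "\<delta>T (word xs) = prod_list (map letter xs)"
  unfolding tensor_alg_coaction_def by (rule word_lift_word[OF multilinear_coaction])

lemma clinear_tensor_alg_coaction: "clinear \<delta>T"
  unfolding tensor_alg_coaction_def by (rule clinear_word_lift[OF multilinear_coaction])

lemmas [lin] = clinear_comp[OF clinear_tensor_alg_coaction]

lemma tensor_alg_coaction_hom: "algebra_hom \<delta>T"
proof -
  have 1: "\<delta>T (word xs * y) = \<delta>T (word xs) * \<delta>T y" for xs y
    by (rule tensor_alg_eqI[where f = "\<lambda>y. \<delta>T (word xs * y)"])
      ((intro lin)[1], (intro lin)[1], simp add: word_mult_word coaction_word)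
  have "\<delta>T (x * y) = \<delta>T x * \<delta>T y" for x y
    by (rule tensor_alg_eqI[where f = "\<lambda>x. \<delta>T (x * y)"])
      ((intro lin)[1], (intro lin)[1], rule 1)
  then show ?thesis
    using coaction_word[of "[]"]
    by (simp add: algebra_hom_def clinear_tensor_alg_coaction one_tensor_alg_def)
qed

end

text \<open>\<open>V\<^sup>\<otimes>\<^sup>n \<otimes> H\<close> inside \<open>TV \<otimes> H\<close>.\<close>

definition tensor_degree_with ::
  "nat \<Rightarrow> ('v::complex_vec tensor_alg \<otimes> 'h::complex_vec) set"
  where "tensor_degree_with n = cvec.span {word xs \<otimes> h | xs h. length xs = n}"

lemma tensor_degree_with_mult:
  fixes X Y :: "'v::complex_vec tensor_alg \<otimes> 'h::complex_alg"
  assumes X: "X \<in> tensor_degree_with m" and Y: "Y \<in> tensor_degree_with n"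
  shows "X * Y \<in> tensor_degree_with (m + n)"
proof -
  have 1: "(word xs \<otimes> h) * Y \<in> tensor_degree_with (m + n)" if "length xs = m" for xs :: "'v list" and h :: 'h
    using Y unfolding tensor_degree_with_def
  proof (induction rule: cvec.span_induct_alt)
    case (step c x y)
    then obtain ys k where x: "x = word ys \<otimes> k" "length ys = n"
      by auto
    have "word (xs @ ys) \<otimes> (h * k) \<in> {word xs \<otimes> h | xs h. length xs = m + n}"
      using that x by force
    with step show ?case
      by (simp add: distrib_left cscale_mult_right x tensor_mult_pure word_mult_word
          cvec.span_add cvec.span_scale cvec.span_base)
  qed (simp add: cvec.span_zero)
  show ?thesis
    using X unfolding tensor_degree_with_def[of m]
  proof (induction rule: cvec.span_induct_alt)
    case (step c x y)
    with 1 show ?case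
      by (auto simp: distrib_right cscale_mult_left tensor_degree_with_def
          intro: cvec.span_add cvec.span_scale)
  qed (simp add: cvec.span_zero tensor_degree_with_def)
qed

text \<open>Serves two purposes: \<open>braid_at\<close> can be moved past a prefix only if the
  length of the prefix is known, and the kernels defining B are taken degree by degree.\<close>

lemma (in tensor_algebra_comodule) coaction_degree:
  "\<delta>T (word xs) \<in> tensor_degree_with (length xs)"
proof (induction xs)
  case Nil
  show ?case
    unfolding coaction_word tensor_degree_with_def
    by (rule cvec.span_base) (auto simp: one_tensor_def one_tensor_alg_def)
next
  case (Cons v xs)
  have "tensor_map (\<lambda>u. word [u]) id z \<in> tensor_degree_with 1" for z :: "'v \<otimes> 'h"
  proof (induction z rule: tensor_induct)
    case (pure a b)
    show ?case
      unfolding tensor_degree_with_def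
      by (rule cvec.span_base, unfold tensor_map_pure[OF clinear_word_simps(1) clinear_id])
        (rule CollectI, rule exI[of _ "[a]"], rule exI[of _ "id b"], simp)
  next
    case (add x y)
    then show ?case
      unfolding tensor_degree_with_def clinear_add[OF clinear_tensor_map[OF clinear_word_simps(1) clinear_id]]
      by (rule cvec.span_add)
  qed
  from tensor_degree_with_mult[OF this[of "\<delta> v"] Cons] show ?case
    by (simp add: coaction_word)
qed

section \<open>Braiding operators on the tensor algebra\<close>

abbreviation "word2 \<equiv> tensor_lift (\<lambda>v w. word [v, w])"

lemma cbilinear_word2: "cbilinear (\<lambda>v w. word [v, w])"
  by (intro lin)

lemmas word2_pure = tensor_lift_pure[OF cbilinear_word2]

locale tensor_square_map =
  fixes \<Psi> :: "'v::complex_vec \<otimes> 'v \<Rightarrow> 'v \<otimes> 'v"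
  assumes clinear_\<Psi>: "clinear \<Psi>"
begin

lemmas [lin] = clinear_comp[OF clinear_\<Psi>] clinear_comp[OF clinear_tensor_lift[OF cbilinear_word2]]

lemma multilinear_braid_at:
  "multilinear (\<lambda>xs. if Suc i < length xs
     then word (take i xs) * word2 (\<Psi> (xs ! i \<otimes> xs ! Suc i)) * word (drop (Suc (Suc i)) xs)
     else word xs)"
  unfolding multilinear_def
proof (intro allI)
  fix xs ys :: "'v list"
  let ?f = "\<lambda>zs. if Suc i < length zs
     then word (take i zs) * word2 (\<Psi> (zs ! i \<otimes> zs ! Suc i)) * word (drop (Suc (Suc i)) zs)
     else word zs"
  \<comment> \<open>The cases locate the letter v relative to the braided positions i and i + 1. In
    \<open>short\<close> the whole word has at most i + 1 letters and nothing is braided; in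
    \<open>before\<close> v precedes the pair, which is found at k and k + 1 in ys; in
    \<open>first\<close> and \<open>second\<close> v belongs to the pair; in \<open>after\<close> it
    follows.\<close>
  consider (short) "length xs + length ys \<le> i"
    | (before) k where "i = length xs + Suc k" "Suc k < length ys"
    | (first) w zs where "i = length xs" "ys = w # zs"
    | (second) u zs where "xs = zs @ [u]" "i = length zs"
    | (after) "Suc i < length xs"
  proof -
    have "\<exists>k. i = length xs + Suc k \<and> Suc k < length ys"
      if "length xs < i" "\<not> length xs + length ys \<le> i"
      using that by (intro exI[of _ "i - Suc (length xs)"]) auto
    moreover have "\<exists>w zs. ys = w # zs" if "length xs = i" "\<not> length xs + length ys \<le> i"
      using that by (cases ys) auto
    moreover have "\<exists>u zs. xs = zs @ [u] \<and> i = length zs" if "length xs = Suc i"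
      using that by (cases xs rule: rev_cases) auto
    ultimately show ?thesis
      using that by (metis Suc_lessI linorder_neqE_nat)
  qed
  then show "clinear (\<lambda>v. ?f (xs @ v # ys))"
  proof cases
    case short
    then have "?f (xs @ v # ys) = word (xs @ v # ys)" for v
      by simp
    then show ?thesis
      by (simp only:) (intro lin)
  next
    case before
    then have "?f (xs @ v # ys)
        = word (xs @ v # take k ys) * word2 (\<Psi> (ys ! k \<otimes> ys ! Suc k)) * word (drop (Suc (Suc k)) ys)" for v
    proof -
      have "take i (xs @ v # ys) = xs @ v # take k ys" "(xs @ v # ys) ! i = ys ! k"
        "(xs @ v # ys) ! Suc i = ys ! Suc k" "drop (Suc (Suc i)) (xs @ v # ys) = drop (Suc (Suc k)) ys"
        "Suc i < length (xs @ v # ys)"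
        using before by (simp_all add: nth_append numeral_3_eq_3)
      then show ?thesis
        by (simp only: if_True)
    qed
    then show ?thesis
      by (simp only:) (intro lin)
  next
    case first
    then have "?f (xs @ v # ys) = word xs * word2 (\<Psi> (v \<otimes> w)) * word zs" for v
    proof -
      have "take i (xs @ v # ys) = xs" "(xs @ v # ys) ! i = v"
        "(xs @ v # ys) ! Suc i = w" "drop (Suc (Suc i)) (xs @ v # ys) = zs"
        "Suc i < length (xs @ v # ys)"
        using first by (simp_all add: nth_append)
      then show ?thesis
        by (simp only: if_True)
    qed
    then show ?thesis
      by (simp only:) (intro lin)
  next
    case second
    then have "?f (xs @ v # ys) = word zs * word2 (\<Psi> (u \<otimes> v)) * word ys" for v
    proof -
      have "take i (xs @ v # ys) = zs" "(xs @ v # ys) ! i = u"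
        "(xs @ v # ys) ! Suc i = v" "drop (Suc (Suc i)) (xs @ v # ys) = ys"
        "Suc i < length (xs @ v # ys)"
        using second by (simp_all add: nth_append)
      then show ?thesis
        by (simp only: if_True)
    qed
    then show ?thesis
      by (simp only:) (intro lin)
  next
    case after
    then have "?f (xs @ v # ys)
        = word (take i xs) * word2 (\<Psi> (xs ! i \<otimes> xs ! Suc i)) * word (drop (Suc (Suc i)) xs @ v # ys)" for v
    proof -
      have "take i (xs @ v # ys) = take i xs" "(xs @ v # ys) ! i = xs ! i"
        "(xs @ v # ys) ! Suc i = xs ! Suc i"
        "drop (Suc (Suc i)) (xs @ v # ys) = drop (Suc (Suc i)) xs @ v # ys"
        "Suc i < length (xs @ v # ys)"
        using after by (simp_all add: nth_append)
      then show ?thesis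
        by (simp only: if_True)
    qed
    then show ?thesis
      by (simp only:) (intro lin)
  qed
qed

lemma clinear_braid_at: "clinear (braid_at \<Psi> i)"
  unfolding braid_at_def by (rule clinear_word_lift[OF multilinear_braid_at])

lemma braid_at_word:
  "braid_at \<Psi> (length as) (word (as @ v # w # cs)) = word as * word2 (\<Psi> (v \<otimes> w)) * word cs"
  unfolding braid_at_def word_lift_word[OF multilinear_braid_at] by (simp add: nth_append)

lemma braid_at_short: "length xs \<le> Suc i \<Longrightarrow> braid_at \<Psi> i (word xs) = word xs"
  unfolding braid_at_def word_lift_word[OF multilinear_braid_at] by simp

text \<open>On words the claim is \<open>braid_at_word\<close>. Both sides are linear in each
  factor, so the factors are extended one at a time from words and pure tensors, \<open>X\<close>
  only within its degree, which fixes the braided position.\<close>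

lemma braid_at_tensor:
  fixes X Z :: "'v tensor_alg \<otimes> 'h::complex_alg"
  assumes "X \<in> tensor_degree_with i"
  shows "tensor_map (braid_at \<Psi> i) id (X * tensor_map word2 id Y * Z)
    = X * tensor_map word2 id (tensor_map \<Psi> id Y) * Z"
proof -
  note [lin] = clinear_comp[OF clinear_braid_at]
  have lins: "clinear (braid_at \<Psi> i)" "clinear word2" "clinear (id :: 'h \<Rightarrow> 'h)" "clinear \<Psi>"
    by (intro lin clinear_braid_at clinear_\<Psi>)+
  let ?F = "\<lambda>X Y Z. tensor_map (braid_at \<Psi> i) id (X * tensor_map word2 id Y * Z)"
  let ?G = "\<lambda>X Y Z. X * tensor_map word2 id (tensor_map \<Psi> id Y) * (Z :: 'v tensor_alg \<otimes> 'h)"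
  have FG: "clinear (\<lambda>X. ?F X Y Z)" "clinear (\<lambda>Y. ?F X Y Z)" "clinear (\<lambda>Z. ?F X Y Z)"
     "clinear (\<lambda>X. ?G X Y Z)" "clinear (\<lambda>Y. ?G X Y Z)" "clinear (\<lambda>Z. ?G X Y Z)" for X Y Z
    by (intro lin lins)+
  have 1: "?F (word as \<otimes> h) ((v \<otimes> w) \<otimes> k) (word cs \<otimes> l) = ?G (word as \<otimes> h) ((v \<otimes> w) \<otimes> k) (word cs \<otimes> l)"
    if "length as = i" for as cs v w h k l
    using that braid_at_word[of as v w cs]
    by (simp add: tensor_map_pure lins tensor_mult_pure word2_pure word_mult_word)
  have 2: "?F (word as \<otimes> h) ((v \<otimes> w) \<otimes> k) (z \<otimes> l) = ?G (word as \<otimes> h) ((v \<otimes> w) \<otimes> k) (z \<otimes> l)"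
    if "length as = i" for as v w h k l z
    by (rule tensor_alg_eqI[OF clinear_comp[OF FG(3) clinear_pure_left[OF clinear_ident]]
          clinear_comp[OF FG(6) clinear_pure_left[OF clinear_ident]]]) (rule 1[OF that])
  have 3: "?F (word as \<otimes> h) ((v \<otimes> w) \<otimes> k) Z = ?G (word as \<otimes> h) ((v \<otimes> w) \<otimes> k) Z"
    if "length as = i" for as v w h k
    by (rule tensor_lift_eqI[OF FG(3) FG(6)]) (rule 2[OF that])
  have 4: "?F (word as \<otimes> h) (y \<otimes> k) Z = ?G (word as \<otimes> h) (y \<otimes> k) Z"
    if "length as = i" for as y h k
    by (rule tensor_lift_eqI[OF clinear_comp[OF FG(2) clinear_pure_left[OF clinear_ident]]
          clinear_comp[OF FG(5) clinear_pure_left[OF clinear_ident]]]) (rule 3[OF that])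
  have 5: "?F (word as \<otimes> h) Y Z = ?G (word as \<otimes> h) Y Z" if "length as = i" for as h
    by (rule tensor_lift_eqI[OF FG(2) FG(5)]) (rule 4[OF that])
  show ?thesis
    by (rule clinear_eq_on_span[OF FG(1) FG(4) _ assms[unfolded tensor_degree_with_def]])
      (elim CollectE exE conjE, simp only: 5)
qed

lemma clinear_foldr_braid_at: "clinear (foldr (\<lambda>i f. braid_at \<Psi> i \<circ> f) is id)"
  by (induction "is") (auto simp: clinear_id clinear_ident comp_def intro: clinear_comp[OF clinear_braid_at])

lemma clinear_braided_factorial: "clinear (braided_factorial \<Psi> n)"
  unfolding braided_factorial_def braid_perm_def by (intro lin clinear_foldr_braid_at)

end

text \<open>The kernel of \<open>f\<close> on \<open>V\<^sup>\<otimes>\<^sup>n \<otimes> H\<close> is \<open>ker f \<otimes> H\<close>: on \<open>V\<^sup>\<otimes>\<^sup>n\<close>, \<open>\<pi>\<close> factors through \<open>f\<close>.\<close>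

lemma tensor_map_kernel:
  fixes f :: "'w::complex_vec tensor_alg \<Rightarrow> 'w tensor_alg" and \<pi> :: "'w tensor_alg \<Rightarrow> 'b::complex_vec"
  assumes f: "clinear f" and \<pi>: "clinear \<pi>"
    and ker: "\<And>x. x \<in> tensor_degree n \<Longrightarrow> f x = 0 \<Longrightarrow> \<pi> x = 0"
    and y: "y \<in> tensor_degree_with n" "tensor_map f id y = 0"
  shows "tensor_map \<pi> (id :: 'h::complex_vec \<Rightarrow> 'h) y = 0"
proof -
  interpret vector_space_pair "cscale :: complex \<Rightarrow> 'w tensor_alg \<Rightarrow> 'w tensor_alg"
    "cscale :: complex \<Rightarrow> 'w tensor_alg \<Rightarrow> 'w tensor_alg"
    by unfold_locales
  have sub: "cvec.subspace (tensor_degree n :: 'w tensor_alg set)"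
    unfolding tensor_degree_def by (rule cvec.subspace_span)
  \<comment> \<open>A linear section of \<open>f\<close> over the image of the degree n part; it
    exists because subspaces have complements.\<close>
  obtain s where s: "clinear s" "\<And>x. s x \<in> tensor_degree n"
    "\<And>x. x \<in> tensor_degree n \<Longrightarrow> f (s (f x)) = f x"
    using linear_exists_right_inverse_on[OF f sub] by (auto simp: Pi_iff)
  have \<pi>_s: "\<pi> x = \<pi> (s (f x))" if "x \<in> tensor_degree n" for x
    using ker[of "x - s (f x)"] that s sub
    by (simp add: clinear_diff[OF f] clinear_diff[OF \<pi>] cvec.subspace_diff)
  have \<pi>s: "clinear (\<lambda>x. \<pi> (s x))"
    by (rule clinear_comp[OF \<pi> s(1)])
  \<comment> \<open>\<open>\<pi>\<close> factors through \<open>f\<close> in degree n because x - s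
    (f x) lies in the kernel of \<open>f\<close>; tensoring with the identity preserves this
    factorisation.\<close>
  have "tensor_map \<pi> id y = tensor_map (\<lambda>x. \<pi> (s x)) id (tensor_map f id y)"
  proof (rule clinear_eq_on_span[OF _ _ _ y(1)[unfolded tensor_degree_with_def]])
    fix z :: "'w tensor_alg \<otimes> 'h"
    assume "z \<in> {word xs \<otimes> h | xs h. length xs = n}"
    then obtain xs h where z: "z = word xs \<otimes> h" "length xs = n"
      by auto
    then have "word xs \<in> tensor_degree n"
      unfolding tensor_degree_def by (auto intro: cvec.span_base)
    from \<pi>_s[OF this] show "tensor_map \<pi> id z = tensor_map (\<lambda>x. \<pi> (s x)) id (tensor_map f id z)"
      unfolding z by (simp only: tensor_map_pure f \<pi> \<pi>s clinear_id id_apply)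
  qed (intro lin f \<pi> \<pi>s clinear_tensor_map)+
  then show ?thesis
    by (simp add: y(2) clinear_zero[OF clinear_tensor_map[OF \<pi>s clinear_id]])
qed

section \<open>Equivariance of the braided factorials\<close>

locale braided_symmetric_coaction = comodule_pair H Rb \<delta> \<delta> + tensor_algebra_comodule H \<delta>
  for H :: "('h::complex_alg) cqt_hopf" and Rb and \<delta> :: "'v::complex_vec \<Rightarrow> 'v \<otimes> 'h" +
  fixes \<pi> :: "'v tensor_alg \<Rightarrow> 'b::complex_alg"
  assumes \<pi>: "braided_symmetric_algebra (braid H \<delta> \<delta>) \<pi>"
begin

abbreviation "\<Psi> \<equiv> braid H \<delta> \<delta>"

sublocale tensor_square_map \<Psi>
  by unfold_locales (simp_all add: clinear_add[OF clinear_braid] clinear_scale[OF clinear_braid])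

text \<open>The product of two letters in TV \<otimes> H multiplies the components in H as v1 w1,
  just as the tensor product coaction does.\<close>

lemma coaction_word2: "\<delta>T (word2 z) = tensor_map word2 id (tensor_coaction \<delta> \<delta> z)"
proof (rule tensor_lift_eqI[where f = "\<lambda>z. \<delta>T (word2 z)"])
  have w2: "clinear word2"
    by (rule clinear_tensor_lift[OF cbilinear_word2])
  note m = clinear_tensor_map[OF w2 clinear_id]
  show "clinear (\<lambda>z. \<delta>T (word2 z))" "clinear (\<lambda>z. tensor_map word2 id (tensor_coaction \<delta> \<delta> z))"
    by (intro lin clinear_tensor_coaction clinear_comp[OF m] clinear_word_simps)+
  fix v w
  have "tensor_map word2 id (tensor_coaction \<delta> \<delta> (v \<otimes> w))
      = (\<^bold>\<Sum>v0 v1\<leftarrow>\<delta> v. \<^bold>\<Sum>w0 w1\<leftarrow>\<delta> w. word [v0, w0] \<otimes> (v1 * w1))"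
    by (simp add: tensor_coaction_pure clinear_tensor_liftI[OF m] tensor_map_pure[OF w2 clinear_id]
        word2_pure)
  also have "\<dots> = letter v * letter w"
    unfolding tensor_map_def
    by (simp add: tensor_lift_factor tensor_mult_pure word_mult_word) (rule tensor_lift_swap)
  finally show "\<delta>T (word2 (v \<otimes> w)) = tensor_map word2 id (tensor_coaction \<delta> \<delta> (v \<otimes> w))"
    by (simp add: word2_pure coaction_word)
qed

text \<open>Around position i the word splits into prefix, pair and suffix. The coaction is
  multiplicative, preserves the length of the prefix, and commutes with \<open>\<Psi>\<close> on the
  pair.\<close>

lemma coaction_braid_at: "\<delta>T (braid_at \<Psi> i x) = tensor_map (braid_at \<Psi> i) id (\<delta>T x)"
proof (rule tensor_alg_eqI[where f = "\<lambda>x. \<delta>T (braid_at \<Psi> i x)"])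
  note b = clinear_braid_at
  note bt = clinear_tensor_map[OF b clinear_id]
  show "clinear (\<lambda>x. \<delta>T (braid_at \<Psi> i x))" "clinear (\<lambda>x. tensor_map (braid_at \<Psi> i) id (\<delta>T x))"
    by (intro clinear_comp[OF clinear_tensor_alg_coaction] clinear_comp[OF bt] b clinear_tensor_alg_coaction)+
  fix xs :: "'v list"
  show "\<delta>T (braid_at \<Psi> i (word xs)) = tensor_map (braid_at \<Psi> i) id (\<delta>T (word xs))"
  proof (cases "Suc i < length xs")
    case True
    define as cs v w where as_def: "as = take i xs" and cs_def: "cs = drop (Suc (Suc i)) xs"
      and v_def: "v = xs ! i" and w_def: "w = xs ! Suc i"
    have as: "length as = i"
      using True by (simp add: as_def)
    have xs: "xs = as @ v # w # cs"
      using id_take_nth_drop[of i xs] Cons_nth_drop_Suc[OF True] True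
      by (simp add: as_def cs_def v_def w_def)
    note hom = algebra_homD(3)[OF tensor_alg_coaction_hom]
    have "\<delta>T (braid_at \<Psi> i (word xs)) = \<delta>T (word as) * \<delta>T (word2 (\<Psi> (v \<otimes> w))) * \<delta>T (word cs)"
      using braid_at_word[of as v w cs] by (simp add: xs as hom)
    also have "\<delta>T (word2 (\<Psi> (v \<otimes> w))) = tensor_map word2 id (tensor_map \<Psi> id (tensor_coaction \<delta> \<delta> (v \<otimes> w)))"
      using comodule_map_braid by (simp add: coaction_word2 comodule_map_def)
    also have "\<delta>T (word as) * \<dots> * \<delta>T (word cs)
        = tensor_map (braid_at \<Psi> i) id (\<delta>T (word as) * tensor_map word2 id (tensor_coaction \<delta> \<delta> (v \<otimes> w)) * \<delta>T (word cs))"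
      by (rule braid_at_tensor[symmetric]) (use coaction_degree[of as] as in simp)
    also have "\<delta>T (word as) * tensor_map word2 id (tensor_coaction \<delta> \<delta> (v \<otimes> w)) * \<delta>T (word cs) = \<delta>T (word xs)"
      by (simp add: xs coaction_word2[symmetric] word2_pure hom[symmetric] word_mult_word)
    finally show ?thesis .
  next
    case False
    \<comment> \<open>For words too short to be braided \<open>braid_at\<close> is the identity by
      default; by degree this also holds on their coactions.\<close>
    have "tensor_map (braid_at \<Psi> i) id y = y" if "y \<in> tensor_degree_with (length xs)" for y :: "'v tensor_alg \<otimes> 'h"
    proof (rule clinear_eq_on_span[OF bt clinear_ident _ that[unfolded tensor_degree_with_def]])
      fix z :: "'v tensor_alg \<otimes> 'h"
      assume "z \<in> {word ys \<otimes> h | ys h. length ys = length xs}"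
      then show "tensor_map (braid_at \<Psi> i) id z = z"
        using False by (auto simp: tensor_map_pure[OF b clinear_id] braid_at_short)
    qed
    with coaction_degree[of xs] False show ?thesis
      by (simp add: braid_at_short)
  qed
qed

text \<open>Any composite of the operators \<open>braid_at\<close> commutes with the coaction, in
  particular the one for whichever reduced expression \<open>braid_perm\<close> selects.\<close>

lemma coaction_braided_factorial:
  "\<delta>T (braided_factorial \<Psi> n x) = tensor_map (braided_factorial \<Psi> n) id (\<delta>T x)"
proof -
  have fold: "\<delta>T (foldr (\<lambda>i f. braid_at \<Psi> i \<circ> f) is id x)
      = tensor_map (foldr (\<lambda>i f. braid_at \<Psi> i \<circ> f) is id) id (\<delta>T x)" for "is"
  proof (induction "is")
    case (Cons i "is")
    then show ?case
      by (simp add: coaction_braid_at comp_def tensor_map_map[OF clinear_braid_at clinear_id])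
  qed (simp add: tensor_map_id[unfolded id_def] id_def)
  have sum: "tensor_map (\<lambda>x. \<Sum>\<sigma>\<in>S. f \<sigma> x) id y = (\<Sum>\<sigma>\<in>S. tensor_map (f \<sigma>) id y)"
    for S :: "(nat \<Rightarrow> nat) set" and f :: "(nat \<Rightarrow> nat) \<Rightarrow> 'v tensor_alg \<Rightarrow> 'v tensor_alg" and y :: "'v tensor_alg \<otimes> 'h"
    unfolding tensor_map_def tensor_lift_sum
    by (simp add: clinear_sum_apply[OF clinear_pure_left[OF clinear_ident]] cvec.scale_sum_right)
      (rule sum.swap)
  show ?thesis
    by (simp add: braided_factorial_def[abs_def] sum clinear_sum_apply[OF clinear_tensor_alg_coaction])
      (simp add: braid_perm_def fold)
qed

lemma \<pi>_hom: "algebra_hom \<pi>" and clinear_\<pi>: "clinear \<pi>" and surj_\<pi>: "surj \<pi>"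
  and kernel_\<pi>: "\<pi> x = 0 \<longleftrightarrow> x \<in> symmetric_relations \<Psi>"
  using \<pi> by (auto simp: braided_symmetric_algebra_def quotient_projection_def)

lemma clinear_coaction_\<pi>: "clinear (\<lambda>x. tensor_map \<pi> id (\<delta>T x))"
  by (intro lin clinear_\<pi> clinear_tensor_alg_coaction)

lemma kernel_subcomodule:
  assumes "\<pi> x = 0"
  shows "tensor_map \<pi> id (\<delta>T x) = 0"
proof (rule span_vanish[OF clinear_coaction_\<pi> _ assms[unfolded kernel_\<pi> symmetric_relations_def]])
  fix z
  assume "z \<in> (\<Union>n. {x \<in> tensor_degree n. braided_factorial \<Psi> n x = 0})"
  then obtain n where n: "z \<in> tensor_degree n" "braided_factorial \<Psi> n z = 0"
    by auto
  show "tensor_map \<pi> id (\<delta>T z) = 0"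
  proof (rule tensor_map_kernel[OF clinear_braided_factorial clinear_\<pi>])
    fix x
    assume "x \<in> tensor_degree n" "braided_factorial \<Psi> n x = 0"
    then show "\<pi> x = 0"
      unfolding kernel_\<pi> symmetric_relations_def by (auto intro: cvec.span_base)
  next
    show "\<delta>T z \<in> tensor_degree_with n"
      using n(1) unfolding tensor_degree_def
    proof (induction rule: cvec.span_induct_alt)
      case (step c x y)
      then show ?case
        using coaction_degree unfolding tensor_degree_with_def
        by (auto simp: clinear_add[OF clinear_tensor_alg_coaction] clinear_scale[OF clinear_tensor_alg_coaction]
            intro: cvec.span_add cvec.span_scale)
    qed (simp add: clinear_zero[OF clinear_tensor_alg_coaction] tensor_degree_with_def cvec.span_zero)
    show "tensor_map (braided_factorial \<Psi> n) id (\<delta>T z) = 0"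
      by (simp add: coaction_braided_factorial[symmetric] n(2) clinear_zero[OF clinear_tensor_alg_coaction])
  qed
qed

section \<open>The induced comodule algebra structure on B\<close>

abbreviation "\<delta>B \<equiv> quotient_coaction \<pi> \<delta>"

lemma quotient_coaction_\<pi>: "\<delta>B (\<pi> x) = tensor_map \<pi> id (\<delta>T x)"
  unfolding quotient_coaction_def
  by (rule descend_apply[OF clinear_\<pi> clinear_coaction_\<pi> kernel_subcomodule])

lemma clinear_quotient_coaction: "clinear \<delta>B"
  unfolding quotient_coaction_def
  by (rule clinear_descend[OF clinear_\<pi> surj_\<pi> clinear_coaction_\<pi> kernel_subcomodule])

lemma quotient_coaction_hom: "algebra_hom \<delta>B"
proof -
  note hom = algebra_hom_comp[OF algebra_hom_tensor_map[OF \<pi>_hom algebra_hom_id] tensor_alg_coaction_hom]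
  have "\<delta>B (a * b) = \<delta>B a * \<delta>B b" for a b
  proof -
    obtain x y where "a = \<pi> x" "b = \<pi> y"
      using surj_\<pi> by (metis surjD)
    then show ?thesis
      using algebra_homD(3)[OF hom]
      by (simp add: algebra_homD(3)[OF \<pi>_hom, symmetric] quotient_coaction_\<pi>)
  qed
  moreover have "\<delta>B 1 = 1"
    using algebra_homD(2)[OF hom] quotient_coaction_\<pi>[of 1] by (simp add: algebra_homD(2)[OF \<pi>_hom])
  ultimately show ?thesis
    by (simp add: algebra_hom_def clinear_quotient_coaction)
qed

abbreviation "generator \<equiv> (\<lambda>v. \<pi> (word [v]))"

lemma clinear_generator: "clinear generator"
  by (rule clinear_comp[OF clinear_\<pi> clinear_word_simps(1)])

lemma quotient_coaction_generator: "\<delta>B (generator v) = tensor_map generator id (\<delta> v)"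
  by (simp add: quotient_coaction_\<pi> coaction_word tensor_map_map[OF clinear_\<pi> clinear_id])
    (simp add: id_def)

lemma quotient_hom_eqI:
  assumes "algebra_hom f" "algebra_hom g" "\<And>v. f (generator v) = g (generator v)"
  shows "f b = g b"
proof -
  obtain x where "b = \<pi> x"
    using surj_\<pi> by (metis surjD)
  then show ?thesis
    using tensor_alg_hom_eqI[OF algebra_hom_comp[OF assms(1) \<pi>_hom] algebra_hom_comp[OF assms(2) \<pi>_hom] assms(3)]
    by simp
qed

text \<open>Both comodule axioms equate two algebra homomorphisms out of B, so they need checking
  only on generators, where they are the axioms for V.\<close>

lemma right_comodule_quotient: "right_comodule H \<delta>B"
proof -
  note \<delta>B = clinear_quotient_coaction
  have "tensor_assoc (tensor_map \<delta>B id (\<delta>B b)) = tensor_map id (comult H) (\<delta>B b)" for b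
  proof (rule quotient_hom_eqI)
    fix v
    \<comment> \<open>Naturality of the associator with respect to the inclusion of generators,
      reduced to pure tensors in two stages.\<close>
    have g: "tensor_assoc (tensor_map (tensor_map generator id) id z) = tensor_map generator id (tensor_assoc z)"
      for z :: "('v \<otimes> 'h) \<otimes> 'h"
    proof (rule tensor_lift_eqI[where f = "\<lambda>z. tensor_assoc (tensor_map (tensor_map generator id) id z)"])
      note g2 = clinear_tensor_map[OF clinear_generator clinear_id]
      note g3 = clinear_tensor_map[OF g2 clinear_id]
      show "clinear (\<lambda>z. tensor_assoc (tensor_map (tensor_map generator id) id (z :: ('v \<otimes> 'h) \<otimes> 'h)))"
        "clinear (\<lambda>z. tensor_map generator id (tensor_assoc (z :: ('v \<otimes> 'h) \<otimes> 'h)))"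
        by (rule clinear_comp[OF clinear_tensor_assoc g3] clinear_comp[OF g2 clinear_tensor_assoc])+
      fix a :: "'v \<otimes> 'h" and c :: 'h
      show "tensor_assoc (tensor_map (tensor_map generator id) id (a \<otimes> c)) = tensor_map generator id (tensor_assoc (a \<otimes> c))"
      proof (rule tensor_lift_eqI[where x = a])
        show "clinear (\<lambda>a. tensor_assoc (tensor_map (tensor_map generator id) id (a \<otimes> c)))"
          "clinear (\<lambda>a. tensor_map generator id (tensor_assoc (a \<otimes> c)))"
          by (rule clinear_comp[OF clinear_tensor_assoc clinear_comp[OF g3 clinear_pure_left[OF clinear_ident]]]
              clinear_comp[OF g2 clinear_comp[OF clinear_tensor_assoc clinear_pure_left[OF clinear_ident]]])+
        fix u and h :: 'h
        have "tensor_map generator id (u \<otimes> h) = generator u \<otimes> h"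
          "tensor_map generator id (u \<otimes> h') = generator u \<otimes> h'"
          "tensor_map (tensor_map generator id) id ((u \<otimes> h) \<otimes> c) = tensor_map generator id (u \<otimes> h) \<otimes> c"
          for h' :: "'h \<otimes> 'h"
          by (simp_all add: tensor_map_pure[OF g2 clinear_id] tensor_map_pure[OF clinear_generator clinear_id])
        then show "tensor_assoc (tensor_map (tensor_map generator id) id ((u \<otimes> h) \<otimes> c))
            = tensor_map generator id (tensor_assoc ((u \<otimes> h) \<otimes> c))"
          by (simp only: tensor_assoc_pure)
      qed
    qed
    have "tensor_assoc (tensor_map \<delta>B id (\<delta>B (generator v)))
        = tensor_assoc (tensor_map (tensor_map generator id) id (tensor_map \<delta> id (\<delta> v)))"
      by (simp add: quotient_coaction_generator tensor_map_map[OF \<delta>B clinear_id]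
          tensor_map_map[OF clinear_tensor_map[OF clinear_generator clinear_id] clinear_id])
    also have "\<dots> = tensor_map generator id (tensor_map id (comult H) (\<delta> v))"
      using V.comodule by (simp add: g right_comodule_def)
    also have "\<dots> = tensor_map id (comult H) (\<delta>B (generator v))"
      by (simp add: quotient_coaction_generator tensor_map_map[OF clinear_generator clinear_id]
          tensor_map_map[OF clinear_id clinear_comult])
    finally show "tensor_assoc (tensor_map \<delta>B id (\<delta>B (generator v))) = tensor_map id (comult H) (\<delta>B (generator v))" .
  qed (intro algebra_hom_comp[OF algebra_hom_tensor_assoc] algebra_hom_comp[OF algebra_hom_tensor_map]
      quotient_coaction_hom algebra_hom_id comult_hom)+
  moreover have "(\<^bold>\<Sum>b0 b1\<leftarrow>\<delta>B b. counit H b1 *\<^sub>C b0) = b" for b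
    \<comment> \<open>Read as the action of the counit, the left-hand side is an algebra
      homomorphism by \<open>algebra_hom_twist\<close>.\<close>
    unfolding twist_def[symmetric]
  proof (rule quotient_hom_eqI[where g = "\<lambda>b. b"])
    fix v
    have "cbilinear (\<lambda>b0 b1. counit H b1 *\<^sub>C (b0 :: 'b))"
      by (intro lin)
    then show "twist \<delta>B (counit H) (generator v) = generator v"
      by (simp add: twist_def quotient_coaction_generator tensor_lift_map V.coaction_counit[OF clinear_generator])
  qed (intro algebra_hom_twist quotient_coaction_hom counit_hom, simp add: algebra_hom_def clinear_ident)
  ultimately show ?thesis
    by (simp add: right_comodule_def clinear_quotient_coaction)
qed

end

section \<open>Extension by Laurent polynomials\<close>

lemma clinear_free_extend_fun [lin]:
  assumes "\<And>i. clinear (\<lambda>z. F z i)"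
  shows "clinear (\<lambda>z. free_extend (F z) p)"
  unfolding free_extend_def by (intro lin assms)

lemma clinear_free_extend_arg [lin]: "clinear g \<Longrightarrow> clinear (\<lambda>z. free_extend f (g z))"
  by (rule clinear_comp[OF clinear_free_extend])

lemma free_extend_tpow: "free_extend f (tpow n) = f n"
  by (simp add: tpow_def free_extend_single)

lemma tpow_add: "tpow m * tpow n = tpow (m + n)"
  by (simp add: tpow_def mult_single)

lemma tpow_zero: "tpow 0 = 1"
  by (simp add: tpow_def)

lemma laurent_eqI:
  assumes "clinear f" "clinear g" "\<And>a n. f (a \<otimes> tpow n) = g (a \<otimes> tpow n)"
  shows "f x = g (x :: 'a::complex_vec \<otimes> laurent)"
proof (rule tensor_lift_eqI[OF assms(1,2)])
  fix a b
  show "f (a \<otimes> b) = g (a \<otimes> b)"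
    by (rule clinear_eq_on_basis[where f = "\<lambda>b. f (a \<otimes> b)" and g = "\<lambda>b. g (a \<otimes> b)"])
      (rule clinear_comp[OF assms(1) clinear_pure_right[OF clinear_ident]]
        clinear_comp[OF assms(2) clinear_pure_right[OF clinear_ident]] assms(3)[unfolded tpow_def])+
qed

lemma laurent_eqI2:
  fixes x :: "'a::complex_vec \<otimes> laurent" and y :: "'b::complex_vec \<otimes> laurent"
  assumes f: "cbilinear f" and g: "cbilinear g"
    and "\<And>a m b n. f (a \<otimes> tpow m) (b \<otimes> tpow n) = g (a \<otimes> tpow m) (b \<otimes> tpow n)"
  shows "f x y = g x y"
proof (rule laurent_eqI[where f = "\<lambda>x. f x y" and g = "\<lambda>x. g x y"])
  fix a m
  show "f (a \<otimes> tpow m) y = g (a \<otimes> tpow m) y"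
    by (rule laurent_eqI[where f = "f (a \<otimes> tpow m)"]) (use assms in \<open>auto simp: cbilinear_def\<close>)
qed (use f g in \<open>auto simp: cbilinear_def\<close>)

text \<open>Left general in the form and the exponent so that \<R> of the extension, with \<alpha>,
  and its convolution inverse, with the inverse form and -\<alpha>, are both instances.\<close>

definition laurent_form ::
  "complex \<Rightarrow> complex \<Rightarrow> ('g::complex_alg \<Rightarrow> 'g \<Rightarrow> complex) \<Rightarrow> 'g \<otimes> laurent \<Rightarrow> 'g \<otimes> laurent \<Rightarrow> complex" where
  "laurent_form q \<alpha> R = (\<lambda>x y. \<^bold>\<Sum>a b\<leftarrow>x. \<^bold>\<Sum>a' b'\<leftarrow>y. R a a' * rform (laurent_hopf q \<alpha>) b b')"

text \<open>With the counit for \<open>e\<close> this is the character q^(\<beta> n) times the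
  counit at g \<otimes> t^n; the values 2 \<alpha> and -2 \<alpha> of \<beta> give \<rho> and its
  inverse.\<close>

definition laurent_character :: "complex \<Rightarrow> complex \<Rightarrow> ('g::complex_alg \<Rightarrow> complex) \<Rightarrow> 'g \<otimes> laurent \<Rightarrow> complex"
  where "laurent_character q \<beta> e = tensor_lift (\<lambda>a b. e a * free_extend (\<lambda>n. q powr (\<beta> * of_int n)) b)"

section \<open>The coquasitriangular bialgebra of G and Laurent polynomials\<close>

locale laurent_bialgebra = G: cqt_bialgebra G Rb
  for G :: "('g::complex_alg) cqt_hopf" and Rb +
  fixes q \<alpha> :: complex
  assumes q: "q \<noteq> 0"
begin

abbreviation "H \<equiv> laurent_extension q \<alpha> G"

lemma rform_laurent: "rform (laurent_hopf q \<beta>) (tpow m) (tpow n) = q powr (\<beta> * of_int m * of_int n)"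
  by (simp add: laurent_hopf_def free_extend_tpow)

lemma bilinear_laurent: "cbilinear (rform (laurent_hopf q \<beta>))"
  unfolding laurent_hopf_def cqt_hopf.simps by (intro lin)

lemmas laurent_lin = cbilinear_left[OF bilinear_laurent] cbilinear_right[OF bilinear_laurent]

lemma bilinear_laurent_form:
  assumes "cbilinear R"
  shows "cbilinear (laurent_form q \<beta> R)"
  unfolding laurent_form_def
  by (intro lin laurent_lin cbilinear_left[OF assms] cbilinear_right[OF assms])

lemma laurent_form_pure:
  assumes "cbilinear R"
  shows "laurent_form q \<beta> R (a \<otimes> tpow m) (b \<otimes> tpow n) = R a b * q powr (\<beta> * of_int m * of_int n)"
proof -
  note [lin] = cbilinear_left[OF assms] cbilinear_right[OF assms] laurent_lin
  have "cbilinear (\<lambda>a b. \<^bold>\<Sum>a' b'\<leftarrow>y. R a a' * rform (laurent_hopf q \<beta>) b b')"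
    "cbilinear (\<lambda>a' b'. R a a' * rform (laurent_hopf q \<beta>) b b')" for y a b
    by (intro lin)+
  then show ?thesis
    by (simp add: laurent_form_def tensor_lift_pure rform_laurent)
qed

lemma rform_H: "rform H = laurent_form q \<alpha> (rform G)"
  by (simp add: laurent_extension_def tensor_cqt_hopf_def laurent_form_def)

lemma comult_H_bilinear: "cbilinear (\<lambda>a b. \<^bold>\<Sum>a1 a2\<leftarrow>comult G a. \<^bold>\<Sum>b1 b2\<leftarrow>comult (laurent_hopf q \<alpha>) b.
    (a1 \<otimes> b1) \<otimes> (a2 \<otimes> b2))"
  unfolding laurent_hopf_def cqt_hopf.simps by (intro lin)

lemma clinear_comult_H: "clinear (comult H)"
  unfolding laurent_extension_def tensor_cqt_hopf_def cqt_hopf.simps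
  by (rule clinear_tensor_lift[OF comult_H_bilinear])

lemma comult_H: "comult H (g \<otimes> tpow n) = (\<^bold>\<Sum>a b\<leftarrow>comult G g. (a \<otimes> tpow n) \<otimes> (b \<otimes> tpow n))"
proof -
  have "cbilinear (\<lambda>(b1 :: laurent) (b2 :: laurent). (a \<otimes> b1) \<otimes> (b \<otimes> b2))" for a b :: 'g
    by (intro lin)
  then show ?thesis
    unfolding laurent_extension_def tensor_cqt_hopf_def cqt_hopf.simps tensor_lift_pure[OF comult_H_bilinear]
    by (simp add: laurent_hopf_def free_extend_tpow tensor_lift_pure)
qed

lemma comult_H_lift:
  assumes "cbilinear F"
  shows "tensor_lift F (comult H (g \<otimes> tpow n)) = (\<^bold>\<Sum>a b\<leftarrow>comult G g. F (a \<otimes> tpow n) (b \<otimes> tpow n))"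
  by (simp add: comult_H clinear_tensor_liftI[OF clinear_tensor_lift[OF assms]] tensor_lift_pure[OF assms])

lemma counit_H_bilinear: "cbilinear (\<lambda>a b. counit G a * counit (laurent_hopf q \<alpha>) b)"
  unfolding laurent_hopf_def cqt_hopf.simps by (intro lin)

lemma clinear_counit_H: "clinear (counit H)"
  unfolding laurent_extension_def tensor_cqt_hopf_def cqt_hopf.simps
  by (rule clinear_tensor_lift[OF counit_H_bilinear])

lemma counit_H: "counit H (g \<otimes> tpow n) = counit G g"
  unfolding laurent_extension_def tensor_cqt_hopf_def cqt_hopf.simps tensor_lift_pure[OF counit_H_bilinear]
  by (simp add: laurent_hopf_def free_extend_tpow)

lemmas bilinear_forms = bilinear_laurent_form[OF G.rform_bilinear, of \<alpha>] bilinear_laurent_form[OF G.rinv_bilinear, of "- \<alpha>"]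

lemmas [lin] = clinear_comp[OF clinear_comult_H] clinear_comp[OF clinear_counit_H]
  cbilinear_left[OF bilinear_forms(1)] cbilinear_right[OF bilinear_forms(1)]
  cbilinear_left[OF bilinear_forms(2)] cbilinear_right[OF bilinear_forms(2)]

lemmas form_pure = laurent_form_pure[OF G.rform_bilinear] laurent_form_pure[OF G.rinv_bilinear]

text \<open>\<open>powr\<close> uses one fixed logarithm of q, so exponents add for arbitrary
  complex \<alpha>. At q = 0 the identity fails, since \<open>0 powr z = 0\<close>.\<close>

lemma powr_cancel: "q powr z * q powr (- z) = 1" "q powr (- z) * q powr z = 1"
  using q by (simp_all add: powr_add[symmetric])

text \<open>Powers of t are grouplike: on g \<otimes> t^n each law is the one of G with t^n carried
  along in every factor.\<close>

lemma coalgebra_H: "coalgebra (comult H) (counit H)"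
  unfolding coalgebra_def
proof (intro conjI allI)
  note assoc_lin = clinear_comp[OF clinear_tensor_assoc]
  fix x :: "'g \<otimes> laurent"
  show "tensor_assoc (tensor_map (comult H) id (comult H x)) = tensor_map id (comult H) (comult H x)"
  proof (rule laurent_eqI[where f = "\<lambda>x. tensor_assoc (tensor_map (comult H) id (comult H x))"])
    show "clinear (\<lambda>x. tensor_assoc (tensor_map (comult H) id (comult H x)))"
      by (intro assoc_lin clinear_tensor_map_arg clinear_comult_H clinear_id)
    show "clinear (\<lambda>x. tensor_map id (comult H) (comult H x))"
      by (intro clinear_tensor_map_arg clinear_comult_H clinear_id)
    fix g n
    let ?t = "\<lambda>g. g \<otimes> tpow n"
    have 1: "cbilinear (\<lambda>a b. comult H a \<otimes> id b)" "cbilinear (\<lambda>a b. id a \<otimes> comult H b)"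
      by (simp_all add: id_def) (intro lin)+
    have "tensor_assoc (tensor_map (comult H) id (comult H (?t g)))
        = (\<^bold>\<Sum>a c\<leftarrow>comult G g. \<^bold>\<Sum>x y\<leftarrow>comult G a. ?t x \<otimes> (?t y \<otimes> ?t c))"
      unfolding tensor_map_def comult_H_lift[OF 1(1)]
      by (simp add: comult_H clinear_tensor_liftI[OF clinear_tensor_assoc]
          clinear_tensor_liftI[OF clinear_pure_left[OF clinear_ident]] tensor_assoc_pure)
    also have "\<dots> = (\<^bold>\<Sum>a b\<leftarrow>comult G g. \<^bold>\<Sum>x y\<leftarrow>comult G b. ?t a \<otimes> (?t x \<otimes> ?t y))"
      by (rule G.comult_coassoc) (intro lin)
    also have "\<dots> = tensor_map id (comult H) (comult H (?t g))"
      unfolding tensor_map_def comult_H_lift[OF 1(2)]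
      by (simp add: comult_H clinear_tensor_liftI[OF clinear_pure_right[OF clinear_ident]])
    finally show "tensor_assoc (tensor_map (comult H) id (comult H (?t g))) = tensor_map id (comult H) (comult H (?t g))" .
  qed
  have 1: "cbilinear (\<lambda>a b. counit H a *\<^sub>C b)" "cbilinear (\<lambda>a b. counit H b *\<^sub>C a)"
    by (intro lin)+
  show "(\<^bold>\<Sum>a b\<leftarrow>comult H x. counit H a *\<^sub>C b) = x"
  proof (rule laurent_eqI[where g = "\<lambda>x. x"])
    fix g n
    show "(\<^bold>\<Sum>a b\<leftarrow>comult H (g \<otimes> tpow n). counit H a *\<^sub>C b) = g \<otimes> tpow n"
      by (simp add: comult_H_lift[OF 1(1)] counit_H G.counit_left[OF clinear_pure_left[OF clinear_ident]])
  qed (intro lin)+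
  show "(\<^bold>\<Sum>a b\<leftarrow>comult H x. counit H b *\<^sub>C a) = x"
  proof (rule laurent_eqI[where g = "\<lambda>x. x"])
    fix g n
    show "(\<^bold>\<Sum>a b\<leftarrow>comult H (g \<otimes> tpow n). counit H b *\<^sub>C a) = g \<otimes> tpow n"
      by (simp add: comult_H_lift[OF 1(2)] counit_H G.counit_right[OF clinear_pure_left[OF clinear_ident]])
  qed (intro lin)+
qed (rule clinear_comult_H clinear_counit_H)+

lemma one_H: "1 = (1 :: 'g) \<otimes> tpow 0"
  by (simp add: one_tensor_def tpow_zero)

lemma mult_H: "(a \<otimes> tpow m) * (b \<otimes> tpow n) = (a * b) \<otimes> tpow (m + n)" for a b :: 'g
  by (simp add: tensor_mult_pure tpow_add)

lemma comult_H_hom: "algebra_hom (comult H)"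
proof -
  have "comult H (x * y) = comult H x * comult H y" for x y
  proof (rule laurent_eqI2[OF cbilinear_mult_compose[OF clinear_comult_H]])
    fix a m b n
    have bil: "cbilinear (\<lambda>c d. ((c :: 'g) \<otimes> tpow (m + n)) \<otimes> ((d :: 'g) \<otimes> tpow (m + n)))"
      by (intro lin)
    show "comult H ((a \<otimes> tpow m) * (b \<otimes> tpow n)) = comult H (a \<otimes> tpow m) * comult H (b \<otimes> tpow n)"
      by (simp add: mult_H comult_H G.comult_mult tensor_lift_mult[OF bil] tensor_lift_factor tensor_mult_pure tpow_add)
        (rule tensor_lift_swap)
  qed
  moreover have "comult H 1 = 1"
  proof -
    have bil: "cbilinear (\<lambda>a b. ((a :: 'g) \<otimes> tpow 0) \<otimes> ((b :: 'g) \<otimes> tpow 0))"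
      by (intro lin)
    have "comult H (1 \<otimes> tpow 0) = (1 \<otimes> tpow 0) \<otimes> (1 \<otimes> tpow 0)"
      by (simp add: comult_H G.comult_one tensor_lift_pure[OF bil])
    then show ?thesis
      by (simp add: one_tensor_def tpow_zero)
  qed
  ultimately show ?thesis
    by (simp add: algebra_hom_def clinear_comult_H)
qed

lemma counit_H_hom: "algebra_hom (counit H)"
proof -
  have "counit H (x * y) = counit H x * counit H y" for x y
    by (rule laurent_eqI2[OF cbilinear_mult_compose[OF clinear_counit_H]])
      (simp add: mult_H counit_H G.counit_mult)
  then show ?thesis
    by (simp add: algebra_hom_def clinear_counit_H one_H counit_H G.counit_one)
qed

text \<open>At powers t^m and t^n the two scalar factors are constant over the Sweedler sums and
  cancel because \<beta> + \<gamma> = 0. The symmetric form of that condition serves both the left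
  and the right inverse.\<close>

lemma convolution_inverse:
  assumes R: "cbilinear R" and S: "cbilinear S"
    and RS: "\<And>x y. (\<^bold>\<Sum>x1 x2\<leftarrow>comult G x. \<^bold>\<Sum>y1 y2\<leftarrow>comult G y. R x1 y1 * S x2 y2)
      = counit G x * counit G y"
    and \<beta>: "\<beta> + \<gamma> = 0"
  shows "(\<^bold>\<Sum>x1 x2\<leftarrow>comult H x. \<^bold>\<Sum>y1 y2\<leftarrow>comult H y. laurent_form q \<beta> R x1 y1 * laurent_form q \<gamma> S x2 y2)
    = counit H x * counit H y"
proof (rule laurent_eqI2[where g = "\<lambda>x y. counit H x * counit H y"])
  note RS' = bilinear_laurent_form[OF R, of \<beta>] bilinear_laurent_form[OF S, of \<gamma>]
  note [lin] = cbilinear_left[OF RS'(1)] cbilinear_right[OF RS'(1)]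
    cbilinear_left[OF RS'(2)] cbilinear_right[OF RS'(2)]
  show "cbilinear (\<lambda>x y. \<^bold>\<Sum>x1 x2\<leftarrow>comult H x. \<^bold>\<Sum>y1 y2\<leftarrow>comult H y.
      laurent_form q \<beta> R x1 y1 * laurent_form q \<gamma> S x2 y2)"
    "cbilinear (\<lambda>x y. counit H x * counit H y)"
    by (intro lin)+
  fix a m b n
  have 1: "cbilinear (\<lambda>x1 x2. \<^bold>\<Sum>y1 y2\<leftarrow>comult H y. laurent_form q \<beta> R x1 y1 * laurent_form q \<gamma> S x2 y2)"
    "cbilinear (\<lambda>y1 y2. laurent_form q \<beta> R x1 y1 * laurent_form q \<gamma> S x2 y2)" for y x1 x2
    by (intro lin)+
  have "\<gamma> = - \<beta>"
    using \<beta> by (simp add: eq_neg_iff_add_eq_0 add.commute)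
  then have c: "R u v * q powr (\<beta> * of_int m * of_int n) * (S u' v' * q powr (\<gamma> * of_int m * of_int n))
      = R u v * S u' v'" for u v u' v'
    using powr_cancel(1)[of "\<beta> * of_int m * of_int n"] by (simp add: mult_ac)
  show "(\<^bold>\<Sum>x1 x2\<leftarrow>comult H (a \<otimes> tpow m). \<^bold>\<Sum>y1 y2\<leftarrow>comult H (b \<otimes> tpow n).
      laurent_form q \<beta> R x1 y1 * laurent_form q \<gamma> S x2 y2) = counit H (a \<otimes> tpow m) * counit H (b \<otimes> tpow n)"
    by (subst comult_H_lift[OF 1(1)]) (simp only: comult_H_lift[OF 1(2)] laurent_form_pure[OF R]
        laurent_form_pure[OF S] c RS counit_H)
qed

lemma rform_H_mult_left: "rform H (x * y) z = (\<^bold>\<Sum>z1 z2\<leftarrow>comult H z. rform H x z1 * rform H y z2)"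
  unfolding rform_H
proof (rule laurent_eqI2[where f = "\<lambda>x y. laurent_form q \<alpha> (rform G) (x * y) z"])
  show "cbilinear (\<lambda>x y. laurent_form q \<alpha> (rform G) (x * y) z)"
    "cbilinear (\<lambda>x y. \<^bold>\<Sum>z1 z2\<leftarrow>comult H z. laurent_form q \<alpha> (rform G) x z1 * laurent_form q \<alpha> (rform G) y z2)"
    by (intro lin)+
  fix a m b n
  show "laurent_form q \<alpha> (rform G) ((a \<otimes> tpow m) * (b \<otimes> tpow n)) z
      = (\<^bold>\<Sum>z1 z2\<leftarrow>comult H z. laurent_form q \<alpha> (rform G) (a \<otimes> tpow m) z1 * laurent_form q \<alpha> (rform G) (b \<otimes> tpow n) z2)"
  proof (rule laurent_eqI[where x = z])
    fix c k
    have 1: "cbilinear (\<lambda>z1 z2. laurent_form q \<alpha> (rform G) x z1 * laurent_form q \<alpha> (rform G) y z2)" for x y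
      by (intro lin)
    have "q powr (\<alpha> * of_int (m + n) * of_int k) = q powr (\<alpha> * of_int m * of_int k) * q powr (\<alpha> * of_int n * of_int k)"
      by (subst powr_add[symmetric]) (simp add: algebra_simps)
    then show "laurent_form q \<alpha> (rform G) ((a \<otimes> tpow m) * (b \<otimes> tpow n)) (c \<otimes> tpow k)
        = (\<^bold>\<Sum>z1 z2\<leftarrow>comult H (c \<otimes> tpow k). laurent_form q \<alpha> (rform G) (a \<otimes> tpow m) z1 * laurent_form q \<alpha> (rform G) (b \<otimes> tpow n) z2)"
      by (simp only: comult_H_lift[OF 1] form_pure mult_H G.rform_mult_left tensor_lift_factor mult_ac)
  qed (intro lin)+
qed

lemma rform_H_mult_right: "rform H x (y * z) = (\<^bold>\<Sum>x1 x2\<leftarrow>comult H x. rform H x1 z * rform H x2 y)"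
  unfolding rform_H
proof (rule laurent_eqI2[where f = "\<lambda>y z. laurent_form q \<alpha> (rform G) x (y * z)"])
  show "cbilinear (\<lambda>y z. laurent_form q \<alpha> (rform G) x (y * z))"
    "cbilinear (\<lambda>y z. \<^bold>\<Sum>x1 x2\<leftarrow>comult H x. laurent_form q \<alpha> (rform G) x1 z * laurent_form q \<alpha> (rform G) x2 y)"
    by (intro lin)+
  fix a m b n
  show "laurent_form q \<alpha> (rform G) x ((a \<otimes> tpow m) * (b \<otimes> tpow n))
      = (\<^bold>\<Sum>x1 x2\<leftarrow>comult H x. laurent_form q \<alpha> (rform G) x1 (b \<otimes> tpow n) * laurent_form q \<alpha> (rform G) x2 (a \<otimes> tpow m))"
  proof (rule laurent_eqI[where x = x])
    fix c k
    have 1: "cbilinear (\<lambda>x1 x2. laurent_form q \<alpha> (rform G) x1 z * laurent_form q \<alpha> (rform G) x2 y)" for z y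
      by (intro lin)
    have "q powr (\<alpha> * of_int k * of_int (m + n)) = q powr (\<alpha> * of_int k * of_int n) * q powr (\<alpha> * of_int k * of_int m)"
      by (subst powr_add[symmetric]) (simp add: algebra_simps)
    then show "laurent_form q \<alpha> (rform G) (c \<otimes> tpow k) ((a \<otimes> tpow m) * (b \<otimes> tpow n))
        = (\<^bold>\<Sum>x1 x2\<leftarrow>comult H (c \<otimes> tpow k). laurent_form q \<alpha> (rform G) x1 (b \<otimes> tpow n) * laurent_form q \<alpha> (rform G) x2 (a \<otimes> tpow m))"
      by (simp only: comult_H_lift[OF 1] form_pure mult_H G.rform_mult_right tensor_lift_factor mult_ac)
  qed (intro lin)+
qed

lemma quasi_commutative_H:
  "(\<^bold>\<Sum>x1 x2\<leftarrow>comult H x. \<^bold>\<Sum>y1 y2\<leftarrow>comult H y. rform H x2 y2 *\<^sub>C (y1 * x1))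
    = (\<^bold>\<Sum>x1 x2\<leftarrow>comult H x. \<^bold>\<Sum>y1 y2\<leftarrow>comult H y. rform H x1 y1 *\<^sub>C (x2 * y2))"
  unfolding rform_H
proof (rule laurent_eqI2[where f = "\<lambda>x y. \<^bold>\<Sum>x1 x2\<leftarrow>comult H x. \<^bold>\<Sum>y1 y2\<leftarrow>comult H y.
    laurent_form q \<alpha> (rform G) x2 y2 *\<^sub>C (y1 * x1)"])
  let ?R = "laurent_form q \<alpha> (rform G)"
  fix a m b n
  have 1: "cbilinear (\<lambda>x1 x2. \<^bold>\<Sum>y1 y2\<leftarrow>comult H y. ?R x2 y2 *\<^sub>C (y1 * x1))"
    "cbilinear (\<lambda>y1 y2. ?R x2 y2 *\<^sub>C (y1 * x1))"
    "cbilinear (\<lambda>x1 x2. \<^bold>\<Sum>y1 y2\<leftarrow>comult H y. ?R x1 y1 *\<^sub>C (x2 * y2))"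
    "cbilinear (\<lambda>y1 y2. ?R x1 y1 *\<^sub>C (x2 * y2))" for y x1 x2
    by (intro lin)+
  \<comment> \<open>On both sides every term carries the same scalar q^(\<alpha> m n) and the same
    power t^(m + n), as Laurent polynomials commute; \<open>L\<close> collects this factor and
    leaves the identity in G.\<close>
  define L where "L h = q powr (\<alpha> * of_int m * of_int n) *\<^sub>C (h \<otimes> tpow (m + n))" for h :: 'g
  have L: "clinear L"
    unfolding L_def by (intro lin)
  have pure: "?R (x \<otimes> tpow m) (y \<otimes> tpow n) *\<^sub>C ((c \<otimes> tpow m) * (d \<otimes> tpow n)) = L (rform G x y *\<^sub>C (c * d))"
    "?R (x \<otimes> tpow m) (y \<otimes> tpow n) *\<^sub>C ((d \<otimes> tpow n) * (c \<otimes> tpow m)) = L (rform G x y *\<^sub>C (d * c))"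
    for x y c d
    by (simp_all add: L_def form_pure mult_H pure_tensor_scale_left mult.commute add.commute)
  show "(\<^bold>\<Sum>x1 x2\<leftarrow>comult H (a \<otimes> tpow m). \<^bold>\<Sum>y1 y2\<leftarrow>comult H (b \<otimes> tpow n). ?R x2 y2 *\<^sub>C (y1 * x1))
    = (\<^bold>\<Sum>x1 x2\<leftarrow>comult H (a \<otimes> tpow m). \<^bold>\<Sum>y1 y2\<leftarrow>comult H (b \<otimes> tpow n). ?R x1 y1 *\<^sub>C (x2 * y2))"
    by (subst comult_H_lift[OF 1(1)], subst comult_H_lift[OF 1(3)])
      (simp only: comult_H_lift[OF 1(2)] comult_H_lift[OF 1(4)] pure
        clinear_tensor_liftI[OF L, symmetric] G.quasi_commutative)
qed (intro lin)+

sublocale H: cqt_bialgebra H "laurent_form q (- \<alpha>) Rb"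
proof unfold_locales
  show "(\<^bold>\<Sum>x1 x2\<leftarrow>comult H x. \<^bold>\<Sum>y1 y2\<leftarrow>comult H y. rform H x1 y1 * laurent_form q (- \<alpha>) Rb x2 y2)
      = counit H x * counit H y" for x y
    unfolding rform_H
    by (rule convolution_inverse[OF G.rform_bilinear G.rinv_bilinear G.rform_rinv]) simp
  show "(\<^bold>\<Sum>x1 x2\<leftarrow>comult H x. \<^bold>\<Sum>y1 y2\<leftarrow>comult H y. laurent_form q (- \<alpha>) Rb x1 y1 * rform H x2 y2)
      = counit H x * counit H y" for x y
    unfolding rform_H
    by (rule convolution_inverse[OF G.rinv_bilinear G.rform_bilinear G.rinv_rform]) simp
qed (simp_all only: coalgebra_H comult_H_hom counit_H_hom rform_H bilinear_forms
    rform_H_mult_left[unfolded rform_H] rform_H_mult_right[unfolded rform_H] quasi_commutative_H[unfolded rform_H])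

text \<open>Since t is grouplike, both axioms reduce to those of \<delta> with t carried
  along.\<close>

lemma right_comodule_extend:
  assumes "right_comodule G \<delta>"
  shows "right_comodule H (extend_coaction \<delta>)"
proof -
  interpret \<delta>: comodule G \<delta>
    by unfold_locales (rule assms)
  let ?\<delta> = "extend_coaction \<delta>" and ?t = "\<lambda>g. g \<otimes> tpow 1"
  have lin_\<delta>: "clinear ?\<delta>"
    unfolding extend_coaction_def by (intro lin)
  note [lin] = clinear_comp[OF lin_\<delta>]
  have ext: "tensor_lift F (?\<delta> v) = (\<^bold>\<Sum>v0 v1\<leftarrow>\<delta> v. F v0 (?t v1))" if "cbilinear F" for F :: "'a \<Rightarrow> 'g \<otimes> laurent \<Rightarrow> 'z::complex_vec" and v
    unfolding extend_coaction_def by (simp add: tensor_lift_map[OF that])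
  have \<delta>_eq: "?\<delta> v = (\<^bold>\<Sum>v0 v1\<leftarrow>\<delta> v. v0 \<otimes> ?t v1)" for v
    by (simp add: extend_coaction_def tensor_map_def)
  have 1: "cbilinear (\<lambda>a b. ?\<delta> a \<otimes> id b)" "cbilinear (\<lambda>a b. id a \<otimes> comult H b)"
    "cbilinear (\<lambda>(v0::'a) v1. counit H v1 *\<^sub>C v0)"
    by (simp_all add: id_def) (intro lin)+
  have "tensor_assoc (tensor_map ?\<delta> id (?\<delta> v)) = tensor_map id (comult H) (?\<delta> v)" for v
  proof -
    have "tensor_assoc (tensor_map ?\<delta> id (?\<delta> v)) = (\<^bold>\<Sum>v0 v1\<leftarrow>\<delta> v. \<^bold>\<Sum>x y\<leftarrow>\<delta> v0. x \<otimes> (?t y \<otimes> ?t v1))"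
      unfolding tensor_map_def ext[OF 1(1)]
      by (simp add: \<delta>_eq clinear_tensor_liftI[OF clinear_tensor_assoc]
          clinear_tensor_liftI[OF clinear_pure_left[OF clinear_ident]] tensor_assoc_pure)
    also have "\<dots> = (\<^bold>\<Sum>v0 v1\<leftarrow>\<delta> v. \<^bold>\<Sum>x y\<leftarrow>comult G v1. v0 \<otimes> (?t x \<otimes> ?t y))"
      by (rule \<delta>.coaction_coassoc) (intro lin)
    also have "\<dots> = tensor_map id (comult H) (?\<delta> v)"
      unfolding tensor_map_def ext[OF 1(2)]
      by (simp add: comult_H clinear_tensor_liftI[OF clinear_pure_right[OF clinear_ident]])
    finally show ?thesis .
  qed
  moreover have "(\<^bold>\<Sum>v0 v1\<leftarrow>?\<delta> v. counit H v1 *\<^sub>C v0) = v" for v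
    by (simp add: ext[OF 1(3)] counit_H \<delta>.coaction_counit[OF clinear_ident])
  ultimately show ?thesis
    by (simp add: right_comodule_def lin_\<delta>)
qed

section \<open>Characters and the evaluation of the form at D\<close>

abbreviation "\<kappa> \<beta> \<equiv> laurent_character q \<beta> (counit G)"

lemma laurent_character_pure: "\<kappa> \<beta> (g \<otimes> tpow n) = counit G g * q powr (\<beta> * of_int n)"
  unfolding laurent_character_def
  by (subst tensor_lift_pure) (intro lin | simp add: free_extend_tpow)+

lemma clinear_laurent_character: "clinear (\<kappa> \<beta>)"
  unfolding laurent_character_def by (intro lin)

lemma laurent_character_hom: "algebra_hom (\<kappa> \<beta>)"
proof -
  have "\<kappa> \<beta> (x * y) = \<kappa> \<beta> x * \<kappa> \<beta> y" for x y
  proof (rule laurent_eqI2[OF cbilinear_mult_compose[OF clinear_laurent_character]])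
    fix a m b n
    have "q powr (\<beta> * of_int (m + n)) = q powr (\<beta> * of_int m) * q powr (\<beta> * of_int n)"
      by (subst powr_add[symmetric]) (simp add: algebra_simps)
    then show "\<kappa> \<beta> ((a \<otimes> tpow m) * (b \<otimes> tpow n)) = \<kappa> \<beta> (a \<otimes> tpow m) * \<kappa> \<beta> (b \<otimes> tpow n)"
      by (simp only: mult_H laurent_character_pure G.counit_mult mult_ac)
  qed
  then show ?thesis
    using q by (simp add: algebra_hom_def clinear_laurent_character one_H laurent_character_pure G.counit_one)
qed

lemma laurent_character_inverse:
  assumes "\<beta> + \<gamma> = 0"
  shows "(\<^bold>\<Sum>a b\<leftarrow>comult H h. \<kappa> \<beta> a * \<kappa> \<gamma> b) = counit H h"
proof (rule laurent_eqI[where g = "counit H"])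
  note [lin] = clinear_comp[OF clinear_laurent_character]
  have 1: "cbilinear (\<lambda>a b. \<kappa> \<beta> a * \<kappa> \<gamma> b)"
    by (intro lin)
  show "clinear (\<lambda>h. \<^bold>\<Sum>a b\<leftarrow>comult H h. \<kappa> \<beta> a * \<kappa> \<gamma> b)"
    by (intro lin)
  fix g n
  have "\<gamma> = - \<beta>"
    using assms by (simp add: eq_neg_iff_add_eq_0 add.commute)
  then have c: "(counit G a * q powr (\<beta> * of_int n)) * (counit G b * q powr (\<gamma> * of_int n)) = counit G a *\<^sub>C counit G b" for a b
    using powr_cancel(1)[of "\<beta> * of_int n"] by (simp add: cscale_complex_def mult_ac)
  show "(\<^bold>\<Sum>a b\<leftarrow>comult H (g \<otimes> tpow n). \<kappa> \<beta> a * \<kappa> \<gamma> b) = counit H (g \<otimes> tpow n)"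
    by (simp only: comult_H_lift[OF 1] laurent_character_pure c G.counit_left[OF G.clinear_counit] counit_H)
qed (rule clinear_counit_H)

text \<open>At g \<otimes> t^n the part in G is \<R>(g, 1) or \<R>(1, g), each the counit of g. The
  factor 2 in 2 \<alpha> is the exponent of t in the coaction of D.\<close>

lemma rform_H_D: "rform H h (1 \<otimes> tpow 2) = \<kappa> (2 * \<alpha>) h" "rform H (1 \<otimes> tpow 2) h = \<kappa> (2 * \<alpha>) h"
  unfolding rform_H
  by (rule laurent_eqI[where g = "\<kappa> (2 * \<alpha>)"], (intro lin)[1], rule clinear_laurent_character,
      simp add: form_pure laurent_character_pure G.rform_one_left G.rform_one_right mult_ac)+

lemma form_invariant:
  assumes "comodule_map (tensor_coaction \<delta>V \<delta>V) D_coaction \<eta>" and \<delta>V: "right_comodule H \<delta>V"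
  shows "(\<^bold>\<Sum>v0 v1\<leftarrow>\<delta>V v. \<^bold>\<Sum>w0 w1\<leftarrow>\<delta>V w. \<eta> (v0 \<otimes> w0) *\<^sub>C (v1 * w1)) = \<eta> (v \<otimes> w) *\<^sub>C (1 \<otimes> tpow 2)"
proof -
  interpret comodule_pair H "laurent_form q (- \<alpha>) Rb" \<delta>V \<delta>V
    by unfold_locales (rule \<delta>V)+
  have \<eta>: "clinear \<eta>" and "D_coaction (\<eta> (v \<otimes> w)) = tensor_map \<eta> id (tensor_coaction \<delta>V \<delta>V (v \<otimes> w))"
    using assms by (simp_all add: comodule_map_def)
  \<comment> \<open>Scalar multiplication identifies CD \<otimes> H with H and turns equivariance of
    \<eta> into an equation between elements of H.\<close>
  then have "tensor_lift (\<lambda>z h. z *\<^sub>C h) (\<eta> (v \<otimes> w) \<otimes> (1 \<otimes> tpow 2))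
      = tensor_lift (\<lambda>z h. z *\<^sub>C h) (tensor_map \<eta> id (tensor_coaction \<delta>V \<delta>V (v \<otimes> w)))"
    by (simp add: D_coaction_def)
  moreover have bil: "cbilinear (\<lambda>z (h :: 'g \<otimes> laurent). z *\<^sub>C h)" "cbilinear (\<lambda>x (h :: 'g \<otimes> laurent). \<eta> x *\<^sub>C h)"
    by (intro lin clinear_comp[OF \<eta>])+
  ultimately show ?thesis
    by (simp add: tensor_lift_map[OF bil(1)] tensor_lift_pure[OF bil(1)] tensor_coaction_pure
        clinear_tensor_liftI[OF clinear_tensor_lift[OF bil(2)]] tensor_lift_pure[OF bil(2)])
qed

end

theorem corollary5p2:
  fixes G :: "('g::complex_alg) cqt_hopf"
    and q \<alpha> :: complex
    and \<delta> :: "'v::complex_vec \<Rightarrow> 'v \<otimes> 'g"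
    and \<eta> :: "'v \<otimes> 'v \<Rightarrow> complex"
    and \<pi> :: "'v tensor_alg \<Rightarrow> 'b::complex_alg"
    and p10 :: "('v \<otimes> 'b) \<otimes> ('v \<otimes> 'b) \<Rightarrow> 'w10::complex_vec"
    and p01 :: "('b \<otimes> 'v) \<otimes> ('b \<otimes> 'v) \<Rightarrow> 'w01::complex_vec"
  assumes "coquasitriangular_hopf G" and "q \<noteq> 0"
    and "right_comodule G \<delta>"
    and H: "H = laurent_extension q \<alpha> G"
    and \<delta>V: "\<delta>V = extend_coaction \<delta>"
    and "comodule_map (tensor_coaction \<delta>V \<delta>V) D_coaction \<eta>"
    and "braided_symmetric_algebra (braid H \<delta>V \<delta>V) \<pi>"
    and \<delta>B: "\<delta>B = quotient_coaction \<pi> \<delta>V"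
    and \<Psi>BV: "\<Psi>BV = braid H \<delta>B \<delta>V"
    and \<Psi>VB: "\<Psi>VB = braid H \<delta>V \<delta>B"
    and \<Phi>p: "\<Phi>p = inv (braid H \<delta>B D_coaction)"
    and \<Phi>m: "\<Phi>m = braid H D_coaction \<delta>B"
    and "tensor_over omega10_right (omega10_left \<Psi>BV) p10"
    and "tensor_over (omega01_right \<Psi>VB) omega01_left p01"
  shows "bimodule L_left (L_right \<Phi>p) \<and> bimodule L_left (L_right \<Phi>m)
    \<and> (\<forall>x b. L_right \<Phi>p (1 \<otimes> \<eta> x) b = \<Phi>p (\<eta> x \<otimes> b))
    \<and> (\<forall>x b. L_right \<Phi>m (1 \<otimes> \<eta> x) b = \<Phi>m (\<eta> x \<otimes> b))
    \<and> (\<exists>\<psi>p. bimodule_map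
            (tensor_over_left p10 (omega10_left \<Psi>BV)) (tensor_over_right p10 omega10_right)
            L_left (L_right \<Phi>p) \<psi>p
          \<and> (\<forall>x. \<psi>p (p10 x) = phi \<Phi>p \<eta> (tensor_map (inv \<Psi>BV) id x)))
    \<and> (\<exists>\<psi>m. bimodule_map
            (tensor_over_left p01 omega01_left) (tensor_over_right p01 (omega01_right \<Psi>VB))
            L_left (L_right \<Phi>m) \<psi>m
          \<and> (\<forall>x. \<psi>m (p01 x) = phi \<Phi>m \<eta> (tensor_map id (inv \<Psi>VB) x)))"
proof -
  \<comment> \<open>The convolution inverse asserted by the definition is named here and stays fixed
    throughout.\<close>
  obtain R' where G: "cqt_bialgebra G R'"
    using assms(1) unfolding coquasitriangular_hopf_def hopf_algebra_def cqt_bialgebra_def by metis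
  interpret laurent_bialgebra G R' q \<alpha>
    by (intro laurent_bialgebra.intro G laurent_bialgebra_axioms.intro assms(2))
  let ?R' = "laurent_form q (- \<alpha>) R'"
  have \<delta>V_comodule: "right_comodule H \<delta>V"
    unfolding \<open>H = laurent_extension q \<alpha> G\<close> \<delta>V by (rule right_comodule_extend[OF assms(3)])
  interpret B: braided_symmetric_coaction "laurent_extension q \<alpha> G" ?R' \<delta>V \<pi>
    using \<delta>V_comodule assms(7) unfolding \<open>H = laurent_extension q \<alpha> G\<close> by unfold_locales
  have \<delta>B_comodule: "right_comodule (laurent_extension q \<alpha> G) \<delta>B" and \<delta>B_hom: "algebra_hom \<delta>B"
    unfolding \<delta>B by (rule B.right_comodule_quotient B.quotient_coaction_hom)+
  have \<eta>: "clinear \<eta>"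
    using assms(6) by (simp add: comodule_map_def)
  have D: "D_coaction = (\<lambda>z. z \<otimes> (1 \<otimes> tpow 2) :: complex \<otimes> 'g \<otimes> laurent)"
    by (rule ext) (simp add: D_coaction_def)
  \<comment> \<open>D is t^2 and its two evaluations are \<open>\<kappa> (2 * \<alpha>)\<close>; the
    opposite parameter gives the convolution inverse character.\<close>
  interpret F: invariant_form "laurent_extension q \<alpha> G" ?R' \<delta>V \<delta>B "1 \<otimes> tpow 2"
    "\<kappa> (2 * \<alpha>)" "\<kappa> (- (2 * \<alpha>))" \<eta>
    by (intro invariant_form.intro invariant_form_axioms.intro comodule.intro
        H.cqt_bialgebra_axioms \<delta>B_comodule \<delta>V_comodule[unfolded H] \<delta>B_hom \<eta> laurent_character_hom
        laurent_character_inverse rform_H_D form_invariant[OF assms(6)]) simp_all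
  show ?thesis
    unfolding \<Phi>p \<Phi>m \<Psi>BV \<Psi>VB \<open>H = laurent_extension q \<alpha> G\<close> D
  proof (intro conjI allI)
    show "bimodule L_left (L_right (inv (braid (laurent_extension q \<alpha> G) \<delta>B F.\<delta>D)))"
      by (rule F.holomorphic.bimodule_L)
    show "bimodule L_left (L_right (braid (laurent_extension q \<alpha> G) F.\<delta>D \<delta>B))"
      by (rule F.antiholomorphic.bimodule_L)
    show "L_right (inv (braid (laurent_extension q \<alpha> G) \<delta>B F.\<delta>D)) (1 \<otimes> \<eta> x) b
        = inv (braid (laurent_extension q \<alpha> G) \<delta>B F.\<delta>D) (\<eta> x \<otimes> b)" for x b
      by (rule L_right_unit[OF F.holomorphic.clinear_\<Phi>])
    show "L_right (braid (laurent_extension q \<alpha> G) F.\<delta>D \<delta>B) (1 \<otimes> \<eta> x) b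
        = braid (laurent_extension q \<alpha> G) F.\<delta>D \<delta>B (\<eta> x \<otimes> b)" for x b
      by (rule L_right_unit[OF F.antiholomorphic.clinear_\<Phi>])
  qed (rule F.holomorphic.bimodule_map_pairing F.antiholomorphic.bimodule_map_pairing,
      use assms(13,14) in \<open>simp add: \<Psi>BV \<Psi>VB H\<close>)+
qed

end
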